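(* Let $\Gamma$ be a discrete and free Abelian subgroup of $SL(3,\mathbb{R})$, generated by matrices with exclusively positive eigenvalues. - If $\Gamma$ is a cyclic group of type (1), (3), or (4), or if it is a $2$-generated group of type (1) or (3), then the Dirichlet-Selberg domain $DS(X,\Gamma)$ is finitely-sided for all $X\in\mathcal{P}(3)$. - If $\Gamma$ is a cyclic group of type (2) or (3'), or if it is a $2$-generated group of type (1'), (2) or (4), then the Dirichlet-Selberg domain $DS(X,\Gamma)$ is infinitely-sided for all $X$ in a dense and Zariski open subset of $\mathcal{P}(3)$.
   Context: $\mathcal{P}(3)=\{X\in Sym_3(\mathbb{R}):\det X=1,\ X>0\}$, with the action $g.X=g^TXg$ of $SL(3,\mathbb{R})$. Selberg's invariant: $s(X,Y)=\mathrm{tr}(X^{-1}Y)$. For a discrete subgroup $\Gamma$ and $X\in\mathcal{P}(3)$, $DS(X,\Gamma)=\{Y\in\mathcal{P}(3): s(X,Y)\le s(g.X,Y)\ \forall g\in\Gamma\}$; it is a convex polyhedron, i.e. the intersection of a locally finite collection of closed half-spaces $\{Y:\mathrm{tr}(AY)\ge0\}$. A facet of a convex polyhedron $P$ is a maximal subset of $\partial P$ that is itself a convex polyhedron; $P$ is finitely-sided (infinitely-sided) if it has finitely (infinitely) many facets. Types (a group has the given type if it is conjugate in $SL(3,\mathbb{R})$ to the group generated by the listed matrices). Cyclic groups: (1) $\begin{pmatrix}1&1&0\\0&1&0\\0&0&1\end{pmatrix}$; (2) $\begin{pmatrix}1&1&0\\0&1&1\\0&0&1\end{pmatrix}$; (3)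 $\mathrm{diag}(e^r,e^s,e^t)$ with $r+s+t=0$ and all of $r,s,t$ nonzero; (3') $\mathrm{diag}(e^s,e^{-s},1)$ with $s\ne0$; (4) $\begin{pmatrix}e^t&1&0\\0&e^t&0\\0&0&e^{-2t}\end{pmatrix}$, $t\neq0$. $2$-generated (non-cyclic) groups: (1) $\begin{pmatrix}1&1&0\\0&1&0\\0&0&1\end{pmatrix}$, $\begin{pmatrix}1&0&1\\0&1&0\\0&0&1\end{pmatrix}$; (1') $\begin{pmatrix}1&0&0\\0&1&1\\0&0&1\end{pmatrix}$, $\begin{pmatrix}1&0&1\\0&1&0\\0&0&1\end{pmatrix}$; (2) $\begin{pmatrix}1&1&0\\0&1&1\\0&0&1\end{pmatrix}$, $\begin{pmatrix}1&a&b\\0&1&a\\0&0&1\end{pmatrix}$ with $b\ne a(a-1)/2$; (3) $\mathrm{diag}(e^r,e^s,e^t)$, $\mathrm{diag}(e^{r'},e^{s'},e^{t'})$ with $r+s+t=r'+s'+t'=0$; (4) $\begin{pmatrix}e^t&1&0\\0&e^t&0\\0&0&e^{-2t}\end{pmatrix}$, $\begin{pmatrix}e^s&a&0\\0&e^s&0\\0&0&e^{-2s}\end{pmatrix}$ with $(s,t)\neq(0,0)$. All parameters are real. A Zariski open subset of $\mathcal{P}(3)$ is the complement in $\mathcal{P}(3)$ of the common zero set of polynomials in the matrix entries. *)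

theory Defs
  imports
    "HOL-Analysis.Analysis"
    "HOL-Algebra.Generated_Groups"
    "HOL-Algebra.Elementary_Groups"
    "HOL-Algebra.Free_Abelian_Groups"
begin

section \<open>The group $SL(3,\mathbb R)$\<close>

definition SL3 :: "(real^3^3) monoid" where
  "SL3 = \<lparr>carrier = {A. det A = 1}, monoid.mult = (**), one = mat 1\<rparr>"

lemma group_SL3: "group SL3"
proof (rule groupI)
  fix A assume A: "A \<in> carrier SL3"
  hence "invertible A"
    by (simp add: SL3_def invertible_det_nz)
  then obtain B where B: "A ** B = mat 1" "B ** A = mat 1"
    unfolding invertible_def by blast
  have "det B * det A = 1"
    using B(2) by (metis det_I det_mul)
  thus "\<exists>B\<in>carrier SL3. B \<otimes>\<^bsub>SL3\<^esub> A = \<one>\<^bsub>SL3\<^esub>"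
    using A B by (auto simp: SL3_def)
qed (auto simp: SL3_def det_mul matrix_mul_assoc)

definition conjugate_SL3 :: "(real^3^3) set \<Rightarrow> (real^3^3) set \<Rightarrow> bool" where
  "conjugate_SL3 \<Gamma> \<Delta> \<longleftrightarrow>
     (\<exists>h\<in>carrier SL3. \<Gamma> = (\<lambda>g. h \<otimes>\<^bsub>SL3\<^esub> g \<otimes>\<^bsub>SL3\<^esub> inv\<^bsub>SL3\<^esub> h) ` \<Delta>)"

text \<open>No generality is lost by taking the index set of a basis in the type of the group
  elements, since a basis of \<open>G\<close> is itself a subset of the carrier of \<open>G\<close>.\<close>
definition free_abelian :: "'a monoid \<Rightarrow> bool" where
  "free_abelian G \<longleftrightarrow> (\<exists>B::'a set. G \<cong> free_Abelian_group B)"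

definition complex_eigenvalue :: "real^3^3 \<Rightarrow> complex \<Rightarrow> bool" where
  "complex_eigenvalue A z \<longleftrightarrow>
     (\<exists>v::complex^3. v \<noteq> 0 \<and> map_matrix complex_of_real A *v v = z *s v)"

definition positive_eigenvalues :: "real^3^3 \<Rightarrow> bool" where
  "positive_eigenvalues A \<longleftrightarrow>
     (\<forall>z. complex_eigenvalue A z \<longrightarrow> z \<in> \<real> \<and> 0 < Re z)"

section \<open>The symmetric space and Dirichlet--Selberg domains\<close>

definition P3 :: "(real^3^3) set" where
  "P3 = {X. transpose X = X \<and> det X = 1 \<and> (\<forall>v. v \<noteq> 0 \<longrightarrow> 0 < v \<bullet> (X *v v))}"

definition act :: "real^3^3 \<Rightarrow> real^3^3 \<Rightarrow> real^3^3" where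
  "act g X = transpose g ** X ** g"

definition selberg :: "real^3^3 \<Rightarrow> real^3^3 \<Rightarrow> real" where
  "selberg X Y = trace (matrix_inv X ** Y)"

definition DS :: "real^3^3 \<Rightarrow> (real^3^3) set \<Rightarrow> (real^3^3) set" where
  "DS X \<Gamma> = {Y \<in> P3. \<forall>g\<in>\<Gamma>. selberg X Y \<le> selberg (act g X) Y}"

section \<open>Convex polyhedra in the symmetric space\<close>

definition half_space :: "real^3^3 \<Rightarrow> (real^3^3) set" where
  "half_space A = {Y \<in> P3. 0 \<le> trace (A ** Y)}"

definition hyperplane :: "real^3^3 \<Rightarrow> (real^3^3) set" where
  "hyperplane A = {Y \<in> P3. trace (A ** Y) = 0}"

text \<open>As usual for polyhedra, local finiteness of a collection of half-spaces refers to their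
  bounding hyperplanes: the half-spaces themselves may all contain a common point, as those
  cutting out a Dirichlet--Selberg domain do, and then an infinite collection of them is never
  locally finite as a family of sets. Lower-dimensional polyhedra are included, because both
  \<open>half_space A\<close> and \<open>half_space (- A)\<close> may occur.\<close>
definition convex_polyhedron :: "(real^3^3) set \<Rightarrow> bool" where
  "convex_polyhedron P \<longleftrightarrow>
     (\<exists>\<A>. (\<forall>A\<in>\<A>. transpose A = A \<and> A \<noteq> 0) \<and>
          locally_finite_in (top_of_set P3) (hyperplane ` \<A>) \<and>
          P = P3 \<inter> (\<Inter>A\<in>\<A>. half_space A))"

definition facet :: "(real^3^3) set \<Rightarrow> (real^3^3) set \<Rightarrow> bool" where
  "facet P F \<longleftrightarrow>
     convex_polyhedron F \<and> F \<subseteq> top_of_set P3 frontier_of P \<and>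
     (\<forall>G. convex_polyhedron G \<and> G \<subseteq> top_of_set P3 frontier_of P \<and> F \<subseteq> G \<longrightarrow> G = F)"

definition finitely_sided :: "(real^3^3) set \<Rightarrow> bool" where
  "finitely_sided P \<longleftrightarrow> convex_polyhedron P \<and> finite {F. facet P F}"

definition infinitely_sided :: "(real^3^3) set \<Rightarrow> bool" where
  "infinitely_sided P \<longleftrightarrow> convex_polyhedron P \<and> infinite {F. facet P F}"

text \<open>On \<^typ>\<open>real^3^3\<close>, the functions satisfying \<^const>\<open>real_polynomial_function\<close> are
  exactly the real polynomials in the nine matrix entries.\<close>
definition zariski_open_P3 :: "(real^3^3) set \<Rightarrow> bool" where
  "zariski_open_P3 U \<longleftrightarrow>
     (\<exists>Q. (\<forall>p\<in>Q. real_polynomial_function p) \<and> U = P3 - {X. \<forall>p\<in>Q. p X = 0})"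

definition dense_P3 :: "(real^3^3) set \<Rightarrow> bool" where
  "dense_P3 U \<longleftrightarrow> U \<subseteq> P3 \<and> top_of_set P3 closure_of U = P3"

section \<open>Types of subgroups\<close>

definition mat33 ::
  "real \<Rightarrow> real \<Rightarrow> real \<Rightarrow> real \<Rightarrow> real \<Rightarrow> real \<Rightarrow> real \<Rightarrow> real \<Rightarrow> real \<Rightarrow> real^3^3" where
  "mat33 a b c d e f g h i = vector [vector [a, b, c], vector [d, e, f], vector [g, h, i]]"

definition diag3 :: "real \<Rightarrow> real \<Rightarrow> real \<Rightarrow> real^3^3" where
  "diag3 a b c = mat33 a 0 0
                       0 b 0
                       0 0 c"

definition block_mat :: "real \<Rightarrow> real \<Rightarrow> real^3^3" where
  "block_mat t a = mat33 (exp t) a       0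
                         0       (exp t) 0
                         0       0       (exp (- 2 * t))"

definition cyclic_type_1 :: "(real^3^3) set \<Rightarrow> bool" where
  "cyclic_type_1 \<Gamma> \<longleftrightarrow>
     conjugate_SL3 \<Gamma> (generate SL3 {mat33 1 1 0
                                          0 1 0
                                          0 0 1})"

definition cyclic_type_2 :: "(real^3^3) set \<Rightarrow> bool" where
  "cyclic_type_2 \<Gamma> \<longleftrightarrow>
     conjugate_SL3 \<Gamma> (generate SL3 {mat33 1 1 0
                                          0 1 1
                                          0 0 1})"

definition cyclic_type_3 :: "(real^3^3) set \<Rightarrow> bool" where
  "cyclic_type_3 \<Gamma> \<longleftrightarrow>
     (\<exists>r s t. r + s + t = 0 \<and> r \<noteq> 0 \<and> s \<noteq> 0 \<and> t \<noteq> 0 \<and>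
        conjugate_SL3 \<Gamma> (generate SL3 {diag3 (exp r) (exp s) (exp t)}))"

definition cyclic_type_3' :: "(real^3^3) set \<Rightarrow> bool" where
  "cyclic_type_3' \<Gamma> \<longleftrightarrow>
     (\<exists>s. s \<noteq> 0 \<and> conjugate_SL3 \<Gamma> (generate SL3 {diag3 (exp s) (exp (- s)) 1}))"

definition cyclic_type_4 :: "(real^3^3) set \<Rightarrow> bool" where
  "cyclic_type_4 \<Gamma> \<longleftrightarrow>
     (\<exists>t. t \<noteq> 0 \<and> conjugate_SL3 \<Gamma> (generate SL3 {block_mat t 1}))"

text \<open>The two-generated types are types of non-cyclic groups. For types 3 and 4 this is a
  genuine restriction on the parameters.\<close>
definition two_generated_type :: "(real^3^3) set \<Rightarrow> real^3^3 \<Rightarrow> real^3^3 \<Rightarrow> bool" where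
  "two_generated_type \<Gamma> A B \<longleftrightarrow>
     \<not> cyclic_group (SL3\<lparr>carrier := \<Gamma>\<rparr>) \<and> conjugate_SL3 \<Gamma> (generate SL3 {A, B})"

definition two_type_1 :: "(real^3^3) set \<Rightarrow> bool" where
  "two_type_1 \<Gamma> \<longleftrightarrow>
     two_generated_type \<Gamma> (mat33 1 1 0
                                 0 1 0
                                 0 0 1)
                          (mat33 1 0 1
                                 0 1 0
                                 0 0 1)"

definition two_type_1' :: "(real^3^3) set \<Rightarrow> bool" where
  "two_type_1' \<Gamma> \<longleftrightarrow>
     two_generated_type \<Gamma> (mat33 1 0 0
                                 0 1 1
                                 0 0 1)
                          (mat33 1 0 1
                                 0 1 0
                                 0 0 1)"

definition two_type_2 :: "(real^3^3) set \<Rightarrow> bool" where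
  "two_type_2 \<Gamma> \<longleftrightarrow>
     (\<exists>a b. b \<noteq> a * (a - 1) / 2 \<and>
        two_generated_type \<Gamma> (mat33 1 1 0
                                    0 1 1
                                    0 0 1)
                             (mat33 1 a b
                                    0 1 a
                                    0 0 1))"

definition two_type_3 :: "(real^3^3) set \<Rightarrow> bool" where
  "two_type_3 \<Gamma> \<longleftrightarrow>
     (\<exists>r s t r' s' t'. r + s + t = 0 \<and> r' + s' + t' = 0 \<and>
        two_generated_type \<Gamma> (diag3 (exp r) (exp s) (exp t))
                             (diag3 (exp r') (exp s') (exp t')))"

definition two_type_4 :: "(real^3^3) set \<Rightarrow> bool" where
  "two_type_4 \<Gamma> \<longleftrightarrow>
     (\<exists>s t a. (s, t) \<noteq> (0, 0) \<and> two_generated_type \<Gamma> (block_mat t 1) (block_mat s a))"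

end

theory Submission
  imports Defs "HOL-Real_Asymp.Real_Asymp"
begin

text \<open>
  Put \<open>W = X\<^sup>-\<^sup>1\<close> and \<open>f(h) = tr (h W h\<^sup>T Y)\<close>. The domain \<open>DS X \<Gamma>\<close> consists of the \<open>Y\<close> at which
  \<open>f\<close> attains its minimum over \<open>\<Gamma>\<close> at the identity. Its facets are the maximal ones among its intersections with
  bisectors, every frontier point lies in a facet, and \<open>X\<close> is an interior point. Hence the domain is
  finitely-sided if and only if finitely many of the inequalities \<open>f(1) \<le> f(h)\<close> imply all of them.
  This condition is homogeneous in \<open>Y\<close>, and conjugating \<open>\<Gamma>\<close> only replaces \<open>W\<close> by a congruent matrix,
  so the standard groups remain.

  In the finitely-sided cases either \<open>f(h) - f(1)\<close> is a quadratic polynomial in the exponents with a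
  controlled leading part, or a violated inequality for a far element \<open>h\<close> forces some entries of \<open>Y\<close> to be
  so small that the inequality of a fixed element is violated too. In the infinitely-sided cases, for
  every finite subset of \<open>\<Gamma>\<close> a nearly degenerate \<open>Y\<close> satisfies the corresponding inequalities but violates
  that of a far element. This works for all \<open>W\<close> except for the types 3' and 4, where it requires the
  off-diagonal entries \<open>W$1$3\<close> and \<open>W$2$3\<close> not to vanish, which is the Zariski open condition.
\<close>

section \<open>Positive definite matrices and the trace form\<close>

text \<open>Types 1 and 1' show what decides the matter. For the first, the leading part of f(h) -
  f(1) is \<open>Y$1$1\<close> times a fixed form of \<open>W\<close>, so one scale controls all
  exponents. For the second it is \<open>W$3$3\<close> times the upper block of \<open>Y\<close>, an
  arbitrary form that may nearly degenerate along any direction.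

  The obstacle to finiteness is that constants must be uniform over the noncompact cone of all
  \<open>Y\<close>. For the types 3 and 4 this is met by comparing \<open>W\<close> with the
  identity, at the cost of two factors independent of \<open>Y\<close> and h. That suffices when
  some element of a fixed finite set shrinks all coordinates which a given far element does not blow
  up. The eigenvalue 1 of type 3' prevents this: the third coordinate is never scaled, so the mixed
  entries of \<open>W\<close>, which the comparison discards, decide.

  Forms of arbitrary determinant keep everything convex: sums, segments and small perturbations stay
  in the cone, and rescaling returns to determinant 1 without changing a sign.\<close>

lemma trace_matrix_mult_eq_inner: "trace (A ** B) = A \<bullet> transpose B" for A B :: "real^'n^'n"
  by (simp add: trace_def matrix_matrix_mult_def inner_vec_def transpose_def)

lemma matrix_mult_scaleR_left: "(c *\<^sub>R A) ** B = c *\<^sub>R (A ** B)" for A B :: "real^'n^'n"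
  by (simp add: vec_eq_iff matrix_matrix_mult_def sum_distrib_left mult.assoc)

lemma matrix_mult_scaleR_right: "A ** (c *\<^sub>R B) = c *\<^sub>R (A ** B)" for A B :: "real^'n^'n"
  by (simp add: vec_eq_iff matrix_matrix_mult_def sum_distrib_left mult_ac)

lemma trace_scaleR: "trace (c *\<^sub>R A) = c * trace A" for A :: "real^'n^'n"
  by (simp add: trace_def sum_distrib_left)

lemma transpose_add: "transpose (A + B) = transpose A + transpose B" for A B :: "real^'n^'n"
  by (simp add: transpose_def vec_eq_iff)

lemma transpose_diff: "transpose (A - B) = transpose A - transpose B" for A B :: "real^'n^'n"
  by (simp add: transpose_def vec_eq_iff)

lemma transpose_uminus: "transpose (- A) = - transpose A" for A :: "real^'n^'n"
  by (simp add: transpose_def vec_eq_iff)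

text \<open>The norm on matrices is the Frobenius norm, so Cauchy-Schwarz in each row
  suffices.\<close>

lemma norm_matrix_vector_mult_le: "norm (A *v v) \<le> norm A * norm v" for A :: "real^'n^'m"
proof -
  have "(norm (A *v v))\<^sup>2 = (\<Sum>i\<in>UNIV. (A $ i \<bullet> v)\<^sup>2)"
    unfolding power2_norm_eq_inner inner_vec_def[of "A *v v"]
    by (simp add: matrix_vector_mul_component power2_eq_square)
  also have "\<dots> \<le> (\<Sum>i\<in>UNIV. (norm (A $ i))\<^sup>2 * (norm v)\<^sup>2)"
  proof (rule sum_mono)
    fix i
    have "\<bar>A $ i \<bullet> v\<bar> \<le> norm (A $ i) * norm v" by (rule Cauchy_Schwarz_ineq2)
    then have "\<bar>A $ i \<bullet> v\<bar>\<^sup>2 \<le> (norm (A $ i) * norm v)\<^sup>2"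
      by (intro power_mono) auto
    then show "(A $ i \<bullet> v)\<^sup>2 \<le> (norm (A $ i))\<^sup>2 * (norm v)\<^sup>2" by (simp add: power_mult_distrib)
  qed
  also have "\<dots> = (norm A * norm v)\<^sup>2"
    by (simp add: power_mult_distrib norm_vec_def L2_set_def sum_nonneg sum_distrib_right)
  finally show ?thesis by (rule power2_le_imp_le) auto
qed

lemma norm_matrix_eq_columns: "(norm M)\<^sup>2 = (\<Sum>j\<in>UNIV. (norm (column j M))\<^sup>2)" for M :: "real^'n^'m"
  unfolding power2_norm_eq_inner inner_vec_def column_def by simp (rule sum.swap)

lemma norm_matrix_mult_le: "norm (A ** B) \<le> norm A * norm B" for A :: "real^'n^'m" and B :: "real^'k^'n"
proof -
  have "(norm (A ** B))\<^sup>2 = (\<Sum>j\<in>UNIV. (norm (A *v column j B))\<^sup>2)"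
    unfolding norm_matrix_eq_columns by (simp add: column_def matrix_matrix_mult_def matrix_vector_mult_def)
  also have "\<dots> \<le> (\<Sum>j\<in>UNIV. (norm A)\<^sup>2 * (norm (column j B))\<^sup>2)"
    by (intro sum_mono) (metis norm_ge_zero norm_matrix_vector_mult_le power_mono power_mult_distrib)
  also have "\<dots> = (norm A * norm B)\<^sup>2"
    by (simp add: power_mult_distrib norm_matrix_eq_columns[of B] sum_distrib_left)
  finally show ?thesis by (rule power2_le_imp_le) auto
qed

section \<open>The cone of positive definite matrices\<close>

abbreviation quadratic_form :: "real^'n^'n \<Rightarrow> real^'n \<Rightarrow> real" where
  "quadratic_form A v \<equiv> v \<bullet> (A *v v)"

text \<open>\<open>P3\<close> without its determinant condition: a convex cone, stable under the
  sums, rescalings and small perturbations on which the later constructions rely.\<close>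

definition pos_def :: "(real^'n^'n) set" where
  "pos_def = {X. transpose X = X \<and> (\<forall>v. v \<noteq> 0 \<longrightarrow> 0 < quadratic_form X v)}"

lemma P3_iff: "X \<in> P3 \<longleftrightarrow> X \<in> pos_def \<and> det X = 1"
  by (auto simp: P3_def pos_def_def)

lemma pos_def_symmetric: "X \<in> pos_def \<Longrightarrow> transpose X = X"
  by (simp add: pos_def_def)

lemma pos_def_pos: "X \<in> pos_def \<Longrightarrow> v \<noteq> 0 \<Longrightarrow> 0 < quadratic_form X v"
  by (simp add: pos_def_def)

lemma pos_def_nonneg: "X \<in> pos_def \<Longrightarrow> 0 \<le> quadratic_form X v"
  using pos_def_pos[of X v] by (cases "v = 0") auto

lemma pos_def_add: "X \<in> pos_def \<Longrightarrow> Y \<in> pos_def \<Longrightarrow> X + Y \<in> pos_def"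
  by (simp add: pos_def_def transpose_add matrix_vector_mult_add_rdistrib inner_add_right add_pos_pos)

lemma pos_def_scaleR: "X \<in> pos_def \<Longrightarrow> 0 < c \<Longrightarrow> c *\<^sub>R X \<in> pos_def"
  by (simp add: pos_def_def transpose_scalar flip: scaleR_matrix_vector_assoc)

lemma pos_def_mat_1: "mat 1 \<in> pos_def"
  by (simp add: pos_def_def)

lemma quadratic_form_congruence:
  "quadratic_form (transpose g ** X ** g) v = quadratic_form X (g *v v)" for X :: "real^'n^'n"
proof -
  have "(transpose g ** X ** g) *v v = transpose g *v (X *v (g *v v))"
    by (simp only: matrix_vector_mul_assoc matrix_mul_assoc)
  then show ?thesis
    by (metis dot_lmul_matrix inner_commute transpose_matrix_vector)
qed

lemma pos_def_congruence:
  fixes X :: "real^'n^'n"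
  assumes "X \<in> pos_def" "det g \<noteq> 0"
  shows "transpose g ** X ** g \<in> pos_def"
proof -
  have "g *v v \<noteq> 0" if "v \<noteq> 0" for v
    using assms(2) that by (metis invertible_det_nz invertible_def matrix_vector_mul_assoc
        matrix_vector_mul_lid matrix_vector_mult_0_right)
  then show ?thesis
    using assms(1) by (auto simp: pos_def_def quadratic_form_congruence matrix_transpose_mul matrix_mul_assoc)
qed

text \<open>The constant is the minimum of the form on the unit sphere, attained by compactness;
  homogeneity of degree two carries it to all vectors.\<close>

lemma pos_def_lower_bound:
  assumes "X \<in> pos_def"
  obtains \<epsilon> where "\<epsilon> > 0" "\<And>v. \<epsilon> * (norm v)\<^sup>2 \<le> quadratic_form X v"
proof -
  have cont: "continuous_on (sphere 0 1) (quadratic_form X)"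
    by (intro continuous_intros)
  have ne: "sphere 0 1 \<noteq> ({} :: (real^'a) set)"
    by (metis mem_sphere_0 norm_axis_1 empty_iff)
  obtain u where u: "u \<in> sphere 0 1" "\<forall>v\<in>sphere 0 1. quadratic_form X u \<le> quadratic_form X v"
    using continuous_attains_inf[OF compact_sphere ne cont] by blast
  show thesis
  proof
    show "quadratic_form X u > 0"
      using u by (intro pos_def_pos assms) auto
    show "quadratic_form X u * (norm v)\<^sup>2 \<le> quadratic_form X v" for v
    proof (cases "v = 0")
      case False
      have "quadratic_form X u \<le> quadratic_form X (v /\<^sub>R norm v)"
        using bspec[OF u(2), of "v /\<^sub>R norm v"] False by simp
      also have "\<dots> = quadratic_form X v / (norm v)\<^sup>2"
        by (simp add: matrix_vector_mult_scaleR power2_eq_square divide_inverse)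
      finally show ?thesis using False by (simp add: field_simps)
    qed auto
  qed
qed

lemma quadratic_form_upper_bound: "quadratic_form X v \<le> norm X * (norm v)\<^sup>2" for X :: "real^'n^'n"
proof -
  have "quadratic_form X v \<le> norm v * norm (X *v v)" by (rule norm_cauchy_schwarz)
  also have "\<dots> \<le> norm v * (norm X * norm v)"
    by (intro mult_left_mono norm_matrix_vector_mult_le) auto
  finally show ?thesis by (simp add: power2_eq_square mult_ac)
qed

lemma symmetric_nth:
  assumes "transpose X = X"
  shows "X$j$i = X$i$j"
proof -
  have "transpose X $ i $ j = X$i$j" by (simp only: assms)
  then show ?thesis by (simp add: transpose_def)
qed

lemma quadratic_form_3:
  fixes X :: "real^3^3"
  assumes "transpose X = X"
  shows "quadratic_form X v = X$1$1 * (v$1)\<^sup>2 + X$2$2 * (v$2)\<^sup>2 + X$3$3 * (v$3)\<^sup>2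
    + 2 * X$1$2 * v$1 * v$2 + 2 * X$1$3 * v$1 * v$3 + 2 * X$2$3 * v$2 * v$3"
proof -
  note sym = symmetric_nth[OF assms]
  show ?thesis
    unfolding sym[of 2 1] sym[of 3 1] sym[of 3 2]
    by (simp add: inner_vec_def matrix_vector_mult_def sum_3 power2_eq_square algebra_simps
        sym[of 2 1] sym[of 3 1] sym[of 3 2])
qed

lemma vec3_nonzero_iff: "(v::real^3) \<noteq> 0 \<longleftrightarrow> v$1 \<noteq> 0 \<or> v$2 \<noteq> 0 \<or> v$3 \<noteq> 0"
  by (simp add: vec_eq_iff forall_3)

lemma pos_def_minors:
  fixes X :: "real^3^3"
  assumes "X \<in> pos_def"
  shows "X$1$1 > 0" "X$2$2 > 0" "X$3$3 > 0"
    and "X$1$1 * X$2$2 - (X$1$2)\<^sup>2 > 0" "X$2$2 * X$3$3 - (X$2$3)\<^sup>2 > 0" "X$1$1 * X$3$3 - (X$1$3)\<^sup>2 > 0"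
proof -
  have P: "0 < X$1$1 * a\<^sup>2 + X$2$2 * b\<^sup>2 + X$3$3 * c\<^sup>2 + 2 * X$1$2 * a * b + 2 * X$1$3 * a * c + 2 * X$2$3 * b * c"
    if "a \<noteq> 0 \<or> b \<noteq> 0 \<or> c \<noteq> 0" for a b c
    using pos_def_pos[OF assms, of "vector [a,b,c]"] that
    by (simp add: vec3_nonzero_iff quadratic_form_3 pos_def_symmetric[OF assms])
  show 1: "X$1$1 > 0" "X$2$2 > 0" "X$3$3 > 0" using P[of 1 0 0] P[of 0 1 0] P[of 0 0 1] by auto
  \<comment> \<open>At this vector the form is \<open>X$1$1\<close> times the minor; the other two
    minors arise in the same way from other pairs of indices.\<close>
  have "X$1$1 * (X$1$1 * X$2$2 - (X$1$2)\<^sup>2) > 0"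
    using P[of "- X$1$2" "X$1$1" 0] 1 by (simp add: power2_eq_square algebra_simps)
  then show "X$1$1 * X$2$2 - (X$1$2)\<^sup>2 > 0" using 1 zero_less_mult_pos by blast
  have "X$2$2 * (X$2$2 * X$3$3 - (X$2$3)\<^sup>2) > 0"
    using P[of 0 "- X$2$3" "X$2$2"] 1 by (simp add: power2_eq_square algebra_simps)
  then show "X$2$2 * X$3$3 - (X$2$3)\<^sup>2 > 0" using 1 zero_less_mult_pos by blast
  have "X$1$1 * (X$1$1 * X$3$3 - (X$1$3)\<^sup>2) > 0"
    using P[of "- X$1$3" 0 "X$1$1"] 1 by (simp add: power2_eq_square algebra_simps)
  then show "X$1$1 * X$3$3 - (X$1$3)\<^sup>2 > 0" using 1 zero_less_mult_pos by blast
qed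

lemma det_symmetric_3:
  fixes X :: "real^3^3"
  assumes "transpose X = X"
  shows "det X = X$1$1 * X$2$2 * X$3$3 + 2 * X$1$2 * X$2$3 * X$1$3
    - X$1$1 * (X$2$3)\<^sup>2 - X$2$2 * (X$1$3)\<^sup>2 - X$3$3 * (X$1$2)\<^sup>2"
  using symmetric_nth[OF assms, of 2 1] symmetric_nth[OF assms, of 3 1] symmetric_nth[OF assms, of 3 2]
  by (simp add: det_3 power2_eq_square)

text \<open>The value of the form at the cross product of the first two rows is the product of two
  leading principal minors.\<close>

lemma pos_def_det_pos:
  fixes X :: "real^3^3"
  assumes "X \<in> pos_def"
  shows "det X > 0"
proof -
  note sym = pos_def_symmetric[OF assms]
  define d where "d = X$1$1 * X$2$2 - (X$1$2)\<^sup>2"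
  have d: "d > 0" using pos_def_minors[OF assms] by (simp add: d_def)
  define v :: "real^3" where
    "v = vector [X$1$2 * X$2$3 - X$1$3 * X$2$2, X$1$3 * X$1$2 - X$1$1 * X$2$3, d]"
  have v: "v$1 = X$1$2 * X$2$3 - X$1$3 * X$2$2" "v$2 = X$1$3 * X$1$2 - X$1$1 * X$2$3" "v$3 = d"
    by (auto simp: v_def)
  have "0 < quadratic_form X v"
    using d by (intro pos_def_pos assms) (simp add: vec3_nonzero_iff v)
  also have "quadratic_form X v = d * det X"
    unfolding quadratic_form_3[OF sym] det_symmetric_3[OF sym] v d_def by algebra
  finally show ?thesis using d zero_less_mult_pos by blast
qed

text \<open>Sylvester's criterion by Lagrange's reduction: \<open>X$1$1 * d\<close> times the form
  is a positive combination of the squares of \<open>l\<close>, \<open>m\<close> and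
  \<open>v$3\<close>, and these linear forms are triangular, hence vanish together only at
  0.\<close>

lemma pos_defI:
  fixes X :: "real^3^3"
  assumes sym: "transpose X = X" and a: "X$1$1 > 0" and b: "X$1$1 * X$2$2 - (X$1$2)\<^sup>2 > 0"
    and c: "det X > 0"
  shows "X \<in> pos_def"
proof -
  define d where "d = X$1$1 * X$2$2 - (X$1$2)\<^sup>2"
  have d: "d > 0" using b by (simp add: d_def)
  have "0 < quadratic_form X v" if "v \<noteq> 0" for v
  proof -
    define l where "l = X$1$1 * v$1 + X$1$2 * v$2 + X$1$3 * v$3"
    define m where "m = d * v$2 + (X$1$1 * X$2$3 - X$1$2 * X$1$3) * v$3"
    have eq: "X$1$1 * d * quadratic_form X v = d * l\<^sup>2 + m\<^sup>2 + X$1$1 * det X * (v$3)\<^sup>2"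
      unfolding quadratic_form_3[OF sym] det_symmetric_3[OF sym] l_def m_def d_def by algebra
    have "0 < d * l\<^sup>2 + m\<^sup>2 + X$1$1 * det X * (v$3)\<^sup>2"
    proof (cases "v$3 = 0")
      case False
      have "0 \<le> d * l\<^sup>2 + m\<^sup>2" using d by simp
      moreover have "0 < X$1$1 * det X * (v$3)\<^sup>2" using a c False by simp
      ultimately show ?thesis by linarith
    next
      case 3: True
      show ?thesis
      proof (cases "v$2 = 0")
        case False
        then have "0 < m\<^sup>2" using 3 d by (simp add: m_def)
        then have "0 < d * l\<^sup>2 + m\<^sup>2" using d by (simp add: add_nonneg_pos)
        then show ?thesis using 3 by simp
      next
        case True
        then have "v$1 \<noteq> 0" using that 3 by (simp add: vec3_nonzero_iff)
        then show ?thesis using a d 3 True by (simp add: l_def m_def)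
      qed
    qed
    then show ?thesis
      using eq a d by (metis mult_pos_pos zero_less_mult_pos)
  qed
  then show ?thesis using sym by (simp add: pos_def_def)
qed

lemma det_scaleR_3: "det (c *\<^sub>R X) = c ^ 3 * det X" for X :: "real^3^3"
  by (simp add: det_3 power3_eq_cube algebra_simps)

section \<open>The trace form and its comparison with the case of the identity\<close>

text \<open>With \<open>W\<close> the inverse of \<open>X\<close> this is the Selberg invariant of
  the translate of \<open>X\<close> by the inverse of \<open>h\<close>. In this shape it is linear
  in \<open>W\<close> and in \<open>Y\<close> and quadratic in the entries of
  \<open>h\<close>.\<close>

definition trace_form :: "real^3^3 \<Rightarrow> real^3^3 \<Rightarrow> real^3^3 \<Rightarrow> real" where
  "trace_form W Y h = trace (h ** W ** transpose h ** Y)"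

lemma trace_form_scaleR: "trace_form W (c *\<^sub>R Y) h = c * trace_form W Y h"
  by (simp add: trace_form_def matrix_mult_scaleR_right trace_scaleR)

lemma trace_form_add: "trace_form W (Y + Z) h = trace_form W Y h + trace_form W Z h"
  by (simp add: trace_form_def matrix_add_ldistrib trace_add)

text \<open>Cyclicity of the trace lets \<open>W\<close> and \<open>Y\<close> change places, so that
  \<open>W\<close> too can be read as a form evaluated at vectors.\<close>

lemma trace_form_swap:
  assumes "transpose W = W" "transpose Y = Y"
  shows "trace_form W Y h = trace_form Y W (transpose h)"
proof -
  have "trace_form W Y h = trace (W ** transpose h ** Y ** h)"
    unfolding trace_form_def by (metis matrix_mul_assoc trace_mul_sym)
  also have "\<dots> = trace (transpose h ** Y ** h ** W)"
    by (metis matrix_mul_assoc trace_mul_sym)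
  finally show ?thesis by (simp add: trace_form_def)
qed

lemma trace_form_mat_1_eq: "trace_form (mat 1) Y h = (\<Sum>j\<in>UNIV. quadratic_form Y (column j h))"
proof -
  have "trace_form (mat 1) Y h = trace (transpose h ** (Y ** h))"
    unfolding trace_form_def by (metis matrix_mul_assoc trace_mul_sym matrix_mul_rid)
  also have "\<dots> = (\<Sum>j\<in>UNIV. quadratic_form Y (column j h))"
    unfolding trace_def
    by (rule sum.cong[OF refl]) (simp add: matrix_matrix_mult_def inner_vec_def column_def transpose_def
        matrix_vector_mult_def)
  finally show ?thesis .
qed

lemma cholesky_3:
  fixes X :: "real^3^3"
  assumes "X \<in> pos_def"
  obtains M :: "real^3^3" where "X = M ** transpose M"
proof -
  note sym = pos_def_symmetric[OF assms] and m = pos_def_minors[OF assms]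
  define a where "a = sqrt (X$1$1)"
  define b where "b = X$1$2 / a"
  define c where "c = X$1$3 / a"
  define d where "d = sqrt (X$2$2 - b\<^sup>2)"
  define e where "e = (X$2$3 - b * c) / d"
  define f where "f = sqrt (X$3$3 - c\<^sup>2 - e\<^sup>2)"
  have a: "a > 0" "a\<^sup>2 = X$1$1" using m by (auto simp: a_def)
  have eq2: "X$1$1 * (X$2$2 - b\<^sup>2) = X$1$1 * X$2$2 - (X$1$2)\<^sup>2"
    using a m(1) by (simp add: b_def power_divide right_diff_distrib)
  have "X$2$2 - b\<^sup>2 > 0" using m(1,4) eq2 by (metis zero_less_mult_pos)
  then have d: "d > 0" "d\<^sup>2 = X$2$2 - b\<^sup>2" by (auto simp: d_def)
  have ab: "a * b = X$1$2" "a * c = X$1$3" "d * e = X$2$3 - b * c"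
    using a(1) d(1) by (auto simp: b_def c_def e_def)
  \<comment> \<open>The radicands are the pivots of the elimination; the last one is the determinant
    divided by the product of the first two, hence positive.\<close>
  have "det X = a\<^sup>2 * d\<^sup>2 * (X$3$3 - c\<^sup>2 - e\<^sup>2)"
  proof -
    have *: "X$2$2 = d\<^sup>2 + b\<^sup>2" "X$1$1 = a\<^sup>2" "X$2$3 = d * e + b * c" using a d ab by auto
    show ?thesis
      unfolding det_symmetric_3[OF sym] ab(1,2)[symmetric] * by algebra
  qed
  moreover have "a\<^sup>2 * d\<^sup>2 > 0" using a(1) d(1) by simp
  ultimately have "X$3$3 - c\<^sup>2 - e\<^sup>2 > 0"
    using pos_def_det_pos[OF assms] by (metis zero_less_mult_pos)
  then have f: "f\<^sup>2 = X$3$3 - c\<^sup>2 - e\<^sup>2" by (auto simp: f_def)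
  show thesis
  proof
    show "X = mat33 a 0 0 b d 0 c e f ** transpose (mat33 a 0 0 b d 0 c e f)"
      using a(2) d(2) f ab symmetric_nth[OF sym, of 2 1] symmetric_nth[OF sym, of 3 1] symmetric_nth[OF sym, of 3 2]
      by (simp add: vec_eq_iff forall_3 mat33_def matrix_matrix_mult_def sum_3 transpose_def
          power2_eq_square algebra_simps)
  qed
qed

lemma trace_form_gram:
  fixes M h :: "real^3^3"
  shows "trace_form (M ** transpose M) Y h = trace_form (mat 1) Y (h ** M)"
  by (simp add: trace_form_def matrix_transpose_mul matrix_mul_assoc)

text \<open>Factor \<open>Y = M ** transpose M\<close>. For every \<open>V\<close> at once the trace
  form is the sum of the values of \<open>V\<close> at the columns of
  \<open>transpose h ** M\<close>, so comparing \<open>W\<close> with the identity vector by vector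
  compares the sums, with constants that depend on \<open>W\<close> alone.\<close>

lemma trace_form_bounds:
  assumes "W \<in> pos_def"
  shows "\<exists>\<epsilon>>0. \<exists>C>0. \<forall>Y\<in>pos_def. \<forall>h. \<epsilon> * trace_form (mat 1) Y h \<le> trace_form W Y h
    \<and> trace_form W Y h \<le> C * trace_form (mat 1) Y h"
proof -
  obtain \<epsilon> where \<epsilon>: "\<epsilon> > 0" "\<And>v. \<epsilon> * (norm v)\<^sup>2 \<le> quadratic_form W v"
    using pos_def_lower_bound[OF assms] by blast
  have eq: "\<exists>f :: 3 \<Rightarrow> real^3. \<forall>V \<in> pos_def. trace_form V Y h = (\<Sum>j\<in>UNIV. quadratic_form V (f j))"
    if Y: "Y \<in> pos_def" for Y h :: "real^3^3"
  proof -
    obtain M :: "real^3^3" where M: "Y = M ** transpose M" using cholesky_3[OF Y] .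
    have "trace_form V Y h = (\<Sum>j\<in>UNIV. quadratic_form V (column j (transpose h ** M)))"
      if V: "V \<in> pos_def" for V
      using trace_form_swap[OF pos_def_symmetric[OF V] pos_def_symmetric[OF Y], of h]
        trace_form_mat_1_eq[of V "transpose h ** M"] trace_form_gram[of M V "transpose h"] M by simp
    then show ?thesis by (intro exI[of _ "\<lambda>j. column j (transpose h ** M)"]) auto
  qed
  show ?thesis
  proof (rule exI[of _ \<epsilon>], rule conjI, goal_cases)
    case 2
    show ?case
    proof (rule exI[of _ "norm W + 1"], intro conjI ballI allI)
    show "norm W + 1 > 0" using norm_ge_zero[of W] by linarith
    fix Y h :: "real^3^3" assume "Y \<in> pos_def"
    from eq[OF this, of h] obtain f :: "3 \<Rightarrow> real^3"
      where f: "\<forall>V \<in> pos_def. trace_form V Y h = (\<Sum>j\<in>UNIV. quadratic_form V (f j))" by blast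
    have 1: "trace_form (mat 1) Y h = (\<Sum>j\<in>UNIV. (norm (f j))\<^sup>2)"
      using f[rule_format, OF pos_def_mat_1] by (simp add: power2_norm_eq_inner)
    show "\<epsilon> * trace_form (mat 1) Y h \<le> trace_form W Y h"
      unfolding 1 f[rule_format, OF assms] sum_distrib_left by (intro sum_mono \<epsilon>)
    have "quadratic_form W (f j) \<le> (norm W + 1) * (norm (f j))\<^sup>2" for j
      using quadratic_form_upper_bound[of "f j" W] zero_le_power2[of "norm (f j)"] by (simp only: distrib_right)
    then show "trace_form W Y h \<le> (norm W + 1) * trace_form (mat 1) Y h"
      unfolding 1 f[rule_format, OF assms] sum_distrib_left by (intro sum_mono)
    qed
  qed (rule \<epsilon>)
qed

text \<open>Uniformity over a neighbourhood of \<open>Y\<close> is the point: it yields local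
  finiteness of the bisectors, not merely finiteness at each point.\<close>

lemma trace_form_coercive:
  assumes "W \<in> pos_def" "Y \<in> pos_def"
  obtains \<delta> where "\<delta> > 0" "\<And>Z h. Z \<in> pos_def \<Longrightarrow> norm (Z - Y) < \<delta> \<Longrightarrow> \<delta> * (norm h)\<^sup>2 \<le> trace_form W Z h"
proof -
  obtain \<epsilon> where \<epsilon>: "\<epsilon> > 0" "\<forall>Y\<in>pos_def. \<forall>h. \<epsilon> * trace_form (mat 1) Y h \<le> trace_form W Y h"
    using trace_form_bounds[OF assms(1)] by blast
  obtain \<eta> where \<eta>: "\<eta> > 0" "\<And>v. \<eta> * (norm v)\<^sup>2 \<le> quadratic_form Y v"
    using pos_def_lower_bound[OF assms(2)] by blast
  \<comment> \<open>The same number serves as radius, which costs at most half of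
    \<open>\<eta>\<close>, and as coercivity constant.\<close>
  define \<delta> where "\<delta> = min (\<eta> / 2) (\<epsilon> * \<eta> / 2)"
  show thesis
  proof
    show "\<delta> > 0" using \<epsilon> \<eta> by (simp add: \<delta>_def)
    fix Z h :: "real^3^3" assume Z: "Z \<in> pos_def" "norm (Z - Y) < \<delta>"
    have "\<eta> / 2 * (norm v)\<^sup>2 \<le> quadratic_form Z v" for v
    proof -
      have "quadratic_form (Y - Z) v \<le> norm (Y - Z) * (norm v)\<^sup>2" by (rule quadratic_form_upper_bound)
      also have "\<dots> \<le> \<eta> / 2 * (norm v)\<^sup>2"
        using Z by (intro mult_right_mono) (auto simp: \<delta>_def norm_minus_commute)
      finally show ?thesis using \<eta>(2)[of v] by (simp add: matrix_vector_mult_diff_rdistrib inner_diff_right)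
    qed
    then have "(\<Sum>j\<in>UNIV. \<eta> / 2 * (norm (column j h))\<^sup>2) \<le> trace_form (mat 1) Z h"
      unfolding trace_form_mat_1_eq by (intro sum_mono)
    then have "\<eta> / 2 * (norm h)\<^sup>2 \<le> trace_form (mat 1) Z h"
      unfolding norm_matrix_eq_columns[of h] sum_distrib_left .
    then have "\<epsilon> * (\<eta> / 2 * (norm h)\<^sup>2) \<le> trace_form W Z h"
      using \<epsilon>(1) \<epsilon>(2)[rule_format, OF Z(1), of h] mult_left_mono[of _ _ \<epsilon>]
      by (meson less_imp_le order_trans)
    moreover have "\<delta> * (norm h)\<^sup>2 \<le> \<epsilon> * (\<eta> / 2) * (norm h)\<^sup>2"
      by (intro mult_right_mono) (auto simp: \<delta>_def)
    ultimately show "\<delta> * (norm h)\<^sup>2 \<le> trace_form W Z h" by (metis mult.assoc order_trans)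
  qed
qed

section \<open>Inverses and discrete subgroups\<close>

text \<open>The adjugate, equal to the inverse on determinant 1. Its entries are polynomials, which
  gives continuity of inversion and the polynomial behind the Zariski open set.\<close>

definition adj3 :: "real^3^3 \<Rightarrow> real^3^3" where
  "adj3 A = mat33
     (A$2$2 * A$3$3 - A$2$3 * A$3$2) (A$1$3 * A$3$2 - A$1$2 * A$3$3) (A$1$2 * A$2$3 - A$1$3 * A$2$2)
     (A$2$3 * A$3$1 - A$2$1 * A$3$3) (A$1$1 * A$3$3 - A$1$3 * A$3$1) (A$1$3 * A$2$1 - A$1$1 * A$2$3)
     (A$2$1 * A$3$2 - A$2$2 * A$3$1) (A$1$2 * A$3$1 - A$1$1 * A$3$2) (A$1$1 * A$2$2 - A$1$2 * A$2$1)"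

lemma mat33_nth [simp]:
  "mat33 a b c d e f g h i $ 1 $ 1 = a" "mat33 a b c d e f g h i $ 1 $ 2 = b" "mat33 a b c d e f g h i $ 1 $ 3 = c"
  "mat33 a b c d e f g h i $ 2 $ 1 = d" "mat33 a b c d e f g h i $ 2 $ 2 = e" "mat33 a b c d e f g h i $ 2 $ 3 = f"
  "mat33 a b c d e f g h i $ 3 $ 1 = g" "mat33 a b c d e f g h i $ 3 $ 2 = h" "mat33 a b c d e f g h i $ 3 $ 3 = i"
  by (simp_all add: mat33_def)

lemma matrix_diff_ldistrib: "A ** (B - C) = A ** B - A ** C" for A B C :: "real^'n^'n"
  by (simp add: vec_eq_iff matrix_matrix_mult_def right_diff_distrib sum_subtractf)

lemma matrix_diff_rdistrib: "(B - C) ** A = B ** A - C ** A" for A B C :: "real^'n^'n"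
  by (simp add: vec_eq_iff matrix_matrix_mult_def left_diff_distrib sum_subtractf)

lemma mat33_eqI:
  fixes A B :: "real^3^3"
  assumes "A$1$1 = B$1$1" "A$1$2 = B$1$2" "A$1$3 = B$1$3"
    "A$2$1 = B$2$1" "A$2$2 = B$2$2" "A$2$3 = B$2$3"
    "A$3$1 = B$3$1" "A$3$2 = B$3$2" "A$3$3 = B$3$3"
  shows "A = B"
  using assms by (simp add: vec_eq_iff forall_3)

lemma matrix_mult_nth_3: "(A ** B) $ i $ j = A$i$1 * B$1$j + A$i$2 * B$2$j + A$i$3 * B$3$j" for A B :: "real^3^3"
  by (simp add: matrix_matrix_mult_def sum_3)

lemma mat_1_nth_3 [simp]:
  "(mat 1 :: real^3^3)$1$1 = 1" "(mat 1 :: real^3^3)$1$2 = 0" "(mat 1 :: real^3^3)$1$3 = 0"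
  "(mat 1 :: real^3^3)$2$1 = 0" "(mat 1 :: real^3^3)$2$2 = 1" "(mat 1 :: real^3^3)$2$3 = 0"
  "(mat 1 :: real^3^3)$3$1 = 0" "(mat 1 :: real^3^3)$3$2 = 0" "(mat 1 :: real^3^3)$3$3 = 1"
  by (simp_all add: mat_def)

lemma transpose_nth [simp]: "transpose A $ i $ j = A $ j $ i"
  by (simp add: transpose_def)

lemma adj3_mult:
  assumes "det A = 1"
  shows "adj3 A ** A = mat 1" "A ** adj3 A = mat 1"
  using assms by (intro mat33_eqI; simp add: matrix_mult_nth_3 adj3_def det_3 algebra_simps)+

lemma matrix_inv_unique:
  fixes A B :: "real^'n^'n"
  assumes "A ** B = mat 1" "B ** A = mat 1"
  shows "matrix_inv A = B"
proof -
  have "A ** matrix_inv A = mat 1 \<and> matrix_inv A ** A = mat 1"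
    unfolding matrix_inv_def by (rule someI[of _ B]) (use assms in auto)
  then show ?thesis
    by (metis assms(2) matrix_mul_assoc matrix_mul_lid matrix_mul_rid)
qed

lemma matrix_inv_eq_adj3: "det A = 1 \<Longrightarrow> matrix_inv A = adj3 A"
  by (intro matrix_inv_unique adj3_mult)

lemma det_adj3: "det A = 1 \<Longrightarrow> det (adj3 A) = 1"
  by (metis adj3_mult(1) det_I det_mul mult.right_neutral)

lemma adj3_adj3: "det A = 1 \<Longrightarrow> adj3 (adj3 A) = A"
  by (metis adj3_mult det_adj3 matrix_inv_eq_adj3 matrix_inv_unique)

lemma adj3_matrix_mult: "det A = 1 \<Longrightarrow> det B = 1 \<Longrightarrow> adj3 (A ** B) = adj3 B ** adj3 A"
  by (metis (no_types, lifting) adj3_mult det_mul matrix_inv_eq_adj3 matrix_inv_unique matrix_mul_assoc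
      matrix_mul_lid mult.right_neutral)

lemma adj3_transpose: "adj3 (transpose A) = transpose (adj3 A)"
  by (intro mat33_eqI) (simp_all add: adj3_def)

lemma SL3_simps [simp]:
  "A \<in> carrier SL3 \<longleftrightarrow> det A = 1" "A \<otimes>\<^bsub>SL3\<^esub> B = A ** B" "\<one>\<^bsub>SL3\<^esub> = mat 1"
  by (simp_all add: SL3_def)

lemma inv_SL3: "det A = 1 \<Longrightarrow> inv\<^bsub>SL3\<^esub> A = adj3 A"
  by (rule group.inv_equality[OF group_SL3]) (simp_all add: adj3_mult det_adj3)

lemma subgroup_SL3D:
  assumes "subgroup \<Gamma> SL3"
  shows "g \<in> \<Gamma> \<Longrightarrow> det g = 1" "mat 1 \<in> \<Gamma>" "g \<in> \<Gamma> \<Longrightarrow> h \<in> \<Gamma> \<Longrightarrow> g ** h \<in> \<Gamma>" "g \<in> \<Gamma> \<Longrightarrow> adj3 g \<in> \<Gamma>"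
proof -
  show 1: "det g = 1" if "g \<in> \<Gamma>" for g
    using subgroup.mem_carrier[OF assms that] by simp
  show "mat 1 \<in> \<Gamma>" using subgroup.one_closed[OF assms] by simp
  show "g ** h \<in> \<Gamma>" if "g \<in> \<Gamma>" "h \<in> \<Gamma>" for g h using subgroup.m_closed[OF assms that] by simp
  show "adj3 g \<in> \<Gamma>" if "g \<in> \<Gamma>" for g
    using subgroup.m_inv_closed[OF assms that] 1[OF that] by (simp add: inv_SL3)
qed

lemma continuous_on_adj3: "continuous_on S adj3"
proof -
  have c: "continuous_on S (\<lambda>A. adj3 A $ i $ j)" for i j
    using exhaust_3[of i] exhaust_3[of j]
    by (elim disjE; hypsubst; simp only: adj3_def mat33_nth; intro continuous_intros)
  have "continuous_on S (\<lambda>A. \<chi> i j. adj3 A $ i $ j)"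
    by (intro continuous_on_vec_lambda c)
  then show ?thesis by (simp add: vec_lambda_eta)
qed

text \<open>If \<open>g\<close> and \<open>h\<close> are close and bounded, then
  \<open>adj3 g ** h\<close> is close to the identity. So the isolation of the identity spreads to a
  uniform gap on the bounded part; a bounded uniformly discrete set is compact and discrete, hence
  finite.\<close>

lemma discrete_subgroup_finite_bounded:
  assumes \<Gamma>: "subgroup \<Gamma> SL3" "discrete \<Gamma>"
  shows "finite {g\<in>\<Gamma>. norm g \<le> R}"
proof -
  note sub = subgroup_SL3D[OF \<Gamma>(1)]
  let ?S = "{g\<in>\<Gamma>. norm g \<le> R}"
  obtain e where e: "e > 0" "\<And>y. y \<in> \<Gamma> \<Longrightarrow> dist (mat 1) y < e \<Longrightarrow> y = mat 1"
    using isolated_inE_dist[OF discreteD[OF \<Gamma>(2) sub(2)]] by blast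
  have "bounded (adj3 ` cball 0 R)"
    by (intro compact_imp_bounded compact_continuous_image continuous_on_adj3 compact_cball)
  then obtain C where C: "C > 0" "\<forall>x\<in>adj3 ` cball 0 R. norm x \<le> C"
    using bounded_pos by blast
  have eq: "h = g" if "g \<in> ?S" "h \<in> ?S" "dist g h < e / C" for g h
  proof -
    have det: "det g = 1" "det h = 1" using that sub(1) by auto
    have "adj3 g ** h - mat 1 = adj3 g ** (h - g)"
      using adj3_mult(1)[OF det(1)] by (simp add: matrix_diff_ldistrib)
    then have "dist (mat 1) (adj3 g ** h) \<le> norm (adj3 g) * norm (h - g)"
      by (metis dist_norm dist_commute norm_matrix_mult_le)
    also have "\<dots> \<le> C * norm (h - g)"
      using C(2) that(1) by (intro mult_right_mono) auto
    also have "\<dots> < e"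
      using that(3) C(1) by (simp add: dist_norm norm_minus_commute pos_less_divide_eq mult.commute)
    finally have "adj3 g ** h = mat 1"
      using e(2) that sub(3,4) by blast
    then show "h = g"
      using adj3_mult(2)[OF det(1)] by (metis matrix_mul_assoc matrix_mul_lid matrix_mul_rid)
  qed
  have "uniform_discrete ?S"
    unfolding uniform_discrete_def using e(1) C(1) eq by (metis (no_types, lifting) divide_pos_pos)
  then have "discrete ?S" "closed ?S"
    using uniform_discrete_imp_closed uniform_discrete_imp_discrete by blast+
  moreover have "bounded ?S" unfolding bounded_iff by blast
  ultimately show ?thesis
    using discrete_compact_finite_iff compact_eq_bounded_closed by blast
qed

text \<open>The inverse of \<open>X\<close> is the congruence of \<open>X\<close> by that
  inverse.\<close>

lemma P3_adj3:
  assumes "X \<in> P3"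
  shows "adj3 X \<in> P3"
proof -
  have det: "det X = 1" and sym: "transpose X = X" and X: "X \<in> pos_def"
    using assms by (auto simp: P3_iff pos_def_symmetric)
  have "adj3 X = transpose (adj3 X) ** X ** adj3 X"
    using adj3_mult(1)[OF det] by (simp add: sym flip: adj3_transpose)
  then show ?thesis
    using pos_def_congruence[OF X, of "adj3 X"] det_adj3[OF det] by (simp add: P3_iff)
qed

lemma selberg_act:
  assumes "X \<in> P3" "det g = 1"
  shows "selberg (act g X) Y = trace_form (adj3 X) Y (adj3 g)"
proof -
  have det: "det X = 1" using assms by (simp add: P3_iff)
  have "adj3 (act g X) = adj3 g ** adj3 X ** transpose (adj3 g)"
    using assms(2) det by (simp add: act_def adj3_matrix_mult det_mul adj3_transpose matrix_mul_assoc)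
  moreover have "det (act g X) = 1" using assms det by (simp add: act_def det_mul)
  ultimately show ?thesis
    by (simp add: selberg_def matrix_inv_eq_adj3 trace_form_def)
qed

lemma selberg_eq: "X \<in> P3 \<Longrightarrow> selberg X Y = trace_form (adj3 X) Y (mat 1)"
  by (simp add: P3_iff selberg_def matrix_inv_eq_adj3 trace_form_def)

text \<open>The Selberg inequality for \<open>g\<close> is the trace form inequality for the inverse
  of \<open>g\<close>, and a group contains inverses.\<close>

lemma DS_eq:
  assumes "subgroup \<Gamma> SL3" "X \<in> P3"
  shows "DS X \<Gamma> = {Y \<in> P3. \<forall>h\<in>\<Gamma>. trace_form (adj3 X) Y (mat 1) \<le> trace_form (adj3 X) Y h}"
proof -
  note sub = subgroup_SL3D[OF assms(1)]
  have "(\<forall>g\<in>\<Gamma>. selberg X Y \<le> selberg (act g X) Y) \<longleftrightarrow>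
      (\<forall>h\<in>\<Gamma>. trace_form (adj3 X) Y (mat 1) \<le> trace_form (adj3 X) Y h)" (is "?L \<longleftrightarrow> ?R") for Y
  proof
    assume L: ?L
    show ?R
    proof
      fix h assume h: "h \<in> \<Gamma>"
      show "trace_form (adj3 X) Y (mat 1) \<le> trace_form (adj3 X) Y h"
        using bspec[OF L sub(4)[OF h]] selberg_act[OF assms(2) det_adj3[OF sub(1)[OF h]]]
        by (simp add: selberg_eq[OF assms(2)] adj3_adj3[OF sub(1)[OF h]])
    qed
  next
    assume R: ?R
    show ?L
    proof
      fix h assume h: "h \<in> \<Gamma>"
      show "selberg X Y \<le> selberg (act h X) Y"
        using bspec[OF R sub(4)[OF h]] selberg_act[OF assms(2) sub(1)[OF h]]
        by (simp add: selberg_eq[OF assms(2)])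
    qed
  qed
  then show ?thesis unfolding DS_def by auto
qed

section \<open>Facets of polyhedra in the symmetric space\<close>

lemma trace_mult_add_right: "trace (A ** (Y + Z)) = trace (A ** Y) + trace (A ** Z)" for A :: "real^'n^'n"
  by (simp add: matrix_add_ldistrib trace_add)

lemma trace_mult_scaleR_right: "trace (A ** (c *\<^sub>R Y)) = c * trace (A ** Y)" for A :: "real^'n^'n"
  by (simp add: matrix_mult_scaleR_right trace_scaleR)

lemma trace_mult_sum_right: "trace (A ** sum f I) = (\<Sum>i\<in>I. trace (A ** f i))" for A :: "real^'n^'n"
  by (rule linear_sum) (simp add: linear_iff trace_mult_add_right trace_mult_scaleR_right)

lemma pos_def_add_sum:
  assumes "finite I" "Y \<in> pos_def" "\<And>i. i \<in> I \<Longrightarrow> f i \<in> pos_def"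
  shows "Y + sum f I \<in> pos_def"
  using assms(1,3)
proof (induction I)
  case (insert i I)
  then have "f i + (Y + sum f I) \<in> pos_def" by (rule_tac pos_def_add) auto
  then show ?case using insert.hyps by (simp add: add.left_commute)
qed (simp add: assms(2))

lemma continuous_on_trace_mult: "continuous_on S (\<lambda>Z. trace (A ** Z))" for A :: "real^'n^'n"
  unfolding trace_def matrix_matrix_mult_def by (simp, intro continuous_intros)

text \<open>The radial projection of the cone onto \<open>P3\<close>; the determinant is homogeneous
  of degree 3. The bounding hyperplanes are linear, so a point and its projection lie on the same
  side of each.\<close>

definition normalized :: "real^3^3 \<Rightarrow> real^3^3" where
  "normalized X = inverse (root 3 (det X)) *\<^sub>R X"

lemma normalized_P3:
  assumes "X \<in> pos_def"
  shows "normalized X \<in> P3"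
proof -
  have 1: "root 3 (det X) > 0" using pos_def_det_pos[OF assms] by simp
  moreover have "inverse (root 3 (det X)) ^ 3 * det X = 1"
    using pos_def_det_pos[OF assms] by (simp add: power_inverse)
  ultimately show ?thesis
    using pos_def_scaleR[OF assms, of "inverse (root 3 (det X))"]
    by (auto simp: normalized_def P3_iff det_scaleR_3)
qed

lemma isCont_normalized:
  assumes "X \<in> pos_def"
  shows "isCont normalized X"
proof -
  have "isCont (\<lambda>X::real^3^3. root 3 (det X)) X"
    unfolding det_3 by (intro continuous_intros)
  then have "isCont (\<lambda>X::real^3^3. inverse (root 3 (det X))) X"
    by (rule continuous_at_within_inverse) (use pos_def_det_pos[OF assms] in simp)
  then show ?thesis
    unfolding normalized_def by (rule continuous_scaleR) (rule continuous_ident)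
qed

lemma normalized_eq: "X \<in> P3 \<Longrightarrow> normalized X = X"
  by (simp add: normalized_def P3_iff)

lemma trace_normalized_iff:
  assumes "X \<in> pos_def"
  shows "0 < trace (A ** normalized X) \<longleftrightarrow> 0 < trace (A ** X)"
    and "0 \<le> trace (A ** normalized X) \<longleftrightarrow> 0 \<le> trace (A ** X)"
    and "trace (A ** normalized X) = 0 \<longleftrightarrow> trace (A ** X) = 0"
  using pos_def_det_pos[OF assms]
  by (auto simp: normalized_def trace_mult_scaleR_right zero_less_mult_iff zero_le_mult_iff)

lemma eventually_pos_def:
  assumes "Y \<in> pos_def" "transpose B = B"
  shows "\<forall>\<^sub>F t in at_right (0::real). Y + t *\<^sub>R B \<in> pos_def"
proof -
  obtain \<epsilon> where \<epsilon>: "\<epsilon> > 0" "\<And>v. \<epsilon> * (norm v)\<^sup>2 \<le> quadratic_form Y v"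
    using pos_def_lower_bound[OF assms(1)] by blast
  have "\<forall>\<^sub>F t in at_right (0::real). t < \<epsilon> / (norm B + 1) \<and> t > 0"
    using \<epsilon>(1) by (intro eventually_conj eventually_at_right_less order_tendstoD[OF tendsto_ident_at])
      (auto intro!: divide_pos_pos add_nonneg_pos)
  then show ?thesis
  proof eventually_elim
    case (elim t)
    have pos: "norm B + 1 > 0" by (simp add: add_nonneg_pos)
    have "t * (norm B + 1) < \<epsilon>" using elim pos by (simp add: pos_less_divide_eq)
    have "0 < quadratic_form (Y + t *\<^sub>R B) v" if "v \<noteq> 0" for v
    proof -
      have "quadratic_form (- B) v \<le> norm (- B) * (norm v)\<^sup>2" by (rule quadratic_form_upper_bound)
      then have "- quadratic_form B v \<le> norm B * (norm v)\<^sup>2"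
        by (simp add: matrix_vector_mult_diff_rdistrib[of 0 B, simplified])
      then have "t * - quadratic_form B v \<le> t * (norm B * (norm v)\<^sup>2)"
        using elim by (intro mult_left_mono) auto
      also have "\<dots> \<le> t * (norm B + 1) * (norm v)\<^sup>2" using elim by (simp add: algebra_simps)
      also have "\<dots> < \<epsilon> * (norm v)\<^sup>2" using \<open>t * (norm B + 1) < \<epsilon>\<close> that by (intro mult_strict_right_mono) auto
      also have "\<dots> \<le> quadratic_form Y v" by (rule \<epsilon>)
      finally show ?thesis
        by (simp add: matrix_vector_mult_add_rdistrib inner_add_right flip: scaleR_matrix_vector_assoc)
    qed
    then show ?case
      using assms pos_def_symmetric[OF assms(1)] by (simp add: pos_def_def transpose_add transpose_scalar)
  qed
qed

text \<open>Local finiteness counts the functionals that are nonpositive somewhere near a point, not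
  only those vanishing there. This form also bounds the number of inequalities violated at a point
  outside the polyhedron, and it implies the condition on hyperplanes.\<close>

locale polyhedral_family =
  fixes \<A> :: "(real^3^3) set"
  assumes symmetric: "A \<in> \<A> \<Longrightarrow> transpose A = A" and nonzero: "A \<in> \<A> \<Longrightarrow> A \<noteq> 0"
    and locally_finite: "Y \<in> P3 \<Longrightarrow>
      \<exists>\<delta>>0. finite {A\<in>\<A>. \<exists>Z\<in>P3. norm (Z - Y) < \<delta> \<and> trace (A ** Z) \<le> 0}"
begin

definition polyhedron :: "(real^3^3) set" where
  "polyhedron = P3 \<inter> (\<Inter>A\<in>\<A>. half_space A)"

lemma polyhedron_iff: "Y \<in> polyhedron \<longleftrightarrow> Y \<in> P3 \<and> (\<forall>A\<in>\<A>. 0 \<le> trace (A ** Y))"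
  by (auto simp: polyhedron_def half_space_def)

lemma finite_nonpos: "Y \<in> P3 \<Longrightarrow> finite {A\<in>\<A>. trace (A ** Y) \<le> 0}"
proof -
  assume Y: "Y \<in> P3"
  obtain \<delta> where "\<delta> > 0" "finite {A\<in>\<A>. \<exists>Z\<in>P3. norm (Z - Y) < \<delta> \<and> trace (A ** Z) \<le> 0}"
    using locally_finite[OF Y] by blast
  then show ?thesis using Y by (elim finite_subset[rotated]) (auto intro!: bexI[of _ Y])
qed

lemma locally_finite_hyperplanes: "locally_finite_in (top_of_set P3) (hyperplane ` \<A>)"
  unfolding locally_finite_in_def
proof (intro conjI ballI)
  show "\<Union> (hyperplane ` \<A>) \<subseteq> topspace (top_of_set P3)" by (auto simp: hyperplane_def)
  fix Y assume "Y \<in> topspace (top_of_set P3)"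
  then have Y: "Y \<in> P3" by simp
  obtain \<delta> where \<delta>: "\<delta> > 0" "finite {A\<in>\<A>. \<exists>Z\<in>P3. norm (Z - Y) < \<delta> \<and> trace (A ** Z) \<le> 0}"
    using locally_finite[OF Y] by blast
  show "\<exists>V. openin (top_of_set P3) V \<and> Y \<in> V \<and> finite {U \<in> hyperplane ` \<A>. U \<inter> V \<noteq> {}}"
  proof (intro exI conjI)
    show "openin (top_of_set P3) (P3 \<inter> ball Y \<delta>)" by (simp add: openin_open_Int)
    show "Y \<in> P3 \<inter> ball Y \<delta>" using Y \<delta> by simp
    have "{U \<in> hyperplane ` \<A>. U \<inter> (P3 \<inter> ball Y \<delta>) \<noteq> {}}
        \<subseteq> hyperplane ` {A\<in>\<A>. \<exists>Z\<in>P3. norm (Z - Y) < \<delta> \<and> trace (A ** Z) \<le> 0}"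
      by (fastforce simp: hyperplane_def dist_norm norm_minus_commute)
    then show "finite {U \<in> hyperplane ` \<A>. U \<inter> (P3 \<inter> ball Y \<delta>) \<noteq> {}}"
      using \<delta>(2) finite_subset by blast
  qed
qed

lemma convex_polyhedron_polyhedron: "convex_polyhedron polyhedron"
  unfolding convex_polyhedron_def polyhedron_def
  using symmetric nonzero locally_finite_hyperplanes by blast

text \<open>Adjoining the opposite half-space cuts out the face and adds no new bounding hyperplane,
  so local finiteness is inherited.\<close>

lemma convex_polyhedron_face:
  assumes A: "A \<in> \<A>"
  shows "convex_polyhedron (polyhedron \<inter> hyperplane A)"
proof -
  have "hyperplane (- A) = hyperplane A"
    by (auto simp: hyperplane_def trace_matrix_mult_eq_inner)
  then have "hyperplane ` (insert (- A) \<A>) = hyperplane ` \<A>" using A by auto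
  moreover have "half_space A \<inter> half_space (- A) = hyperplane A"
    by (auto simp: hyperplane_def half_space_def trace_matrix_mult_eq_inner)
  then have "polyhedron \<inter> hyperplane A = P3 \<inter> (\<Inter>B\<in>insert (- A) \<A>. half_space B)"
    using A by (auto simp: polyhedron_def)
  ultimately show ?thesis
    unfolding convex_polyhedron_def using symmetric nonzero locally_finite_hyperplanes A
    by (intro exI[of _ "insert (- A) \<A>"]) (auto simp: transpose_uminus)
qed

text \<open>Where all functionals are positive, only finitely many can turn nonpositive nearby, so a
  neighbourhood stays inside. Where some \<open>A\<close> vanishes, a small step in the direction
  \<open>- A\<close> leaves the polyhedron.\<close>

lemma frontier_iff:
  "Y \<in> top_of_set P3 frontier_of polyhedron \<longleftrightarrow> Y \<in> polyhedron \<and> (\<exists>A\<in>\<A>. trace (A ** Y) = 0)"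
proof -
  have "polyhedron = P3 \<inter> (\<Inter>A\<in>\<A>. {Z. 0 \<le> trace (A ** Z)})"
    by (auto simp: polyhedron_iff)
  moreover have "closed (\<Inter>A\<in>\<A>. {Z. 0 \<le> trace (A ** Z)})"
    by (intro closed_INT ballI closed_Collect_le continuous_on_const continuous_on_trace_mult)
  ultimately have "closedin (top_of_set P3) polyhedron"
    by (metis closedin_closed_Int)
  then have fr: "top_of_set P3 frontier_of polyhedron = polyhedron - top_of_set P3 interior_of polyhedron"
    by (simp add: frontier_of_def closure_of_closedin)
  have "Y \<in> top_of_set P3 interior_of polyhedron \<longleftrightarrow> (\<forall>A\<in>\<A>. trace (A ** Y) \<noteq> 0)"
    if Y: "Y \<in> polyhedron"
  proof
    have P3: "Y \<in> P3" using Y by (simp add: polyhedron_iff)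
    assume ne: "\<forall>A\<in>\<A>. trace (A ** Y) \<noteq> 0"
    then have pos: "0 < trace (A ** Y)" if "A \<in> \<A>" for A using Y that by (force simp: polyhedron_iff)
    obtain \<delta> where \<delta>: "\<delta> > 0" "finite {A\<in>\<A>. \<exists>Z\<in>P3. norm (Z - Y) < \<delta> \<and> trace (A ** Z) \<le> 0}"
      (is "finite ?F") using locally_finite[OF P3] by blast
    let ?O = "ball Y \<delta> \<inter> (\<Inter>A\<in>?F. {Z. 0 < trace (A ** Z)})"
    have "open ?O"
      by (intro open_Int open_ball open_INT \<delta> ballI open_Collect_less continuous_on_const continuous_on_trace_mult)
    moreover have "P3 \<inter> ?O \<subseteq> polyhedron"
    proof
      fix Z assume Z: "Z \<in> P3 \<inter> ?O"
      have "0 \<le> trace (A ** Z)" if "A \<in> \<A>" for A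
      proof (rule ccontr)
        assume "\<not> ?thesis"
        then have "trace (A ** Z) < 0" by simp
        moreover from this have "A \<in> ?F" using Z that
          by (auto simp: dist_norm norm_minus_commute intro!: bexI[of _ Z])
        ultimately show False using Z by force
      qed
      then show "Z \<in> polyhedron" using Z by (auto simp: polyhedron_iff)
    qed
    moreover have "Y \<in> P3 \<inter> ?O" using P3 \<delta>(1) pos by auto
    ultimately show "Y \<in> top_of_set P3 interior_of polyhedron"
      unfolding interior_of_def by (auto intro!: exI[of _ "P3 \<inter> ?O"] openin_open_Int)
  next
    have P3: "Y \<in> P3" using Y by (simp add: polyhedron_iff)
    then have PD: "Y \<in> pos_def" by (simp add: P3_iff)
    assume int: "Y \<in> top_of_set P3 interior_of polyhedron"
    show "\<forall>A\<in>\<A>. trace (A ** Y) \<noteq> 0"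
    proof (intro ballI notI)
      fix A assume A: "A \<in> \<A>" "trace (A ** Y) = 0"
      obtain T where T: "openin (top_of_set P3) T" "Y \<in> T" "T \<subseteq> polyhedron"
        using int unfolding interior_of_def by blast
      then obtain O' where O': "open O'" "T = P3 \<inter> O'" by (metis openin_open)
      have lim: "((\<lambda>t. Y + t *\<^sub>R (- A)) \<longlongrightarrow> Y + 0 *\<^sub>R (- A)) (at_right (0::real))"
        by (intro tendsto_intros)
      have "((\<lambda>t. normalized (Y + t *\<^sub>R (- A))) \<longlongrightarrow> normalized Y) (at_right (0::real))"
        using isCont_tendsto_compose[OF isCont_normalized lim] PD by simp
      then have "\<forall>\<^sub>F t in at_right (0::real). normalized (Y + t *\<^sub>R (- A)) \<in> O'"
        by (rule topological_tendstoD) (use O' T(2) normalized_eq[OF P3] in auto)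
      moreover have "\<forall>\<^sub>F t in at_right (0::real). Y + t *\<^sub>R (- A) \<in> pos_def"
        using symmetric[OF A(1)] by (intro eventually_pos_def PD) (simp add: transpose_uminus)
      moreover have "\<forall>\<^sub>F t in at_right (0::real). t > 0" by (rule eventually_at_right_less)
      ultimately have "\<forall>\<^sub>F t in at_right (0::real). False"
      proof eventually_elim
        case (elim t)
        have "normalized (Y + t *\<^sub>R (- A)) \<in> polyhedron"
          using elim normalized_P3 O' T(3) by auto
        then have "0 \<le> trace (A ** (Y + t *\<^sub>R (- A)))"
          using trace_normalized_iff(2)[OF elim(2)] A(1) by (auto simp: polyhedron_iff)
        also have "\<dots> = - t * (A \<bullet> A)"
          using A(2) symmetric[OF A(1)]
          by (simp only: trace_mult_add_right trace_mult_scaleR_right)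
             (simp add: trace_matrix_mult_eq_inner transpose_uminus)
        also have "\<dots> < 0" using elim nonzero[OF A(1)] by simp
        finally show ?case by simp
      qed
      then show False by simp
    qed
  qed
  then show ?thesis unfolding fr by blast
qed

text \<open>A convex subset of the frontier cannot straddle several faces: if it left each of the
  finitely many hyperplanes through \<open>Y\<close>, the sum of \<open>Y\<close> and one point off
  each of them would, after rescaling, be a point of \<open>G\<close> where every functional is
  positive.\<close>

lemma frontier_sub_convex_polyhedron:
  assumes G: "convex_polyhedron G" "G \<subseteq> top_of_set P3 frontier_of polyhedron" and Y: "Y \<in> G"
  obtains A where "A \<in> \<A>" "trace (A ** Y) = 0" "G \<subseteq> hyperplane A"
proof -
  obtain \<B> where \<B>: "G = P3 \<inter> (\<Inter>A\<in>\<B>. half_space A)"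
    using G(1) by (auto simp: convex_polyhedron_def)
  have G_iff: "Z \<in> G \<longleftrightarrow> Z \<in> P3 \<and> (\<forall>A\<in>\<B>. 0 \<le> trace (A ** Z))" for Z
    by (auto simp: \<B> half_space_def)
  have GP: "Z \<in> polyhedron" "Z \<in> P3" "Z \<in> pos_def" if "Z \<in> G" for Z
    using that G(2) frontier_iff G_iff by (auto simp: P3_iff)
  have "\<exists>A\<in>\<A>. trace (A ** Y) = 0 \<and> (\<forall>Z\<in>G. trace (A ** Z) = 0)"
  proof (rule ccontr)
    assume neg: "\<not> ?thesis"
    let ?F = "{A\<in>\<A>. trace (A ** Y) = 0}"
    have fin: "finite ?F"
      by (rule finite_subset[OF _ finite_nonpos[OF GP(2)[OF Y]]]) auto
    have "\<forall>A\<in>?F. \<exists>Z. Z \<in> G \<and> trace (A ** Z) \<noteq> 0" using neg by blast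
    from bchoice[OF this] obtain f where f: "\<forall>A\<in>?F. f A \<in> G \<and> trace (A ** f A) \<noteq> 0" by blast
    define V where "V = Y + sum f ?F"
    have V: "V \<in> pos_def"
      unfolding V_def by (rule pos_def_add_sum[OF fin GP(3)[OF Y]]) (use f GP(3) in blast)
    have tr: "trace (B ** V) = trace (B ** Y) + (\<Sum>A\<in>?F. trace (B ** f A))" for B
      by (simp add: V_def trace_mult_add_right trace_mult_sum_right)
    have "normalized V \<in> G"
      unfolding G_iff using V Y f
      by (auto simp: normalized_P3 trace_normalized_iff tr G_iff intro!: add_nonneg_nonneg sum_nonneg)
    then obtain A where A: "A \<in> \<A>" "trace (A ** V) = 0"
      using G(2) frontier_iff trace_normalized_iff(3)[OF V] by blast
    have nn: "0 \<le> trace (A ** Y)" "\<And>B. B \<in> ?F \<Longrightarrow> 0 \<le> trace (A ** f B)"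
      using GP(1) Y f A(1) by (auto simp: polyhedron_iff)
    have "0 \<le> (\<Sum>B\<in>?F. trace (A ** f B))" by (rule sum_nonneg) (rule nn(2))
    then have 0: "trace (A ** Y) = 0" "(\<Sum>B\<in>?F. trace (A ** f B)) = 0"
      using A(2) nn(1) unfolding tr by linarith+
    then have "A \<in> ?F" using A by simp
    moreover have "\<forall>B\<in>?F. trace (A ** f B) = 0"
      using sum_nonneg_eq_0_iff[OF fin, of "\<lambda>B. trace (A ** f B)"] nn(2) 0(2) by blast
    ultimately show False using f by blast
  qed
  then show thesis using that GP(2) by (auto simp: hyperplane_def)
qed

lemma face_sub_frontier: "A \<in> \<A> \<Longrightarrow> polyhedron \<inter> hyperplane A \<subseteq> top_of_set P3 frontier_of polyhedron"
  by (auto simp: frontier_iff hyperplane_def)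

lemma nonempty_facet_eq:
  assumes "facet polyhedron F" "F \<noteq> {}"
  obtains A where "A \<in> \<A>" "F = polyhedron \<inter> hyperplane A"
proof -
  obtain Y where Y: "Y \<in> F" using assms(2) by blast
  have F: "convex_polyhedron F" "F \<subseteq> top_of_set P3 frontier_of polyhedron"
    and max: "\<And>G. convex_polyhedron G \<Longrightarrow> G \<subseteq> top_of_set P3 frontier_of polyhedron \<Longrightarrow> F \<subseteq> G \<Longrightarrow> G = F"
    using assms(1) by (auto simp: facet_def)
  obtain A where A: "A \<in> \<A>" "F \<subseteq> hyperplane A"
    using frontier_sub_convex_polyhedron[OF F Y] by blast
  have "F \<subseteq> polyhedron \<inter> hyperplane A"
    using F(2) A(2) frontier_iff by blast
  then have "polyhedron \<inter> hyperplane A = F"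
    using max convex_polyhedron_face face_sub_frontier A(1) by blast
  then show thesis using that A(1) by blast
qed

lemma finite_family_imp_finite_facets:
  assumes "finite \<A>"
  shows "finite {F. facet polyhedron F}"
proof -
  \<comment> \<open>The empty set is a convex polyhedron, cut out for instance by
    \<open>- mat 1\<close>, and counts as a facet if the frontier is empty.\<close>
  have "{F. facet polyhedron F} \<subseteq> insert {} ((\<lambda>A. polyhedron \<inter> hyperplane A) ` \<A>)"
    using nonempty_facet_eq by blast
  then show ?thesis using assms finite_subset by blast
qed

text \<open>Only finitely many faces pass through \<open>Y\<close>. A maximal one among them is a
  facet, because any larger polyhedron in the frontier lies in a single hyperplane, which again
  passes through \<open>Y\<close>.\<close>

lemma frontier_in_facet:
  assumes Y: "Y \<in> top_of_set P3 frontier_of polyhedron"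
  obtains F where "facet polyhedron F" "Y \<in> F"
proof -
  let ?\<F> = "(\<lambda>A. polyhedron \<inter> hyperplane A) ` {A\<in>\<A>. trace (A ** Y) = 0}"
  have YP: "Y \<in> polyhedron" "Y \<in> P3" using Y by (auto simp: frontier_iff polyhedron_iff)
  have "finite {A\<in>\<A>. trace (A ** Y) = 0}"
    by (rule finite_subset[OF _ finite_nonpos[OF YP(2)]]) auto
  then have fin: "finite ?\<F>" by blast
  have ne: "?\<F> \<noteq> {}" using Y by (auto simp: frontier_iff)
  obtain F where F: "F \<in> ?\<F>" "\<forall>G\<in>?\<F>. F \<subseteq> G \<longrightarrow> F = G"
    using finite_has_maximal[OF fin ne] by blast
  then obtain A where A: "A \<in> \<A>" "trace (A ** Y) = 0" "F = polyhedron \<inter> hyperplane A" by blast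
  have YF: "Y \<in> F" using A YP by (simp add: hyperplane_def)
  have "facet polyhedron F"
    unfolding facet_def
  proof (intro conjI allI impI)
    show "convex_polyhedron F" using A convex_polyhedron_face by blast
    show "F \<subseteq> top_of_set P3 frontier_of polyhedron" using A face_sub_frontier by blast
    fix G assume G: "convex_polyhedron G \<and> G \<subseteq> top_of_set P3 frontier_of polyhedron \<and> F \<subseteq> G"
    then have YG: "Y \<in> G" using YF by blast
    obtain B where B: "B \<in> \<A>" "trace (B ** Y) = 0" "G \<subseteq> hyperplane B"
      using frontier_sub_convex_polyhedron[OF _ _ YG] G by metis
    have "G \<subseteq> polyhedron \<inter> hyperplane B" using G B(3) frontier_iff by blast
    moreover from this have "polyhedron \<inter> hyperplane B = F" using F(2) B(1,2) G by blast
    ultimately show "G = F" using G by blast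
  qed
  then show thesis using that YF by blast
qed

text \<open>The segment from the interior point \<open>X\<close> to a point outside the polyhedron leaves it through
  the frontier; the members of \<open>\<S>\<close> are positive there, so no facet coming from \<open>\<S>\<close>
  contains the exit point.\<close>

lemma infinite_facets:
  assumes X: "X \<in> P3" "\<And>A. A \<in> \<A> \<Longrightarrow> 0 < trace (A ** X)"
    and sep: "\<And>\<S>. finite \<S> \<Longrightarrow> \<S> \<subseteq> \<A> \<Longrightarrow> \<exists>Y\<in>P3. (\<forall>A\<in>\<S>. 0 \<le> trace (A ** Y)) \<and> Y \<notin> polyhedron"
  shows "infinite {F. facet polyhedron F}"
proof
  assume fin: "finite {F. facet polyhedron F}"
  have "\<forall>F\<in>{F. facet polyhedron F \<and> F \<noteq> {}}. \<exists>A. A \<in> \<A> \<and> F = polyhedron \<inter> hyperplane A"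
    using nonempty_facet_eq by blast
  from bchoice[OF this] obtain g
    where g: "\<forall>F\<in>{F. facet polyhedron F \<and> F \<noteq> {}}. g F \<in> \<A> \<and> F = polyhedron \<inter> hyperplane (g F)"
    by blast
  define \<S> where "\<S> = g ` {F. facet polyhedron F \<and> F \<noteq> {}}"
  have "finite {F. facet polyhedron F \<and> F \<noteq> {}}" by (rule finite_subset[OF _ fin]) auto
  then have "finite \<S>" "\<S> \<subseteq> \<A>" using g by (auto simp: \<S>_def)
  then obtain Y where Y: "Y \<in> P3" "\<forall>A\<in>\<S>. 0 \<le> trace (A ** Y)" "Y \<notin> polyhedron" using sep by blast
  define N where "N = {A\<in>\<A>. trace (A ** Y) < 0}"
  have N: "finite N"
    by (rule finite_subset[OF _ finite_nonpos[OF Y(1)]]) (auto simp: N_def)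
  have "N \<noteq> {}" using Y(1,3) by (auto simp: N_def polyhedron_iff not_le)
  note N = N this
  \<comment> \<open>The parameter at which the segment from \<open>X\<close> to \<open>Y\<close>
    meets the hyperplane of \<open>A\<close>; the least one over the violated \<open>A\<close> is
    the exit time.\<close>
  define \<tau> where "\<tau> A = trace (A ** X) / (trace (A ** X) - trace (A ** Y))" for A
  define t where "t = Min (\<tau> ` N)"
  have "t \<in> \<tau> ` N" unfolding t_def using N by (intro Min_in) auto
  then obtain B where B: "B \<in> N" "t = \<tau> B" by blast
  have BX: "0 < trace (B ** X)" "trace (B ** Y) < 0" "B \<in> \<A>" using B X(2) by (auto simp: N_def)
  have t: "0 < t" "t < 1" using BX by (auto simp: B \<tau>_def divide_less_eq)
  define V where "V = (1 - t) *\<^sub>R X + t *\<^sub>R Y"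
  have V: "V \<in> pos_def" unfolding V_def using X(1) Y(1) t by (intro pos_def_add pos_def_scaleR) (auto simp: P3_iff)
  have tr: "trace (A ** V) = (1 - t) * trace (A ** X) + t * trace (A ** Y)" for A
    by (simp add: V_def trace_mult_add_right trace_mult_scaleR_right)
  have B0: "trace (B ** V) = 0"
    using BX unfolding tr B(2) \<tau>_def by (simp add: field_simps)
  have "0 \<le> trace (A ** V)" if A: "A \<in> \<A>" for A
  proof (cases "A \<in> N")
    case False
    then show ?thesis using X(2)[OF A] A t unfolding tr N_def by auto
  next
    case True
    have "t \<le> \<tau> A" unfolding t_def using N True by auto
    moreover have "0 < trace (A ** X) - trace (A ** Y)" using X(2)[OF A] True by (auto simp: N_def)
    ultimately have "t * (trace (A ** X) - trace (A ** Y)) \<le> trace (A ** X)"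
      by (simp add: \<tau>_def pos_le_divide_eq)
    then show ?thesis unfolding tr by (simp add: algebra_simps)
  qed
  then have "normalized V \<in> polyhedron"
    using V by (simp add: polyhedron_iff normalized_P3 trace_normalized_iff)
  then have "normalized V \<in> top_of_set P3 frontier_of polyhedron"
    unfolding frontier_iff using B0 BX(3) trace_normalized_iff(3)[OF V] by blast
  then obtain F where F: "facet polyhedron F" "normalized V \<in> F" by (rule frontier_in_facet)
  then have F': "g F \<in> \<S>" "F = polyhedron \<inter> hyperplane (g F)" using g by (auto simp: \<S>_def)
  then have "trace (g F ** V) = 0"
    using F(2) trace_normalized_iff(3)[OF V] by (auto simp: hyperplane_def)
  moreover have "0 < (1 - t) * trace (g F ** X)" "0 \<le> t * trace (g F ** Y)"
    using t X(2) Y(2) F'(1) \<open>\<S> \<subseteq> \<A>\<close> by auto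
  ultimately show False unfolding tr by linarith
qed

end

section \<open>Dirichlet--Selberg domains of discrete groups\<close>

text \<open>The equality case of the inequality between the arithmetic and the geometric mean, from
  ln x \<le> x - 1 with equality only at x = 1.\<close>

lemma prod_ge_1_sum_le_3:
  fixes a b c :: real
  assumes "a > 0" "b > 0" "c > 0" "a * b * c \<ge> 1" "a + b + c \<le> 3"
  shows "a = 1 \<and> b = 1 \<and> c = 1"
proof -
  have "0 \<le> ln (a * b * c)" using assms(4) by simp
  also have "\<dots> = ln a + ln b + ln c" using assms by (simp add: ln_mult)
  finally have "0 \<le> ln a + ln b + ln c" .
  moreover note ln_le_minus_one[OF assms(1)] ln_le_minus_one[OF assms(2)] ln_le_minus_one[OF assms(3)]
  ultimately have "ln a = a - 1" "ln b = b - 1" "ln c = c - 1" using assms(5) by linarith+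
  then show ?thesis using ln_eq_minus_one assms by blast
qed

text \<open>Fischer's inequality for the splitting into a block of size 2 and a diagonal entry;
  \<open>S$1$1\<close> times the defect is a visibly nonnegative expression.\<close>

lemma det_le_minor_mult:
  fixes S :: "real^3^3"
  assumes "S \<in> pos_def"
  shows "det S \<le> S$3$3 * (S$1$1 * S$2$2 - (S$1$2)\<^sup>2)"
proof -
  note m = pos_def_minors[OF assms]
  have "0 \<le> (S$1$1 * S$2$3 - S$1$2 * S$1$3)\<^sup>2 + (S$1$1 * S$2$2 - (S$1$2)\<^sup>2) * (S$1$3)\<^sup>2"
    using m by (intro add_nonneg_nonneg mult_nonneg_nonneg) auto
  also have "\<dots> = S$1$1 * (S$3$3 * (S$1$1 * S$2$2 - (S$1$2)\<^sup>2) - det S)"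
    unfolding det_symmetric_3[OF pos_def_symmetric[OF assms]] by algebra
  finally show ?thesis using m(1) by (simp add: zero_le_mult_iff)
qed

text \<open>By Fischer's inequality the diagonal entries have product at least 1, so a trace of at
  most 3 makes all of them 1; equality in each estimate then kills the off-diagonal entries.\<close>

lemma pos_def_trace_le_3:
  fixes S :: "real^3^3"
  assumes S: "S \<in> pos_def" and det: "det S = 1" and tr: "trace S \<le> 3"
  shows "S = mat 1"
proof -
  note m = pos_def_minors[OF S] and sym = symmetric_nth[OF pos_def_symmetric[OF S]]
  have le: "1 \<le> S$3$3 * (S$1$1 * S$2$2 - (S$1$2)\<^sup>2)" using det_le_minor_mult[OF S] det by simp
  also have "\<dots> \<le> S$3$3 * (S$1$1 * S$2$2)" using m by (intro mult_left_mono) auto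
  finally have "1 \<le> S$1$1 * S$2$2 * S$3$3" by (simp add: mult_ac)
  then have d: "S$1$1 = 1 \<and> S$2$2 = 1 \<and> S$3$3 = 1"
    using m tr by (intro prod_ge_1_sum_le_3) (auto simp: trace_def sum_3)
  then have 12: "S$1$2 = 0" using le by simp
  then have "det S = 1 - (S$2$3)\<^sup>2 - (S$1$3)\<^sup>2"
    using d unfolding det_symmetric_3[OF pos_def_symmetric[OF S]] by simp
  then have "(S$2$3)\<^sup>2 + (S$1$3)\<^sup>2 = 0" using det by linarith
  then have "S$2$3 = 0" "S$1$3 = 0" unfolding sum_power2_eq_zero_iff by blast+
  then show ?thesis using d 12 sym[of 2 1] sym[of 3 1] sym[of 3 2] by (intro mat33_eqI) simp_all
qed

text \<open>With \<open>X = N ** transpose N\<close>, the matrix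
  \<open>transpose N ** V ** N\<close> has determinant 1 and trace at most 3, so it is the identity.
  Hence at \<open>Y = X\<close> every inequality is strict except for the elements that fix
  \<open>adj3 X\<close>.\<close>

lemma trace_form_base_point:
  assumes X: "X \<in> P3" and h: "det h = 1"
    and le: "trace_form (adj3 X) X h \<le> trace_form (adj3 X) X (mat 1)"
  shows "h ** adj3 X ** transpose h = adj3 X"
proof -
  have det: "det X = 1" and PD: "X \<in> pos_def" using X by (auto simp: P3_iff)
  obtain N :: "real^3^3" where N: "X = N ** transpose N" using cholesky_3[OF PD] by blast
  have detN: "det N * det N = 1" using det N by (simp add: det_mul)
  then have detN0: "det N \<noteq> 0" by auto
  define V where "V = h ** adj3 X ** transpose h"
  have "adj3 X \<in> pos_def" "det (adj3 X) = 1" using P3_adj3[OF X] by (auto simp: P3_iff)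
  then have V: "V \<in> pos_def" "det V = 1"
    using pos_def_congruence[of "adj3 X" "transpose h"] h by (auto simp: V_def det_mul)
  have "trace (transpose N ** V ** N) = trace (V ** X)"
    unfolding N by (metis matrix_mul_assoc trace_mul_sym)
  also have "\<dots> \<le> trace (adj3 X ** X)" using le by (simp add: trace_form_def V_def)
  also have "\<dots> = 3" using adj3_mult(1)[OF det] by (simp add: trace_I)
  finally have "transpose N ** V ** N = mat 1"
    using V detN by (intro pos_def_trace_le_3 pos_def_congruence detN0) (simp_all add: det_mul)
  then have "N ** (transpose N ** V ** N) ** transpose N = X" by (simp add: N)
  then have XVX: "X ** V ** X = X" by (simp add: N matrix_mul_assoc)
  have "adj3 X ** (X ** V ** X) ** adj3 X = V"
    using adj3_mult[OF det] by (metis matrix_mul_assoc matrix_mul_lid matrix_mul_rid)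
  then show ?thesis
    unfolding XVX using adj3_mult[OF det] by (simp add: V_def)
qed

section \<open>Bisectors and finite determination\<close>

text \<open>An element fixing \<open>W\<close> yields the zero functional, which bounds no
  half-space; dropping it loses no inequality.\<close>

definition bisector_family :: "real^3^3 \<Rightarrow> (real^3^3) set \<Rightarrow> (real^3^3) set" where
  "bisector_family W S = (\<lambda>h. h ** W ** transpose h - W) ` S - {0}"

lemma trace_bisector: "trace ((h ** W ** transpose h - W) ** Y) = trace_form W Y h - trace_form W Y (mat 1)"
  by (simp add: trace_form_def matrix_diff_rdistrib trace_sub)

lemma bisector_nonneg_iff:
  "(\<forall>A\<in>bisector_family W S. 0 \<le> trace (A ** Y)) \<longleftrightarrow> (\<forall>h\<in>S. trace_form W Y (mat 1) \<le> trace_form W Y h)"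
proof -
  have "(\<forall>A\<in>bisector_family W S. 0 \<le> trace (A ** Y)) \<longleftrightarrow>
      (\<forall>A\<in>(\<lambda>h. h ** W ** transpose h - W) ` S. 0 \<le> trace (A ** Y))"
    by (auto simp: bisector_family_def trace_matrix_mult_eq_inner)
  then show ?thesis by (simp add: trace_bisector)
qed

text \<open>A functional that is nonpositive at a point near \<open>Y\<close> means f(h) \<le> f(1)
  there. Coercivity then bounds the norm of \<open>h\<close>, and a discrete group has only finitely
  many elements of bounded norm.\<close>

lemma polyhedral_family_bisector:
  assumes \<Gamma>: "subgroup \<Gamma> SL3" "discrete \<Gamma>" and W: "W \<in> P3" and S: "S \<subseteq> \<Gamma>"
  shows "polyhedral_family (bisector_family W S)"
proof
  have PD: "W \<in> pos_def" using W by (simp add: P3_iff)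
  show "transpose A = A" if "A \<in> bisector_family W S" for A
    using that pos_def_symmetric[OF PD]
    by (auto simp: bisector_family_def transpose_diff matrix_transpose_mul matrix_mul_assoc)
  show "A \<noteq> 0" if "A \<in> bisector_family W S" for A using that by (simp add: bisector_family_def)
  fix Y :: "real^3^3" assume "Y \<in> P3"
  then have Y: "Y \<in> pos_def" by (simp add: P3_iff)
  obtain \<delta> where \<delta>: "\<delta> > 0" "\<And>Z h. Z \<in> pos_def \<Longrightarrow> norm (Z - Y) < \<delta> \<Longrightarrow> \<delta> * (norm h)\<^sup>2 \<le> trace_form W Z h"
    using trace_form_coercive[OF PD Y] by blast
  define R where "R = sqrt (norm W * (norm Y + \<delta>) / \<delta>)"
  have "{A \<in> bisector_family W S. \<exists>Z\<in>P3. norm (Z - Y) < \<delta> \<and> trace (A ** Z) \<le> 0}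
      \<subseteq> (\<lambda>h. h ** W ** transpose h - W) ` {h\<in>\<Gamma>. norm h \<le> R}"
  proof
    fix A assume "A \<in> {A \<in> bisector_family W S. \<exists>Z\<in>P3. norm (Z - Y) < \<delta> \<and> trace (A ** Z) \<le> 0}"
    then obtain h Z where h: "h \<in> S" "A = h ** W ** transpose h - W"
      and Z: "Z \<in> P3" "norm (Z - Y) < \<delta>" "trace (A ** Z) \<le> 0"
      by (auto simp: bisector_family_def)
    have Z': "Z \<in> pos_def" using Z by (simp add: P3_iff)
    have "\<delta> * (norm h)\<^sup>2 \<le> trace_form W Z h" by (rule \<delta>(2)[OF Z' Z(2)])
    also have "\<dots> \<le> trace_form W Z (mat 1)" using Z(3) unfolding h(2) trace_bisector by simp
    also have "\<dots> = W \<bullet> Z"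
      using pos_def_symmetric[OF Z'] by (simp add: trace_form_def trace_matrix_mult_eq_inner)
    also have "\<dots> \<le> norm W * norm Z" by (rule norm_cauchy_schwarz)
    also have "\<dots> \<le> norm W * (norm Y + \<delta>)"
      using Z(2) norm_triangle_ineq2[of Z Y] by (intro mult_left_mono) auto
    finally have "(norm h)\<^sup>2 \<le> norm W * (norm Y + \<delta>) / \<delta>"
      using \<delta>(1) by (simp add: pos_le_divide_eq mult.commute)
    then have "norm h \<le> R" unfolding R_def by (rule real_le_rsqrt)
    then show "A \<in> (\<lambda>h. h ** W ** transpose h - W) ` {h\<in>\<Gamma>. norm h \<le> R}" using h S by blast
  qed
  then have "finite {A \<in> bisector_family W S. \<exists>Z\<in>P3. norm (Z - Y) < \<delta> \<and> trace (A ** Z) \<le> 0}"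
    by (rule finite_subset) (intro finite_imageI discrete_subgroup_finite_bounded \<Gamma>)
  then show "\<exists>\<delta>>0. finite {A \<in> bisector_family W S. \<exists>Z\<in>P3. norm (Z - Y) < \<delta> \<and> trace (A ** Z) \<le> 0}"
    using \<delta>(1) by blast
qed

lemma polyhedron_bisector_family:
  assumes "subgroup \<Gamma> SL3" "discrete \<Gamma>" "W \<in> P3" "S \<subseteq> \<Gamma>"
  shows "polyhedral_family.polyhedron (bisector_family W S)
    = {Y \<in> P3. \<forall>h\<in>S. trace_form W Y (mat 1) \<le> trace_form W Y h}"
  using polyhedral_family.polyhedron_iff[OF polyhedral_family_bisector[OF assms]]
    bisector_nonneg_iff[of W S] by auto

definition finitely_determined :: "real^3^3 \<Rightarrow> (real^3^3) set \<Rightarrow> bool" where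
  "finitely_determined W \<Gamma> \<longleftrightarrow> (\<exists>S\<subseteq>\<Gamma>. finite S \<and>
     (\<forall>Y\<in>pos_def. (\<forall>h\<in>S. trace_form W Y (mat 1) \<le> trace_form W Y h) \<longrightarrow>
        (\<forall>h\<in>\<Gamma>. trace_form W Y (mat 1) \<le> trace_form W Y h)))"

lemma finitely_sided_DS:
  assumes \<Gamma>: "subgroup \<Gamma> SL3" "discrete \<Gamma>" and X: "X \<in> P3" and fin: "finitely_determined (adj3 X) \<Gamma>"
  shows "finitely_sided (DS X \<Gamma>)"
proof -
  let ?W = "adj3 X"
  have W: "?W \<in> P3" by (rule P3_adj3[OF X])
  obtain S where S: "S \<subseteq> \<Gamma>" "finite S"
    and det: "\<And>Y. Y \<in> pos_def \<Longrightarrow> \<forall>h\<in>S. trace_form ?W Y (mat 1) \<le> trace_form ?W Y h \<Longrightarrow>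
      \<forall>h\<in>\<Gamma>. trace_form ?W Y (mat 1) \<le> trace_form ?W Y h"
    using fin unfolding finitely_determined_def by blast
  interpret polyhedral_family "bisector_family ?W S"
    by (rule polyhedral_family_bisector[OF \<Gamma> W S(1)])
  have "polyhedron = DS X \<Gamma>"
    unfolding polyhedron_bisector_family[OF \<Gamma> W S(1)] DS_eq[OF \<Gamma>(1) X]
    using det S(1) by (auto simp: P3_iff)
  moreover have "finite (bisector_family ?W S)" using S(2) by (simp add: bisector_family_def)
  ultimately show ?thesis
    using convex_polyhedron_polyhedron finite_family_imp_finite_facets by (simp add: finitely_sided_def)
qed

lemma infinitely_sided_DS:
  assumes \<Gamma>: "subgroup \<Gamma> SL3" "discrete \<Gamma>" and X: "X \<in> P3" and inf: "\<not> finitely_determined (adj3 X) \<Gamma>"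
  shows "infinitely_sided (DS X \<Gamma>)"
proof -
  let ?W = "adj3 X"
  have W: "?W \<in> P3" by (rule P3_adj3[OF X])
  interpret polyhedral_family "bisector_family ?W \<Gamma>"
    by (rule polyhedral_family_bisector[OF \<Gamma> W order_refl])
  have eq: "polyhedron = DS X \<Gamma>"
    unfolding polyhedron_bisector_family[OF \<Gamma> W order_refl] DS_eq[OF \<Gamma>(1) X] ..
  have "infinite {F. facet polyhedron F}"
  proof (rule infinite_facets[OF X])
    fix A assume A: "A \<in> bisector_family ?W \<Gamma>"
    then obtain h where h: "h \<in> \<Gamma>" "A = h ** ?W ** transpose h - ?W" "A \<noteq> 0"
      by (auto simp: bisector_family_def)
    then have "\<not> trace_form ?W X h \<le> trace_form ?W X (mat 1)"
      using trace_form_base_point[OF X subgroup_SL3D(1)[OF \<Gamma>(1) h(1)]] by auto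
    then show "0 < trace (A ** X)" by (simp add: h(2) trace_bisector)
  next
    fix \<S> assume "finite \<S>" "\<S> \<subseteq> bisector_family ?W \<Gamma>"
    then have sub: "\<S> \<subseteq> (\<lambda>h. h ** ?W ** transpose h - ?W) ` \<Gamma>" by (auto simp: bisector_family_def)
    obtain S where S: "S \<subseteq> \<Gamma>" "finite S" "\<S> = (\<lambda>h. h ** ?W ** transpose h - ?W) ` S"
      using finite_subset_image[OF \<open>finite \<S>\<close> sub] by blast
    obtain Y where Y: "Y \<in> pos_def" "\<forall>h\<in>S. trace_form ?W Y (mat 1) \<le> trace_form ?W Y h"
      "\<not> (\<forall>h\<in>\<Gamma>. trace_form ?W Y (mat 1) \<le> trace_form ?W Y h)"
      using inf S unfolding finitely_determined_def by blast
    have "\<forall>A\<in>\<S>. 0 \<le> trace (A ** normalized Y)"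
      using Y(2) by (simp add: S(3) trace_normalized_iff[OF Y(1)] trace_bisector)
    moreover have "\<not> (\<forall>A\<in>bisector_family ?W \<Gamma>. 0 \<le> trace (A ** normalized Y))"
      using Y(3) by (simp add: trace_normalized_iff[OF Y(1)] bisector_nonneg_iff)
    ultimately show "\<exists>Y\<in>P3. (\<forall>A\<in>\<S>. 0 \<le> trace (A ** Y)) \<and> Y \<notin> polyhedron"
      using normalized_P3[OF Y(1)] polyhedron_iff by blast
  qed
  then show ?thesis
    using convex_polyhedron_polyhedron unfolding infinitely_sided_def eq by blast
qed

section \<open>Passing to conjugate groups\<close>

lemma trace_form_conjugate:
  "trace_form W Y (k ** g ** k') = trace_form (k' ** W ** transpose k') (transpose k ** Y ** k) g"
proof -
  have "trace_form W Y (k ** g ** k') = trace (k ** (g ** k' ** W ** transpose k' ** transpose g ** transpose k ** Y))"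
    by (simp add: trace_form_def matrix_transpose_mul matrix_mul_assoc)
  also have "\<dots> = trace (g ** k' ** W ** transpose k' ** transpose g ** transpose k ** Y ** k)"
    by (rule trace_mul_sym)
  finally show ?thesis by (simp add: trace_form_def matrix_mul_assoc)
qed

lemma finitely_determined_conjugate:
  assumes k: "det k = 1" and X: "X \<in> P3" and fin: "finitely_determined (adj3 X) ((\<lambda>g. k ** g ** adj3 k) ` \<Delta>)"
  shows "finitely_determined (adj3 (act k X)) \<Delta>"
proof -
  let ?W = "adj3 X" and ?W' = "adj3 (act k X)" and ?c = "\<lambda>g. k ** g ** adj3 k"
  have W': "?W' = adj3 k ** ?W ** transpose (adj3 k)"
    using k X by (simp add: act_def adj3_matrix_mult det_mul adj3_transpose matrix_mul_assoc P3_iff)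
  obtain S' where S': "S' \<subseteq> ?c ` \<Delta>" "finite S'" "\<forall>Y\<in>pos_def. (\<forall>h\<in>S'. trace_form ?W Y (mat 1) \<le> trace_form ?W Y h) \<longrightarrow>
        (\<forall>h\<in>?c ` \<Delta>. trace_form ?W Y (mat 1) \<le> trace_form ?W Y h)"
    using fin unfolding finitely_determined_def by blast
  obtain S where S: "S \<subseteq> \<Delta>" "finite S" "S' = ?c ` S"
    using finite_subset_image[OF S'(2,1)] by blast
  show ?thesis
    unfolding finitely_determined_def
  proof (intro exI[of _ S] conjI ballI impI S)
    fix Y h assume Y: "Y \<in> pos_def" "\<forall>h\<in>S. trace_form ?W' Y (mat 1) \<le> trace_form ?W' Y h" and h: "h \<in> \<Delta>"
    define Z where "Z = transpose (adj3 k) ** Y ** adj3 k"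
    have Z: "Z \<in> pos_def" unfolding Z_def using k by (intro pos_def_congruence Y) (simp add: det_adj3)
    have kt: "transpose k ** transpose (adj3 k) = mat 1"
      using adj3_mult(1)[OF k] by (metis matrix_transpose_mul transpose_mat)
    have "transpose k ** Z ** k = (transpose k ** transpose (adj3 k)) ** Y ** (adj3 k ** k)"
      by (simp add: Z_def matrix_mul_assoc)
    then have Y': "transpose k ** Z ** k = Y" by (simp add: kt adj3_mult[OF k])
    have eq: "trace_form ?W Z (?c g) = trace_form ?W' Y g" for g
      by (simp add: trace_form_conjugate Y' W')
    have 1: "trace_form ?W Z (mat 1) = trace_form ?W' Y (mat 1)"
      using eq[of "mat 1"] adj3_mult[OF k] by simp
    show "trace_form ?W' Y (mat 1) \<le> trace_form ?W' Y h"
      using S'(3) Z Y(2) h unfolding S(3) by (auto simp: eq 1)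
  qed
qed

text \<open>The converse is the same implication for the inverse of \<open>k\<close>, applied to the
  conjugated group.\<close>

lemma finitely_determined_conjugate_iff:
  assumes k: "det k = 1" and X: "X \<in> P3"
  shows "finitely_determined (adj3 X) ((\<lambda>g. k ** g ** adj3 k) ` \<Delta>) \<longleftrightarrow> finitely_determined (adj3 (act k X)) \<Delta>"
proof
  let ?\<Gamma> = "(\<lambda>g. k ** g ** adj3 k) ` \<Delta>"
  assume fin: "finitely_determined (adj3 (act k X)) \<Delta>"
  have X': "act k X \<in> P3"
    using X k pos_def_congruence[of X k] by (simp add: act_def P3_iff det_mul)
  have kk: "transpose (adj3 k) ** transpose k = mat 1" "adj3 k ** k = mat 1" "k ** adj3 k = mat 1"
    using adj3_mult[OF k] by (metis matrix_transpose_mul transpose_mat)+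
  have "act (adj3 k) (act k X) = (transpose (adj3 k) ** transpose k) ** X ** (k ** adj3 k)"
    by (simp add: act_def matrix_mul_assoc)
  then have 1: "act (adj3 k) (act k X) = X" by (simp add: kk)
  have "adj3 k ** (k ** g ** adj3 k) ** k = g" for g
    by (metis kk(2) matrix_mul_assoc matrix_mul_lid matrix_mul_rid)
  then have 2: "(\<lambda>g. adj3 k ** g ** adj3 (adj3 k)) ` ?\<Gamma> = \<Delta>"
    by (simp add: adj3_adj3[OF k] image_image)
  show "finitely_determined (adj3 X) ?\<Gamma>"
    using finitely_determined_conjugate[of "adj3 k" "act k X" ?\<Gamma>] fin k X' by (simp add: 1 2 det_adj3)
qed (rule finitely_determined_conjugate[OF assms])

section \<open>Dense Zariski open sets\<close>

text \<open>A polynomial with a nonzero value has finitely many roots, and these cannot accumulate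
  at 0.\<close>

lemma eventually_real_polynomial_nonzero:
  assumes "real_polynomial_function (p :: real \<Rightarrow> real)" "p x \<noteq> 0"
  shows "\<forall>\<^sub>F t in at_right 0. p t \<noteq> 0"
proof -
  obtain a n where p: "p = (\<lambda>x. \<Sum>i\<le>n. a i * x^i)"
    using assms(1) real_polynomial_function_iff_sum by blast
  have "\<exists>i\<le>n. a i \<noteq> 0"
  proof (rule ccontr)
    assume "\<not> ?thesis"
    then have "p x = 0" unfolding p by (intro sum.neutral) auto
    then show False using assms(2) by simp
  qed
  then have "finite {x. p x = 0}" using polyfun_finite_roots[of a n] by (simp add: p)
  then have "\<not> 0 islimpt {x. p x = 0}" by (rule islimpt_finite)
  then have "\<forall>\<^sub>F t in at 0. p t \<noteq> 0" by (simp add: islimpt_iff_eventually)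
  then show ?thesis by (rule filter_leD[rotated]) (simp add: at_le)
qed

text \<open>Homogeneity allows to test the polynomial on a segment in the cone of positive definite
  matrices rather than on its projection to \<^const>\<open>P3\<close>.\<close>

lemma dense_zariski_open_homogeneous:
  assumes q: "real_polynomial_function q" and hom: "\<And>c X. q (c *\<^sub>R X) = c ^ d * q X"
    and X0: "X0 \<in> P3" "q X0 \<noteq> 0"
  shows "dense_P3 {X \<in> P3. q X \<noteq> 0}" "zariski_open_P3 {X \<in> P3. q X \<noteq> 0}"
proof -
  let ?U = "{X \<in> P3. q X \<noteq> 0}"
  show "zariski_open_P3 ?U"
    unfolding zariski_open_P3_def using q by (intro exI[of _ "{q}"]) auto
  have "X \<in> top_of_set P3 closure_of ?U" if X: "X \<in> P3" for X
    unfolding in_closure_of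
  proof (intro conjI allI impI)
    show "X \<in> topspace (top_of_set P3)" using X by simp
    fix T assume T: "X \<in> T \<and> openin (top_of_set P3) T"
    then obtain O' where O': "open O'" "T = P3 \<inter> O'" by (metis openin_open)
    have PD: "X \<in> pos_def" using X by (simp add: P3_iff)
    \<comment> \<open>The segment ends at \<open>X0\<close>, so \<open>q\<close> is not identically
      zero along it.\<close>
    let ?f = "\<lambda>t::real. X + t *\<^sub>R (X0 - X)"
    have "real_polynomial_function (q \<circ> ?f)"
      by (rule real_polynomial_function_compose[OF _ q])
        (intro polynomial_function_add polynomial_function_const polynomial_function_bounded_linear
          bounded_linear_scaleR_left)
    then have "\<forall>\<^sub>F t in at_right 0. (q \<circ> ?f) t \<noteq> 0"
      by (rule eventually_real_polynomial_nonzero[of _ 1]) (simp add: X0)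
    moreover have "\<forall>\<^sub>F t in at_right 0. ?f t \<in> pos_def"
      using X X0 by (intro eventually_pos_def PD) (simp add: transpose_diff P3_iff pos_def_symmetric)
    moreover have "(?f \<longlongrightarrow> X + 0 *\<^sub>R (X0 - X)) (at_right 0)" by (intro tendsto_intros)
    then have "((\<lambda>t. normalized (?f t)) \<longlongrightarrow> normalized X) (at_right 0)"
      using isCont_tendsto_compose[OF isCont_normalized[OF PD]] by simp
    then have "\<forall>\<^sub>F t in at_right 0. normalized (?f t) \<in> O'"
      by (rule topological_tendstoD) (use T O' normalized_eq[OF X] in auto)
    ultimately have "\<forall>\<^sub>F t in at_right 0. normalized (?f t) \<in> ?U \<inter> T"
    proof eventually_elim
      case (elim t)
      have "q (normalized (?f t)) \<noteq> 0"
        using elim(1,2) pos_def_det_pos by (force simp: normalized_def hom)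
      then show ?case using elim O' normalized_P3 by auto
    qed
    then obtain t where "normalized (?f t) \<in> ?U \<inter> T"
      using eventually_happens[of _ "at_right (0::real)"] by auto
    then show "\<exists>y. y \<in> ?U \<and> y \<in> T" by blast
  qed
  moreover have "top_of_set P3 closure_of ?U \<subseteq> P3" using closure_of_subset_topspace by fastforce
  ultimately show "dense_P3 ?U" unfolding dense_P3_def by blast
qed

lemma DS_finitely_sided_conjugate:
  assumes \<Gamma>: "subgroup \<Gamma> SL3" "discrete \<Gamma>" and conj: "conjugate_SL3 \<Gamma> \<Delta>"
    and fin: "\<And>W. W \<in> P3 \<Longrightarrow> finitely_determined W \<Delta>"
  shows "\<forall>X\<in>P3. finitely_sided (DS X \<Gamma>)"
proof
  fix X assume X: "X \<in> P3"
  obtain k where k: "det k = 1" "\<Gamma> = (\<lambda>g. k ** g ** adj3 k) ` \<Delta>"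
    using conj by (auto simp: conjugate_SL3_def inv_SL3)
  have "act k X \<in> P3" using X k pos_def_congruence[of X k] by (simp add: act_def P3_iff det_mul)
  then have "finitely_determined (adj3 X) \<Gamma>"
    unfolding k(2) finitely_determined_conjugate_iff[OF k(1) X] by (intro fin P3_adj3)
  then show "finitely_sided (DS X \<Gamma>)" by (rule finitely_sided_DS[OF \<Gamma> X])
qed

text \<open>One open set serves every infinitely-sided type: the condition on two entries of
  \<open>W\<close> is pulled back along the conjugation and becomes the nonvanishing of a single
  homogeneous polynomial in \<open>X\<close>.\<close>

lemma DS_infinitely_sided_conjugate:
  assumes \<Gamma>: "subgroup \<Gamma> SL3" "discrete \<Gamma>" and conj: "conjugate_SL3 \<Gamma> \<Delta>"
    and inf: "\<And>W. W \<in> P3 \<Longrightarrow> W$1$3 \<noteq> 0 \<Longrightarrow> W$2$3 \<noteq> 0 \<Longrightarrow> \<not> finitely_determined W \<Delta>"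
  shows "\<exists>U. dense_P3 U \<and> zariski_open_P3 U \<and> (\<forall>X\<in>U. infinitely_sided (DS X \<Gamma>))"
proof -
  obtain k where k: "det k = 1" "\<Gamma> = (\<lambda>g. k ** g ** adj3 k) ` \<Delta>"
    using conj by (auto simp: conjugate_SL3_def inv_SL3)
  define q where "q X = adj3 (act k X)$1$3 * adj3 (act k X)$2$3" for X
  have "bounded_linear (\<lambda>X. act k X $ i $ j)" for i j
    unfolding linear_conv_bounded_linear[symmetric]
    by (auto simp: linear_iff act_def matrix_mult_nth_3 algebra_simps)
  then have "real_polynomial_function q"
    unfolding q_def adj3_def mat33_nth
    by (intro real_polynomial_function.intros(4) real_polynomial_function_diff real_polynomial_function.intros(1))
  \<comment> \<open>Each entry of the adjugate is quadratic in \<open>X\<close>, whence the degree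
    4.\<close>
  moreover have "\<And>c X. q (c *\<^sub>R X) = c ^ 4 * q X"
    by (simp add: q_def act_def adj3_def matrix_mult_scaleR_left matrix_mult_scaleR_right algebra_simps power4_eq_xxxx)
  ultimately have U: "dense_P3 {X \<in> P3. q X \<noteq> 0}" "zariski_open_P3 {X \<in> P3. q X \<noteq> 0}"
    if "X0 \<in> P3" "q X0 \<noteq> 0" for X0
    using dense_zariski_open_homogeneous that by blast+
  \<comment> \<open>A sample matrix with both entries nonzero; pulled back to \<open>X0\<close>, it
    shows that \<open>q\<close> does not vanish identically on \<open>P3\<close>.\<close>
  define W0 :: "real^3^3" where "W0 = normalized (mat33 2 0 1 0 2 1 1 1 2)"
  have "mat33 2 0 1 0 2 1 1 1 2 \<in> pos_def"
    by (rule pos_defI) (auto intro!: mat33_eqI simp: det_3)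
  then have "W0 \<in> P3" unfolding W0_def by (rule normalized_P3)
  moreover have "W0$1$3 \<noteq> 0" "W0$2$3 \<noteq> 0" by (auto simp: W0_def normalized_def det_3)
  ultimately have W0: "W0 \<in> P3" "W0$1$3 \<noteq> 0" "W0$2$3 \<noteq> 0" by blast+
  define X0 where "X0 = act (adj3 k) (adj3 W0)"
  have "adj3 W0 \<in> P3" by (rule P3_adj3[OF W0(1)])
  then have X0: "X0 \<in> P3"
    using k pos_def_congruence[of "adj3 W0" "adj3 k"] by (simp add: X0_def act_def P3_iff det_mul det_adj3)
  have kk: "transpose k ** transpose (adj3 k) = mat 1" "adj3 k ** k = mat 1"
    using adj3_mult[OF k(1)] by (metis matrix_transpose_mul transpose_mat)+
  have "act k X0 = (transpose k ** transpose (adj3 k)) ** adj3 W0 ** (adj3 k ** k)"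
    by (simp add: X0_def act_def matrix_mul_assoc)
  then have "adj3 (act k X0) = W0" using W0(1) by (simp add: kk adj3_adj3 P3_iff)
  then have "q X0 \<noteq> 0" using W0 by (simp add: q_def)
  note U = U[OF X0 this]
  have "infinitely_sided (DS X \<Gamma>)" if "X \<in> {X \<in> P3. q X \<noteq> 0}" for X
  proof -
    have X: "X \<in> P3" using that by simp
    have "act k X \<in> P3" using X k pos_def_congruence[of X k] by (simp add: act_def P3_iff det_mul)
    then have "\<not> finitely_determined (adj3 X) \<Gamma>"
      unfolding k(2) finitely_determined_conjugate_iff[OF k(1) X]
      using that by (intro inf P3_adj3) (auto simp: q_def)
    then show ?thesis by (rule infinitely_sided_DS[OF \<Gamma> X])
  qed
  then show ?thesis using U by blast
qed

section \<open>Two-parameter abelian groups\<close>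

definition int_span :: "'a::real_vector \<Rightarrow> 'a \<Rightarrow> 'a set" where
  "int_span u v = range (\<lambda>(m::int, n::int). of_int m *\<^sub>R u + of_int n *\<^sub>R v)"

lemma int_spanI: "of_int m *\<^sub>R u + of_int n *\<^sub>R v \<in> int_span u v"
  by (auto simp: int_span_def)

lemma int_spanE:
  assumes "x \<in> int_span u v"
  obtains m n :: int where "x = of_int m *\<^sub>R u + of_int n *\<^sub>R v"
  using assms by (auto simp: int_span_def)

lemma int_span_closed:
  shows "0 \<in> int_span u v" "x \<in> int_span u v \<Longrightarrow> - x \<in> int_span u v"
    "x \<in> int_span u v \<Longrightarrow> y \<in> int_span u v \<Longrightarrow> x + y \<in> int_span u v"
    "u \<in> int_span u v" "v \<in> int_span u v"
proof -
  show "0 \<in> int_span u v" using int_spanI[of 0 u 0 v] by simp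
  show "u \<in> int_span u v" using int_spanI[of 1 u 0 v] by simp
  show "v \<in> int_span u v" using int_spanI[of 0 u 1 v] by simp
  show "- x \<in> int_span u v" if x: "x \<in> int_span u v"
  proof -
    obtain m n :: int where "x = of_int m *\<^sub>R u + of_int n *\<^sub>R v" using x by (rule int_spanE)
    then show ?thesis using int_spanI[of "-m" u "-n" v] by simp
  qed
  show "x + y \<in> int_span u v" if x: "x \<in> int_span u v" and y: "y \<in> int_span u v"
  proof -
    obtain m n :: int where "x = of_int m *\<^sub>R u + of_int n *\<^sub>R v" using x by (rule int_spanE)
    moreover obtain k l :: int where "y = of_int k *\<^sub>R u + of_int l *\<^sub>R v" using y by (rule int_spanE)
    ultimately show ?thesis using int_spanI[of "m + k" u "n + l" v] by (simp add: algebra_simps)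
  qed
qed

lemma int_span_same: "int_span u u = range (\<lambda>n::int. of_int n *\<^sub>R u)"
proof (intro subset_antisym subsetI)
  fix x assume "x \<in> int_span u u"
  then obtain m n :: int where "x = of_int m *\<^sub>R u + of_int n *\<^sub>R u" by (rule int_spanE)
  then have "x = of_int (m + n) *\<^sub>R u" by (simp add: algebra_simps)
  then show "x \<in> range (\<lambda>n::int. of_int n *\<^sub>R u)" by blast
next
  fix x assume "x \<in> range (\<lambda>n::int. of_int n *\<^sub>R u)"
  then obtain n :: int where "x = of_int n *\<^sub>R u" by blast
  then show "x \<in> int_span u u" using int_spanI[of n u 0 u] by simp
qed

text \<open>A homomorphism from the plane into the group. All standard groups are images of some
  \<open>int_span u v\<close>, so that products and inverses become sums and negatives of
  parameters.\<close>

locale SL3_family =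
  fixes E :: "real \<times> real \<Rightarrow> real^3^3"
  assumes E_0: "E 0 = mat 1" and E_add: "E (x + y) = E x ** E y" and det_E: "det (E x) = 1"
begin

lemma adj3_E: "adj3 (E x) = E (- x)"
proof -
  have "E x ** E (- x) = mat 1" "E (- x) ** E x = mat 1" by (simp_all add: E_0 flip: E_add)
  then show ?thesis using matrix_inv_unique matrix_inv_eq_adj3[OF det_E] by metis
qed

lemma generate_eq: "generate SL3 {E u, E v} = E ` int_span u v"
proof (intro subset_antisym subsetI)
  fix x assume "x \<in> generate SL3 {E u, E v}"
  then show "x \<in> E ` int_span u v"
  proof induction
    case one
    then show ?case using int_span_closed(1) E_0 by (auto intro!: image_eqI[of _ _ 0])
  next
    case (incl h)
    then show ?case by (auto intro!: imageI int_span_closed(4,5))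
  next
    case (inv h)
    then show ?case by (auto simp: inv_SL3 det_E adj3_E intro!: imageI int_span_closed(2,4,5))
  next
    case (eng h1 h2)
    then obtain x y where "h1 = E x" "h2 = E y" "x \<in> int_span u v" "y \<in> int_span u v" by blast
    then show ?case by (auto intro!: imageI int_span_closed(3) simp flip: E_add)
  qed
next
  let ?H = "generate SL3 {E u, E v}"
  have sub: "subgroup ?H SL3"
    by (rule group.generate_is_subgroup[OF group_SL3]) (simp add: det_E)
  have nat: "E (of_nat n *\<^sub>R x) \<in> ?H" if "E x \<in> ?H" for x n
  proof (induction n)
    case 0
    then show ?case using subgroup_SL3D(2)[OF sub] by (simp add: E_0 flip: zero_prod_def)
  next
    case (Suc n)
    then show ?case using subgroup_SL3D(3)[OF sub that] by (simp add: scaleR_add_left E_add)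
  qed
  have int: "E (of_int n *\<^sub>R x) \<in> ?H" if "E x \<in> ?H" for x n
  proof (cases "n \<ge> 0")
    case True
    then show ?thesis using nat[OF that, of "nat n"] by simp
  next
    case False
    then obtain k :: nat where n: "n = - int k" by (metis int_cases2 nle_le of_nat_0_le_iff)
    show ?thesis using subgroup_SL3D(4)[OF sub nat[OF that, of k]] by (simp add: adj3_E n)
  qed
  fix x assume "x \<in> E ` int_span u v"
  then obtain m n :: int where x: "x = E (of_int m *\<^sub>R u + of_int n *\<^sub>R v)" by (auto elim: int_spanE)
  have "E u \<in> ?H" "E v \<in> ?H" by (auto intro: generate.incl)
  then show "x \<in> ?H" unfolding x E_add by (intro subgroup_SL3D(3)[OF sub] int)
qed

lemma generate_singleton_eq: "generate SL3 {E u} = range (\<lambda>n::int. E (of_int n *\<^sub>R u))"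
  using generate_eq[of u u] unfolding int_span_same image_image insert_absorb2 .

end

text \<open>The generator is the infimum of the positive elements. It is attained, since otherwise
  there would be two distinct elements within \<open>\<eta>\<close> above it, with a nonzero
  difference smaller than \<open>\<eta>\<close>.\<close>

lemma discrete_real_subgroup_cyclic:
  fixes H :: "real set"
  assumes add: "\<And>x y. x \<in> H \<Longrightarrow> y \<in> H \<Longrightarrow> x + y \<in> H" and minus: "\<And>x. x \<in> H \<Longrightarrow> - x \<in> H"
    and zero: "0 \<in> H" and \<eta>: "\<eta> > 0" "\<And>x. x \<in> H \<Longrightarrow> \<bar>x\<bar> < \<eta> \<Longrightarrow> x = 0"
  obtains d where "H = range (\<lambda>n::int. of_int n * d)"
proof (cases "\<exists>x\<in>H. x > 0")
  case False
  have "x = 0" if x: "x \<in> H" for x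
  proof -
    have "\<not> x > 0" "\<not> - x > 0" using False x minus[OF x] by blast+
    then show ?thesis by linarith
  qed
  then have "H = range (\<lambda>n::int. of_int n * 0)" using zero by auto
  then show thesis by (rule that)
next
  case True
  define P where "P = {x\<in>H. x > 0}"
  define d where "d = Inf P"
  have bdd: "bdd_below P" by (rule bdd_belowI[of _ 0]) (auto simp: P_def)
  have ne: "P \<noteq> {}" using True by (auto simp: P_def)
  have "\<exists>x\<in>P. x < d + \<eta>"
    using cInf_less_iff[OF ne bdd, of "d + \<eta>"] \<eta>(1) by (auto simp: d_def)
  then obtain x where x: "x \<in> P" "x < d + \<eta>" by blast
  have "x = d"
  proof (rule ccontr)
    assume "x \<noteq> d"
    moreover have "d \<le> x" unfolding d_def using x bdd by (intro cInf_lower)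
    ultimately have "Inf P < x" by (simp add: d_def)
    then obtain y where y: "y \<in> P" "y < x" using cInf_less_iff[OF ne bdd] by blast
    have "d \<le> y" unfolding d_def using y bdd by (intro cInf_lower)
    moreover have "x + - y \<in> H" using add[OF _ minus] x y by (simp add: P_def)
    ultimately show False using \<eta>(2)[of "x + - y"] x y by simp
  qed
  then have d: "d \<in> H" "d > 0" using x by (auto simp: P_def)
  have nat: "of_nat n * d \<in> H" for n
    by (induction n) (auto simp: distrib_right zero intro: add d)
  have int: "of_int n * d \<in> H" for n
  proof (cases "n \<ge> 0")
    case True
    then show ?thesis using nat[of "nat n"] by simp
  next
    case False
    then show ?thesis using minus[OF nat[of "nat (- n)"]] by simp
  qed
  have "h = of_int \<lfloor>h / d\<rfloor> * d" if h: "h \<in> H" for h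
  proof -
    \<comment> \<open>Division with remainder: a positive remainder would be an element of
      \<open>H\<close> below the generator.\<close>
    define r where "r = h + - (of_int \<lfloor>h / d\<rfloor> * d)"
    have r: "r \<in> H" unfolding r_def by (intro add minus int h)
    have "of_int \<lfloor>h / d\<rfloor> * d \<le> h"
      using pos_le_divide_eq[OF d(2), of "of_int \<lfloor>h / d\<rfloor>" h] of_int_floor_le by blast
    moreover have "h < (of_int \<lfloor>h / d\<rfloor> + 1) * d"
      using pos_divide_less_eq[OF d(2), of h "of_int \<lfloor>h / d\<rfloor> + 1"] by linarith
    ultimately have "0 \<le> r" "r < d" by (auto simp: r_def distrib_right)
    have "\<not> r > 0"
    proof
      assume "r > 0"
      then have "d \<le> r" unfolding d_def using r bdd by (intro cInf_lower) (auto simp: P_def)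
      then show False using \<open>r < d\<close> by simp
    qed
    then show ?thesis using \<open>0 \<le> r\<close> by (simp add: r_def)
  qed
  then have "H = range (\<lambda>n::int. of_int n * d)" using int by blast
  then show thesis by (rule that)
qed

lemma conjugate_hom:
  assumes "det k = 1"
  shows "k ** (A ** B) ** adj3 k = (k ** A ** adj3 k) ** (k ** B ** adj3 k)"
proof -
  have "(k ** A ** adj3 k) ** (k ** B ** adj3 k) = k ** A ** (adj3 k ** k) ** B ** adj3 k"
    by (simp add: matrix_mul_assoc)
  then show ?thesis by (simp add: adj3_mult[OF assms] matrix_mul_assoc)
qed

text \<open>Dependent parameters generate a subgroup of a one-parameter group, which is cyclic when it is
  discrete.\<close>

lemma (in SL3_family) two_generated_type_independent:
  assumes \<Gamma>: "subgroup \<Gamma> SL3" "discrete \<Gamma>" and type: "two_generated_type \<Gamma> (E u) (E v)"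
    and cont: "isCont E 0" and inj: "\<And>x. E x = mat 1 \<Longrightarrow> x = 0"
  shows "fst u * snd v \<noteq> snd u * fst v"
proof
  assume dep: "fst u * snd v = snd u * fst v"
  have "\<exists>w p q. u = p *\<^sub>R w \<and> v = q *\<^sub>R w \<and> w \<noteq> 0"
  proof (cases "fst u \<noteq> 0 \<or> snd u \<noteq> 0")
    case False
    then have u: "u = 0" by (simp add: prod_eq_iff)
    show ?thesis
    proof (cases "v = 0")
      case True
      then show ?thesis using u by (intro exI[of _ "(1, 1)"] exI[of _ 0]) (auto simp: zero_prod_def)
    next
      case False
      then show ?thesis using u by (intro exI[of _ v] exI[of _ 0] exI[of _ 1]) auto
    qed
  next
    case True
    define q where "q = (if fst u \<noteq> 0 then fst v / fst u else snd v / snd u)"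
    have "v = q *\<^sub>R u" using True dep by (auto simp: prod_eq_iff q_def field_simps)
    then show ?thesis using True by (intro exI[of _ u] exI[of _ 1] exI[of _ q]) auto
  qed
  then obtain w p q where w: "u = p *\<^sub>R w" "v = q *\<^sub>R w" "w \<noteq> 0" by blast
  obtain k where k: "det k = 1" "\<Gamma> = (\<lambda>g. k ** g ** adj3 k) ` generate SL3 {E u, E v}"
    using type by (auto simp: two_generated_type_def conjugate_SL3_def inv_SL3)
  define \<phi> where "\<phi> x = k ** E (x *\<^sub>R w) ** adj3 k" for x :: real
  define H where "H = int_span p q"
  have \<Gamma>_eq: "\<Gamma> = \<phi> ` H"
  proof -
    have "int_span u v = (\<lambda>x. x *\<^sub>R w) ` H"
      unfolding H_def int_span_def image_image by (rule image_cong) (auto simp: w scaleR_add_left)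
    then show ?thesis unfolding k(2) generate_eq by (simp add: \<phi>_def image_image)
  qed
  have \<phi>_add: "\<phi> (x + y) = \<phi> x ** \<phi> y" for x y
    by (simp add: \<phi>_def scaleR_add_left E_add conjugate_hom[OF k(1)])
  have \<phi>_0: "\<phi> 0 = mat 1" using adj3_mult[OF k(1)] by (simp add: \<phi>_def E_0 flip: zero_prod_def)
  have \<phi>_inj: "x = 0" if "\<phi> x = mat 1" for x
  proof -
    have "adj3 k ** \<phi> x ** k = E (x *\<^sub>R w)"
      unfolding \<phi>_def using adj3_mult[OF k(1)] by (metis matrix_mul_assoc matrix_mul_lid matrix_mul_rid)
    then have "E (x *\<^sub>R w) = mat 1" using that adj3_mult[OF k(1)] by simp
    then have "x *\<^sub>R w = 0" by (rule inj)
    then show ?thesis using w(3) by simp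
  qed
  have \<phi>_cont: "isCont \<phi> 0"
  proof -
    have "isCont (\<lambda>x. E (x *\<^sub>R w)) 0"
      by (rule isCont_o2[where g = E]) (auto intro!: continuous_intros simp: cont)
    moreover have "isCont (\<lambda>M. k ** M ** adj3 k) M" for M
    proof -
      have "linear (\<lambda>M. k ** M ** adj3 k)"
        by (auto simp: linear_iff vec_eq_iff matrix_mult_nth_3 algebra_simps)
      then show ?thesis using linear_continuous_at linear_conv_bounded_linear by blast
    qed
    ultimately show ?thesis unfolding \<phi>_def by (rule isCont_o2)
  qed
  obtain e where e: "e > 0" "\<And>y. y \<in> \<Gamma> \<Longrightarrow> dist (mat 1) y < e \<Longrightarrow> y = mat 1"
    using isolated_inE_dist[OF discreteD[OF \<Gamma>(2) subgroup_SL3D(2)[OF \<Gamma>(1)]]] by blast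
  \<comment> \<open>Continuity at 0 carries the isolation of the identity in \<open>\<Gamma>\<close>
    over to the parameters, so that \<open>H\<close> is a discrete subgroup of the line.\<close>
  obtain \<eta> where \<eta>: "\<eta> > 0" "\<And>x. dist x 0 < \<eta> \<Longrightarrow> dist (\<phi> x) (\<phi> 0) < e"
    using \<phi>_cont e(1) unfolding continuous_at_eps_delta by (metis dist_norm)
  obtain d where d: "H = range (\<lambda>n::int. of_int n * d)"
  proof (rule discrete_real_subgroup_cyclic[of H \<eta>])
    fix x assume x: "x \<in> H" "\<bar>x\<bar> < \<eta>"
    have "\<phi> x = mat 1" using \<eta>(2)[of x] x e(2)[of "\<phi> x"] \<Gamma>_eq by (simp add: \<phi>_0 dist_commute)
    then show "x = 0" by (rule \<phi>_inj)
  qed (use \<eta>(1) int_span_closed in \<open>auto simp: H_def\<close>)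
  have "group (SL3\<lparr>carrier := \<Gamma>\<rparr>)" using subgroup.subgroup_is_group[OF \<Gamma>(1) group_SL3] .
  moreover have "(\<lambda>n::int. \<phi> (of_int n * d)) \<in> epi integer_group (SL3\<lparr>carrier := \<Gamma>\<rparr>)"
    unfolding epi_def hom_def \<Gamma>_eq d by (auto simp: \<phi>_add distrib_right SL3_def)
  ultimately have "cyclic_group (SL3\<lparr>carrier := \<Gamma>\<rparr>)"
    using group.cyclic_group_epimorphic_image[OF group_integer_group] cyclic_integer_group by blast
  then show False using type by (simp add: two_generated_type_def)
qed

text \<open>Rounding the real coordinates of a target point with respect to the lattice basis.\<close>

lemma lattice_cobounded:
  fixes u v :: "real \<times> real"
  assumes "fst u * snd v \<noteq> snd u * fst v"
  obtains R where "R \<ge> 0" "\<And>x y. \<exists>z\<in>int_span u v. \<bar>fst z - x\<bar> \<le> R \<and> \<bar>snd z - y\<bar> \<le> R"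
proof
  define D where "D = fst u * snd v - snd u * fst v"
  have D: "D \<noteq> 0" using assms by (simp add: D_def)
  let ?R = "\<bar>fst u\<bar> + \<bar>fst v\<bar> + \<bar>snd u\<bar> + \<bar>snd v\<bar>"
  show "?R \<ge> 0" by simp
  fix x y :: real
  \<comment> \<open>The real coordinates of the target, by Cramer's rule.\<close>
  define \<alpha> where "\<alpha> = (x * snd v - y * fst v) / D"
  define \<beta> where "\<beta> = (fst u * y - snd u * x) / D"
  have "D * (\<alpha> * fst u + \<beta> * fst v) = D * x" "D * (\<alpha> * snd u + \<beta> * snd v) = D * y"
    using D by (simp_all add: \<alpha>_def \<beta>_def distrib_left) (simp_all add: D_def algebra_simps)
  then have xy: "x = \<alpha> * fst u + \<beta> * fst v" "y = \<alpha> * snd u + \<beta> * snd v" using D by simp_all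
  define a where "a = \<alpha> - of_int \<lfloor>\<alpha>\<rfloor>"
  define b where "b = \<beta> - of_int \<lfloor>\<beta>\<rfloor>"
  have ab: "\<bar>a\<bar> \<le> 1" "\<bar>b\<bar> \<le> 1" unfolding a_def b_def by linarith+
  have bound: "\<bar>a * s + b * t\<bar> \<le> \<bar>s\<bar> + \<bar>t\<bar>" for s t
  proof -
    have "\<bar>a * s + b * t\<bar> \<le> \<bar>a\<bar> * \<bar>s\<bar> + \<bar>b\<bar> * \<bar>t\<bar>" by (metis abs_mult abs_triangle_ineq)
    also have "\<dots> \<le> \<bar>s\<bar> + \<bar>t\<bar>" using ab by (intro add_mono mult_left_le_one_le) auto
    finally show ?thesis .
  qed
  let ?z = "of_int \<lfloor>\<alpha>\<rfloor> *\<^sub>R u + of_int \<lfloor>\<beta>\<rfloor> *\<^sub>R v"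
  have "fst ?z - x = - (a * fst u + b * fst v)" "snd ?z - y = - (a * snd u + b * snd v)"
    by (simp_all add: xy a_def b_def algebra_simps)
  then have "\<bar>fst ?z - x\<bar> \<le> ?R" "\<bar>snd ?z - y\<bar> \<le> ?R"
    using bound[of "fst u" "fst v"] bound[of "snd u" "snd v"] by linarith+
  then show "\<exists>z\<in>int_span u v. \<bar>fst z - x\<bar> \<le> ?R \<and> \<bar>snd z - y\<bar> \<le> ?R"
    using int_spanI by blast
qed

text \<open>By Cramer's rule each integer coordinate times the determinant is a linear expression in
  the components of \<open>z\<close>, hence bounded.\<close>

lemma lattice_finite_bounded:
  fixes u v :: "real \<times> real"
  assumes "fst u * snd v \<noteq> snd u * fst v"
  shows "finite {z\<in>int_span u v. \<bar>fst z\<bar> \<le> B \<and> \<bar>snd z\<bar> \<le> B}"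
proof -
  define D where "D = fst u * snd v - snd u * fst v"
  have D: "D \<noteq> 0" using assms by (simp add: D_def)
  define M where "M = \<lceil>B * (\<bar>fst u\<bar> + \<bar>fst v\<bar> + \<bar>snd u\<bar> + \<bar>snd v\<bar>) / \<bar>D\<bar>\<rceil>"
  have "{z\<in>int_span u v. \<bar>fst z\<bar> \<le> B \<and> \<bar>snd z\<bar> \<le> B}
      \<subseteq> (\<lambda>(m, n). of_int m *\<^sub>R u + of_int n *\<^sub>R v) ` ({-M..M} \<times> {-M..M})"
  proof
    fix z assume z: "z \<in> {z\<in>int_span u v. \<bar>fst z\<bar> \<le> B \<and> \<bar>snd z\<bar> \<le> B}"
    then obtain m n :: int where mn: "z = of_int m *\<^sub>R u + of_int n *\<^sub>R v" by (auto elim: int_spanE)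
    have bound: "\<bar>i\<bar> \<le> M" if "of_int i * D = fst z * s + snd z * t"
      "\<bar>s\<bar> + \<bar>t\<bar> \<le> \<bar>fst u\<bar> + \<bar>fst v\<bar> + \<bar>snd u\<bar> + \<bar>snd v\<bar>" for i s t
    proof -
      have "of_int \<bar>i\<bar> * \<bar>D\<bar> = \<bar>fst z * s + snd z * t\<bar>" using that(1) by (simp flip: abs_mult)
      also have "\<dots> \<le> \<bar>fst z\<bar> * \<bar>s\<bar> + \<bar>snd z\<bar> * \<bar>t\<bar>" by (metis abs_mult abs_triangle_ineq)
      also have "\<dots> \<le> B * \<bar>s\<bar> + B * \<bar>t\<bar>" using z by (intro add_mono mult_right_mono) auto
      also have "\<dots> = B * (\<bar>s\<bar> + \<bar>t\<bar>)" by (simp add: distrib_left)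
      also have "\<dots> \<le> B * (\<bar>fst u\<bar> + \<bar>fst v\<bar> + \<bar>snd u\<bar> + \<bar>snd v\<bar>)"
        using z that(2) by (intro mult_left_mono) auto
      finally have "of_int \<bar>i\<bar> \<le> B * (\<bar>fst u\<bar> + \<bar>fst v\<bar> + \<bar>snd u\<bar> + \<bar>snd v\<bar>) / \<bar>D\<bar>"
        using D by (simp add: pos_le_divide_eq)
      also have "\<dots> \<le> of_int M" unfolding M_def by linarith
      finally show ?thesis by linarith
    qed
    have "\<bar>m\<bar> \<le> M" by (rule bound[of m "snd v" "- fst v"]) (auto simp: mn D_def algebra_simps)
    moreover have "\<bar>n\<bar> \<le> M" by (rule bound[of n "- snd u" "fst u"]) (auto simp: mn D_def algebra_simps)
    ultimately show "z \<in> (\<lambda>(m, n). of_int m *\<^sub>R u + of_int n *\<^sub>R v) ` ({-M..M} \<times> {-M..M})"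
      unfolding mn by (intro image_eqI[of _ _ "(m, n)"]) auto
  qed
  then show ?thesis by (rule finite_subset) auto
qed

section \<open>The finitely-sided types\<close>

definition row_unipotent :: "real \<times> real \<Rightarrow> real^3^3" where
  "row_unipotent z = mat33 1 (fst z) (snd z)  0 1 0  0 0 1"

definition diag_family :: "real \<times> real \<Rightarrow> real^3^3" where
  "diag_family z = diag3 (exp (fst z)) (exp (snd z)) (exp (- fst z - snd z))"

text \<open>The upper block is exp(fst z) (1 + snd z N) with N nilpotent. Factoring out the
  eigenvalue makes both parameters additive, which the off-diagonal entry itself is not.\<close>

definition block_family :: "real \<times> real \<Rightarrow> real^3^3" where
  "block_family z = mat33 (exp (fst z)) (exp (fst z) * snd z) 0  0 (exp (fst z)) 0  0 0 (exp (- 2 * fst z))"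

interpretation row_unipotent: SL3_family row_unipotent
  by standard (auto intro!: mat33_eqI simp: row_unipotent_def matrix_mult_nth_3 det_3)

interpretation diag_family: SL3_family diag_family
  by standard (auto intro!: mat33_eqI simp: diag_family_def diag3_def matrix_mult_nth_3 det_3 algebra_simps
      simp flip: exp_add)

interpretation block_family: SL3_family block_family
  by standard (auto intro!: mat33_eqI simp: block_family_def matrix_mult_nth_3 det_3 algebra_simps
      simp flip: exp_add)

lemma trace_form_eq_sum:
  "trace_form W Y h = (\<Sum>i\<in>UNIV. \<Sum>j\<in>UNIV. \<Sum>k\<in>UNIV. \<Sum>l\<in>UNIV. h$i$j * W$j$k * h$l$k * Y$l$i)"
  by (simp add: trace_form_def trace_def matrix_mult_nth_3 sum_3 algebra_simps)

section \<open>Type 1: unipotent matrices supported in the first row\<close>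

lemma trace_form_row_unipotent:
  assumes W: "transpose W = W" and Y: "transpose Y = Y"
  shows "trace_form W Y (row_unipotent z) = trace_form W Y (mat 1)
    + 2 * (fst z * (W$1$2 * Y$1$1 + W$2$2 * Y$1$2 + W$2$3 * Y$1$3)
         + snd z * (W$1$3 * Y$1$1 + W$2$3 * Y$1$2 + W$3$3 * Y$1$3))
    + Y$1$1 * ((fst z)\<^sup>2 * W$2$2 + 2 * fst z * snd z * W$2$3 + (snd z)\<^sup>2 * W$3$3)"
  unfolding trace_form_eq_sum sum_3 row_unipotent_def mat33_nth mat_1_nth_3
    symmetric_nth[OF W, of 2 1] symmetric_nth[OF W, of 3 1] symmetric_nth[OF W, of 3 2]
    symmetric_nth[OF Y, of 2 1] symmetric_nth[OF Y, of 3 1] symmetric_nth[OF Y, of 3 2]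
  by (simp add: power2_eq_square algebra_simps)

text \<open>The inequality of the n-th power reads n (b + n a) \<ge> 0. For n = 1 and n = -1 this
  says that the absolute value of b is at most a, and the rest follows because an integer is at most
  its square.\<close>

lemma finitely_determined_row_unipotent_cyclic:
  assumes "W \<in> P3"
  shows "finitely_determined W (range (\<lambda>n::int. row_unipotent (of_int n *\<^sub>R (1, 0))))"
  unfolding finitely_determined_def
proof (intro exI[of _ "{row_unipotent (of_int 1 *\<^sub>R (1, 0)), row_unipotent (of_int (-1) *\<^sub>R (1, 0))}"] conjI ballI impI)
  have W: "W \<in> pos_def" using assms by (simp add: P3_iff)
  fix Y h
  assume Y: "Y \<in> pos_def"
    and le: "\<forall>h\<in>{row_unipotent (of_int 1 *\<^sub>R (1, 0)), row_unipotent (of_int (-1) *\<^sub>R (1, 0))}.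
      trace_form W Y (mat 1) \<le> trace_form W Y h"
    and h: "h \<in> range (\<lambda>n::int. row_unipotent (of_int n *\<^sub>R (1, 0)))"
  obtain n :: int where n: "h = row_unipotent (of_int n *\<^sub>R (1, 0))" using h by blast
  define b where "b = 2 * (W$1$2 * Y$1$1 + W$2$2 * Y$1$2 + W$2$3 * Y$1$3)"
  define a where "a = Y$1$1 * W$2$2"
  have eq: "trace_form W Y (row_unipotent (of_int k *\<^sub>R (1, 0)))
      = trace_form W Y (mat 1) + of_int k * (b + of_int k * a)" for k
    unfolding trace_form_row_unipotent[OF pos_def_symmetric[OF W] pos_def_symmetric[OF Y]]
    by (simp add: a_def b_def power2_eq_square algebra_simps)
  have "0 \<le> b + a" "0 \<le> - b + a"
    using le eq[of 1] eq[of "-1"] by auto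
  then have ab: "\<bar>b\<bar> \<le> a" by linarith
  have "0 \<le> of_int n * (b + of_int n * a)"
  proof (cases "n = 0")
    case False
    have "0 \<le> a * (real_of_int \<bar>n\<bar> * (\<bar>n\<bar> - 1))" using ab False by (intro mult_nonneg_nonneg) auto
    also have "\<dots> = of_int n * (of_int n * a) - of_int \<bar>n\<bar> * a"
      by (simp add: algebra_simps flip: power2_eq_square)
    also have "\<dots> \<le> of_int n * (of_int n * a) - \<bar>of_int n * b\<bar>"
      using ab by (simp add: abs_mult mult_left_mono)
    also have "\<dots> \<le> of_int n * (of_int n * a) + of_int n * b" by linarith
    finally show ?thesis by (simp add: algebra_simps)
  qed auto
  then show "trace_form W Y (mat 1) \<le> trace_form W Y h" unfolding n eq by simp
qed (blast, simp)

text \<open>The unit vectors and their negatives bound both linear coefficients by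
  \<open>Y$1$1 * L\<close>, while the leading part is at least \<open>Y$1$1 * \<mu>\<close> times
  the squared length. Both scale with \<open>Y$1$1\<close>, so outside a box whose size depends only
  on \<open>W\<close> the quadratic part wins.\<close>

lemma finitely_determined_row_unipotent:
  assumes "W \<in> P3"
  shows "finitely_determined W (row_unipotent ` int_span (1, 0) (0, 1))"
proof -
  have W: "W \<in> pos_def" using assms by (simp add: P3_iff)
  obtain \<mu> where \<mu>: "\<mu> > 0" "\<And>v. \<mu> * (norm v)\<^sup>2 \<le> quadratic_form W v"
    using pos_def_lower_bound[OF W] by blast
  define L where "L = max (W$2$2) (W$3$3)"
  define N where "N = max 1 \<lceil>2 * L / \<mu>\<rceil>"
  have L: "L > 0" "W$2$2 \<le> L" "W$3$3 \<le> L" using pos_def_minors[OF W] by (auto simp: L_def)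
  let ?F = "\<lambda>(m::int, n::int). row_unipotent (of_int m, of_int n)"
  define S where "S = ?F ` ({-N..N} \<times> {-N..N})"
  have span: "int_span (1, 0) (0, 1) = range (\<lambda>(m::int, n::int). (real_of_int m, real_of_int n))"
    by (simp add: int_span_def)
  then have eq: "row_unipotent ` int_span (1, 0) (0, 1) = range ?F"
    by (simp add: image_image case_prod_beta)
  have Q: "\<mu> * (x\<^sup>2 + y\<^sup>2) \<le> x\<^sup>2 * W$2$2 + 2 * x * y * W$2$3 + y\<^sup>2 * W$3$3" for x y
    using \<mu>(2)[of "vector [0, x, y]"] unfolding quadratic_form_3[OF pos_def_symmetric[OF W]] power2_norm_eq_inner
    by (simp add: inner_vec_def sum_3 power2_eq_square mult_ac)
  show ?thesis
    unfolding finitely_determined_def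
  proof (intro exI[of _ S] conjI ballI impI)
    show "S \<subseteq> row_unipotent ` int_span (1, 0) (0, 1)" unfolding eq S_def by blast
    show "finite S" by (simp add: S_def)
    fix Y h
    assume Y: "Y \<in> pos_def" and le: "\<forall>h\<in>S. trace_form W Y (mat 1) \<le> trace_form W Y h"
      and h: "h \<in> row_unipotent ` int_span (1, 0) (0, 1)"
    obtain m n :: int where mn: "h = row_unipotent (of_int m, of_int n)" using h unfolding eq by auto
    define b where "b = 2 * (W$1$2 * Y$1$1 + W$2$2 * Y$1$2 + W$2$3 * Y$1$3)"
    define c where "c = 2 * (W$1$3 * Y$1$1 + W$2$3 * Y$1$2 + W$3$3 * Y$1$3)"
    have Y1: "Y$1$1 > 0" using pos_def_minors[OF Y] by simp
    have eq': "trace_form W Y (row_unipotent (x, y)) = trace_form W Y (mat 1) + (x * b + y * c)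
        + Y$1$1 * (x\<^sup>2 * W$2$2 + 2 * x * y * W$2$3 + y\<^sup>2 * W$3$3)" for x y
      unfolding trace_form_row_unipotent[OF pos_def_symmetric[OF W] pos_def_symmetric[OF Y]]
      by (simp add: b_def c_def algebra_simps)
    have S: "trace_form W Y (mat 1) \<le> trace_form W Y (row_unipotent (of_int k, of_int l))"
      if "\<bar>k\<bar> \<le> N" "\<bar>l\<bar> \<le> N" for k l
    proof -
      have "row_unipotent (of_int k, of_int l) \<in> S"
        unfolding S_def using that by (intro image_eqI[of _ _ "(k, l)"]) auto
      then show ?thesis using le by blast
    qed
    show "trace_form W Y (mat 1) \<le> trace_form W Y h"
    proof (cases "\<bar>m\<bar> \<le> N \<and> \<bar>n\<bar> \<le> N")
      case True
      then show ?thesis unfolding mn by (intro S) auto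
    next
      case False
      have N: "N \<ge> 1" "2 * L / \<mu> \<le> of_int N" unfolding N_def by linarith+
      have "\<bar>b\<bar> \<le> Y$1$1 * W$2$2" "\<bar>c\<bar> \<le> Y$1$1 * W$3$3"
        using S[of 1 0] S[of "-1" 0] S[of 0 1] S[of 0 "-1"] N(1) eq'[of 1 0] eq'[of "-1" 0] eq'[of 0 1] eq'[of 0 "-1"]
        by auto
      then have bc: "\<bar>b\<bar> \<le> Y$1$1 * L" "\<bar>c\<bar> \<le> Y$1$1 * L"
        using L(2,3) Y1 by (meson mult_left_mono order_trans less_imp_le)+
      define x y where "x = real_of_int m" and "y = real_of_int n"
      have "L * (\<bar>x\<bar> + \<bar>y\<bar>) \<le> \<mu> * (x\<^sup>2 + y\<^sup>2)"
      proof -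
        define s where "s = max \<bar>x\<bar> \<bar>y\<bar>"
        have "of_int N \<le> s" using False unfolding s_def x_def y_def by linarith
        then have "2 * L / \<mu> \<le> s" using N(2) by linarith
        then have s: "2 * L \<le> \<mu> * s" using \<mu>(1) by (simp add: pos_divide_le_eq mult.commute)
        have "s \<ge> 0" "\<bar>x\<bar> + \<bar>y\<bar> \<le> 2 * s" by (auto simp: s_def)
        then have "L * (\<bar>x\<bar> + \<bar>y\<bar>) \<le> L * (2 * s)" using L(1) by (intro mult_left_mono) auto
        also have "\<dots> \<le> \<mu> * s * s" using mult_right_mono[OF s \<open>s \<ge> 0\<close>] by simp
        also have "\<dots> = \<mu> * s\<^sup>2" by (simp add: power2_eq_square)
        also have "s\<^sup>2 \<le> x\<^sup>2 + y\<^sup>2" by (auto simp: s_def max_def)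
        finally show ?thesis using \<mu>(1) by (simp add: mult_left_mono)
      qed
      also have "\<dots> \<le> x\<^sup>2 * W$2$2 + 2 * x * y * W$2$3 + y\<^sup>2 * W$3$3" by (rule Q)
      finally have *: "Y$1$1 * (L * (\<bar>x\<bar> + \<bar>y\<bar>)) \<le> Y$1$1 * (x\<^sup>2 * W$2$2 + 2 * x * y * W$2$3 + y\<^sup>2 * W$3$3)"
        using Y1 by (intro mult_left_mono) auto
      have "\<bar>x * b\<bar> \<le> \<bar>x\<bar> * (Y$1$1 * L)" "\<bar>y * c\<bar> \<le> \<bar>y\<bar> * (Y$1$1 * L)"
        using bc by (auto simp: abs_mult intro: mult_left_mono)
      then have "- (Y$1$1 * (L * (\<bar>x\<bar> + \<bar>y\<bar>))) \<le> x * b + y * c" by (simp add: algebra_simps)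
      then show ?thesis using * unfolding mn x_def[symmetric] y_def[symmetric] eq' by linarith
    qed
  qed
qed

section \<open>Diagonal groups\<close>

definition weight :: "3 \<Rightarrow> real \<times> real \<Rightarrow> real" where
  "weight i z = (if i = 1 then fst z else if i = 2 then snd z else - fst z - snd z)"

lemma weight_simps [simp]: "weight 1 z = fst z" "weight 2 z = snd z" "weight 3 z = - fst z - snd z"
  by (simp_all add: weight_def)

lemma weight_scaleR: "weight i (c *\<^sub>R z) = c * weight i z"
  by (simp add: weight_def algebra_simps)

lemma weight_uminus: "weight i (- z) = - weight i z"
  by (simp add: weight_def)

lemma trace_form_diag_family:
  "trace_form (mat 1) Y (diag_family z) = (\<Sum>i\<in>UNIV. (exp (weight i z))\<^sup>2 * Y$i$i)"
  by (simp add: trace_form_eq_sum sum_3 diag_family_def diag3_def power2_eq_square algebra_simps)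

lemma trace_form_mat_1_mat_1: "trace_form (mat 1) Y (mat 1) = (\<Sum>i\<in>UNIV. Y$i$i)"
  by (simp add: trace_form_def trace_def)

text \<open>If \<open>l\<close> violates its inequality, then the diagonal entries of \<open>Y\<close> belonging to the large
  weights of \<open>l\<close> are tiny; so the inequality of an element \<open>m\<close> contracting all other directions
  is violated as well.\<close>

lemma finitely_determined_diag_family:
  assumes "W \<in> P3"
    and contract: "\<And>K. \<exists>M\<subseteq>\<Lambda>. finite M \<and> (\<forall>B. \<exists>F\<subseteq>\<Lambda>. finite F \<and>
      (\<forall>l\<in>\<Lambda> - F. \<exists>m\<in>M. \<forall>i. weight i m \<le> - K \<or> B \<le> weight i l))"
  shows "finitely_determined W (diag_family ` \<Lambda>)"
proof -
  have W: "W \<in> pos_def" using assms by (simp add: P3_iff)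
  obtain \<epsilon> C where \<epsilon>: "\<epsilon> > 0" and C: "C > 0"
    and bd: "\<forall>Y\<in>pos_def. \<forall>h. \<epsilon> * trace_form (mat 1) Y h \<le> trace_form W Y h
      \<and> trace_form W Y h \<le> C * trace_form (mat 1) Y h"
    using trace_form_bounds[OF W] by blast
  have small: "\<exists>K. c * (exp (- K))\<^sup>2 \<le> \<epsilon> / 4" for c
  proof -
    have "((\<lambda>K. c * (exp (- K))\<^sup>2) \<longlongrightarrow> 0) at_top" by real_asymp
    then have "\<forall>\<^sub>F K in at_top. c * (exp (- K))\<^sup>2 < \<epsilon> / 4" by (rule order_tendstoD) (use \<epsilon> in simp)
    then show ?thesis using eventually_happens[of _ at_top] by (force intro: less_imp_le)
  qed
  \<comment> \<open>Contraction by \<open>K\<close> brings a coordinate below a quarter of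
    \<open>\<epsilon> * T\<close>, and three quarters still add up to less than
    \<open>\<epsilon> * T\<close>.\<close>
  obtain K where K: "C * (exp (- K))\<^sup>2 \<le> \<epsilon> / 4" using small by blast
  obtain M where M: "M \<subseteq> \<Lambda>" "finite M" "\<forall>B. \<exists>F\<subseteq>\<Lambda>. finite F \<and>
      (\<forall>l\<in>\<Lambda> - F. \<exists>m\<in>M. \<forall>i. weight i m \<le> - K \<or> B \<le> weight i l)"
    using contract[of K] by blast
  define Q where "Q = (\<Sum>m\<in>M. \<Sum>i\<in>UNIV. (exp (weight i m))\<^sup>2)"
  have Q: "(exp (weight i m))\<^sup>2 \<le> Q" if "m \<in> M" for i m
  proof -
    have "(exp (weight i m))\<^sup>2 \<le> (\<Sum>i\<in>UNIV. (exp (weight i m))\<^sup>2)" by (intro member_le_sum) auto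
    also have "\<dots> \<le> Q" unfolding Q_def using that M(2) by (intro member_le_sum) (auto intro: sum_nonneg)
    finally show ?thesis .
  qed
  have Q0: "Q \<ge> 0" unfolding Q_def by (intro sum_nonneg) auto
  \<comment> \<open>\<open>B\<close> depends on \<open>M\<close> through the bound \<open>Q\<close>
    on its expansion; hence the order of the quantifiers in \<open>contract\<close>.\<close>
  obtain B where B: "C * Q * (C / \<epsilon>) * (exp (- B))\<^sup>2 \<le> \<epsilon> / 4" using small by blast
  obtain F where F: "F \<subseteq> \<Lambda>" "finite F" "\<forall>l\<in>\<Lambda> - F. \<exists>m\<in>M. \<forall>i. weight i m \<le> - K \<or> B \<le> weight i l"
    using M(3) by blast
  show ?thesis
    unfolding finitely_determined_def
  proof (intro exI[of _ "diag_family ` (M \<union> F)"] conjI ballI impI)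
    show "diag_family ` (M \<union> F) \<subseteq> diag_family ` \<Lambda>" using M(1) F(1) by blast
    show "finite (diag_family ` (M \<union> F))" using M(2) F(2) by simp
    fix Y h
    assume Y: "Y \<in> pos_def" and le: "\<forall>h\<in>diag_family ` (M \<union> F). trace_form W Y (mat 1) \<le> trace_form W Y h"
      and h: "h \<in> diag_family ` \<Lambda>"
    obtain l where l: "l \<in> \<Lambda>" "h = diag_family l" using h by blast
    show "trace_form W Y (mat 1) \<le> trace_form W Y h"
    proof (rule ccontr)
      assume neg: "\<not> ?thesis"
      then have "l \<notin> F" using le l(2) by blast
      then obtain m where m: "m \<in> M" "\<And>i. weight i m \<le> - K \<or> B \<le> weight i l" using F(3) l(1) by blast
      define T where "T = (\<Sum>i\<in>UNIV. Y$i$i)"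
      have pos: "Y$i$i > 0" for i using pos_def_minors[OF Y] exhaust_3[of i] by auto
      have yT: "Y$i$i \<le> T" for i
        unfolding T_def by (intro member_le_sum) (auto intro: less_imp_le pos)
      have T: "T > 0" unfolding T_def by (intro sum_pos pos) auto
      have T1: "\<epsilon> * T \<le> trace_form W Y (mat 1)" "trace_form W Y (mat 1) \<le> C * T"
        using bd Y unfolding T_def trace_form_mat_1_mat_1[symmetric] by auto
      have entry: "C * ((exp (weight i m))\<^sup>2 * Y$i$i) \<le> \<epsilon> / 4 * T" for i
        using m(2)[of i]
      proof
        assume "weight i m \<le> - K"
        then have "(exp (weight i m))\<^sup>2 \<le> (exp (- K))\<^sup>2" by (intro power_mono) auto
        then have "(exp (weight i m))\<^sup>2 * Y$i$i \<le> (exp (- K))\<^sup>2 * T"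
          using yT[of i] pos[of i] by (intro mult_mono) auto
        then have "C * ((exp (weight i m))\<^sup>2 * Y$i$i) \<le> C * ((exp (- K))\<^sup>2 * T)" using C by simp
        also have "\<dots> = C * (exp (- K))\<^sup>2 * T" by simp
        also have "\<dots> \<le> \<epsilon> / 4 * T" using K T by (intro mult_right_mono) auto
        finally show ?thesis .
      next
        assume "B \<le> weight i l"
        then have "(exp B)\<^sup>2 * Y$i$i \<le> (exp (weight i l))\<^sup>2 * Y$i$i"
          using pos[of i] by (intro mult_right_mono power_mono) auto
        also have "\<dots> \<le> (\<Sum>i\<in>UNIV. (exp (weight i l))\<^sup>2 * Y$i$i)"
          by (rule member_le_sum) (simp_all add: less_imp_le[OF pos])
        finally have "\<epsilon> * ((exp B)\<^sup>2 * Y$i$i) \<le> \<epsilon> * trace_form (mat 1) Y (diag_family l)"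
          using \<epsilon> by (simp add: trace_form_diag_family)
        also have "\<dots> \<le> trace_form W Y (diag_family l)" using bd Y by blast
        also have "\<dots> \<le> C * T" using neg T1(2) by (simp add: l(2))
        finally have "(exp B)\<^sup>2 * Y$i$i \<le> C / \<epsilon> * T" using \<epsilon> by (simp add: field_simps)
        then have "(exp (- B))\<^sup>2 * ((exp B)\<^sup>2 * Y$i$i) \<le> (exp (- B))\<^sup>2 * (C / \<epsilon> * T)"
          by (intro mult_left_mono) auto
        moreover have "(exp (- B))\<^sup>2 * (exp B)\<^sup>2 = 1" by (simp add: exp_minus field_simps)
        \<comment> \<open>A coordinate blown up by the violating \<open>l\<close> is tiny relative
          to the trace \<open>T\<close>, tiny enough to survive the expansion by
          \<open>m\<close>.\<close>
        ultimately have y: "Y$i$i \<le> (exp (- B))\<^sup>2 * (C / \<epsilon> * T)" by (metis mult.assoc mult_1)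
        have "C * ((exp (weight i m))\<^sup>2 * Y$i$i) \<le> C * (Q * ((exp (- B))\<^sup>2 * (C / \<epsilon> * T)))"
          using C Q[OF m(1), of i] y pos[of i] Q0 by (intro mult_left_mono mult_mono) auto
        also have "\<dots> = C * Q * (C / \<epsilon>) * (exp (- B))\<^sup>2 * T" by simp
        also have "\<dots> \<le> \<epsilon> / 4 * T" using B T by (intro mult_right_mono) auto
        finally show ?thesis .
      qed
      have "trace_form W Y (diag_family m) \<le> C * trace_form (mat 1) Y (diag_family m)" using bd Y by blast
      also have "\<dots> = (\<Sum>i\<in>UNIV. C * ((exp (weight i m))\<^sup>2 * Y$i$i))"
        by (simp add: trace_form_diag_family sum_distrib_left)
      also have "\<dots> \<le> (\<Sum>i\<in>(UNIV :: 3 set). \<epsilon> / 4 * T)" by (intro sum_mono entry)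
      also have "\<dots> < \<epsilon> * T" using \<epsilon> T by simp
      finally have "trace_form W Y (diag_family m) < \<epsilon> * T" .
      moreover have "trace_form W Y (mat 1) \<le> trace_form W Y (diag_family m)"
        using m(1) by (intro bspec[OF le] imageI) auto
      ultimately show False using T1(1) by linarith
    qed
  qed
qed

text \<open>For l = n u take m = N u or m = - N u according to the sign of n: it contracts the
  coordinates with weights of one sign, and \<open>l\<close> blows up all others, because no weight
  of \<open>u\<close> is 0.\<close>

lemma finitely_determined_diag_cyclic:
  assumes W: "W \<in> P3" and u: "\<And>i. weight i u \<noteq> 0"
  shows "finitely_determined W (diag_family ` range (\<lambda>n::int. of_int n *\<^sub>R u))"
proof (rule finitely_determined_diag_family[OF W])
  let ?\<Lambda> = "range (\<lambda>n::int. of_int n *\<^sub>R u)"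
  define \<mu> where "\<mu> = Min ((\<lambda>i. \<bar>weight i u\<bar>) ` UNIV)"
  have \<mu>: "\<mu> > 0" "\<And>i. \<mu> \<le> \<bar>weight i u\<bar>" using u by (auto simp: \<mu>_def)
  have arch: "\<exists>N::nat. K \<le> of_nat N * \<mu>" for K
    using reals_Archimedean3[OF \<mu>(1)] by (meson less_imp_le)
  fix K
  obtain N :: nat where N: "K \<le> of_nat N * \<mu>" using arch by blast
  show "\<exists>M\<subseteq>?\<Lambda>. finite M \<and> (\<forall>B. \<exists>F\<subseteq>?\<Lambda>. finite F \<and>
      (\<forall>l\<in>?\<Lambda> - F. \<exists>m\<in>M. \<forall>i. weight i m \<le> - K \<or> B \<le> weight i l))"
  proof (rule exI[of _ "{of_int (int N) *\<^sub>R u, of_int (- int N) *\<^sub>R u}"], intro conjI allI)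
    fix B
    obtain N' :: nat where N': "B \<le> of_nat N' * \<mu>" using arch by blast
    show "\<exists>F\<subseteq>?\<Lambda>. finite F \<and> (\<forall>l\<in>?\<Lambda> - F. \<exists>m\<in>{of_int (int N) *\<^sub>R u, of_int (- int N) *\<^sub>R u}.
        \<forall>i. weight i m \<le> - K \<or> B \<le> weight i l)"
    proof (intro exI[of _ "(\<lambda>n::int. of_int n *\<^sub>R u) ` {- int N'..int N'}"] conjI ballI)
      fix l assume l: "l \<in> ?\<Lambda> - (\<lambda>n::int. of_int n *\<^sub>R u) ` {- int N'..int N'}"
      then obtain n :: int where n: "l = of_int n *\<^sub>R u" "n \<notin> {- int N'..int N'}" by blast
      have *: "of_int \<sigma> * of_int (int N) * weight i u \<le> - K \<or> B \<le> of_int \<sigma> * of_int \<bar>n\<bar> * weight i u"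
        if "\<sigma> = 1 \<or> \<sigma> = -1" for \<sigma> :: int and i
      proof (cases "of_int \<sigma> * weight i u < 0")
        case True
        then have "of_int \<sigma> * weight i u \<le> - \<mu>" using \<mu>(2)[of i] that by auto
        then have "of_nat N * (of_int \<sigma> * weight i u) \<le> of_nat N * (- \<mu>)" by (intro mult_left_mono) auto
        then show ?thesis using N by (simp add: algebra_simps)
      next
        case False
        then have "\<mu> \<le> of_int \<sigma> * weight i u" using \<mu>(2)[of i] that by auto
        moreover have "of_nat N' \<le> real_of_int \<bar>n\<bar>" using n(2) by auto
        ultimately have "of_nat N' * \<mu> \<le> of_int \<bar>n\<bar> * (of_int \<sigma> * weight i u)"
          using \<mu>(1) by (intro mult_mono) auto
        then show ?thesis using N' by (simp add: algebra_simps)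
      qed
      show "\<exists>m\<in>{of_int (int N) *\<^sub>R u, of_int (- int N) *\<^sub>R u}. \<forall>i. weight i m \<le> - K \<or> B \<le> weight i l"
      proof (cases "n \<ge> 0")
        case True
        then show ?thesis using *[of 1] by (simp add: n(1) weight_scaleR)
      next
        case False
        then show ?thesis using *[of "-1"] by (simp add: n(1) weight_scaleR weight_uminus)
      qed
    qed auto
  qed (blast, simp)
qed

text \<open>The weights sum to 0, so every far lattice point has a large weight; for each index a
  fixed lattice point contracts the two other coordinates.\<close>

lemma finitely_determined_diag_lattice:
  assumes W: "W \<in> P3" and uv: "fst u * snd v \<noteq> snd u * fst v"
  shows "finitely_determined W (diag_family ` int_span u v)"
proof (rule finitely_determined_diag_family[OF W])
  let ?\<Lambda> = "int_span u v"
  fix K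
  obtain R where R: "R \<ge> 0" "\<And>x y. \<exists>z\<in>?\<Lambda>. \<bar>fst z - x\<bar> \<le> R \<and> \<bar>snd z - y\<bar> \<le> R"
    using lattice_cobounded[OF uv] by blast
  \<comment> \<open>A lattice point misses its target by at most \<open>R\<close> in each parameter,
    hence by at most \<open>2 * R\<close> in the third weight.\<close>
  define K' where "K' = K + 2 * R"
  obtain m1 where m1: "m1 \<in> ?\<Lambda>" "\<bar>fst m1 - 2 * K'\<bar> \<le> R" "\<bar>snd m1 + K'\<bar> \<le> R" using R(2)[of "2 * K'" "- K'"] by auto
  obtain m2 where m2: "m2 \<in> ?\<Lambda>" "\<bar>fst m2 + K'\<bar> \<le> R" "\<bar>snd m2 - 2 * K'\<bar> \<le> R" using R(2)[of "- K'" "2 * K'"] by auto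
  obtain m3 where m3: "m3 \<in> ?\<Lambda>" "\<bar>fst m3 + K'\<bar> \<le> R" "\<bar>snd m3 + K'\<bar> \<le> R" using R(2)[of "- K'" "- K'"] by auto
  show "\<exists>M\<subseteq>?\<Lambda>. finite M \<and> (\<forall>B. \<exists>F\<subseteq>?\<Lambda>. finite F \<and>
      (\<forall>l\<in>?\<Lambda> - F. \<exists>m\<in>M. \<forall>i. weight i m \<le> - K \<or> B \<le> weight i l))"
  proof (rule exI[of _ "{m1, m2, m3}"], intro conjI allI)
    fix B :: real
    let ?F = "{z\<in>?\<Lambda>. \<bar>fst z\<bar> \<le> 2 * \<bar>B\<bar> \<and> \<bar>snd z\<bar> \<le> 2 * \<bar>B\<bar>}"
    show "\<exists>F\<subseteq>?\<Lambda>. finite F \<and> (\<forall>l\<in>?\<Lambda> - F. \<exists>m\<in>{m1, m2, m3}. \<forall>i. weight i m \<le> - K \<or> B \<le> weight i l)"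
    proof (intro exI[of _ ?F] conjI ballI)
      show "finite ?F" by (rule lattice_finite_bounded[OF uv])
      fix l assume "l \<in> ?\<Lambda> - ?F"
      then have "\<not> (\<bar>fst l\<bar> \<le> 2 * \<bar>B\<bar> \<and> \<bar>snd l\<bar> \<le> 2 * \<bar>B\<bar>)" by blast
      then have "B \<le> fst l \<or> B \<le> snd l \<or> B \<le> - fst l - snd l" by linarith
      moreover have "snd m1 \<le> - K" "- fst m1 - snd m1 \<le> - K"
        using abs_le_D1[OF m1(2)] abs_le_D2[OF m1(2)] abs_le_D1[OF m1(3)] abs_le_D2[OF m1(3)] R(1)
        unfolding K'_def by (simp_all only: distrib_left)
      moreover have "fst m2 \<le> - K" "- fst m2 - snd m2 \<le> - K"
        using abs_le_D1[OF m2(2)] abs_le_D2[OF m2(2)] abs_le_D1[OF m2(3)] abs_le_D2[OF m2(3)] R(1)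
        unfolding K'_def by (simp_all only: distrib_left)
      moreover have "fst m3 \<le> - K" "snd m3 \<le> - K"
        using abs_le_D1[OF m3(2)] abs_le_D2[OF m3(2)] abs_le_D1[OF m3(3)] abs_le_D2[OF m3(3)] R(1)
        unfolding K'_def by (simp_all only: distrib_left)
      ultimately show "\<exists>m\<in>{m1, m2, m3}. \<forall>i. weight i m \<le> - K \<or> B \<le> weight i l"
        unfolding forall_3 by auto
    qed auto
  qed (use m1 m2 m3 in auto)
qed

section \<open>Cyclic type 4\<close>

lemma trace_form_block_family:
  assumes "transpose Y = Y"
  shows "trace_form (mat 1) Y (block_family (\<tau>, c))
    = (exp \<tau>)\<^sup>2 * (Y$1$1 + (c\<^sup>2 * Y$1$1 + 2 * c * Y$1$2 + Y$2$2)) + (exp (- 2 * \<tau>))\<^sup>2 * Y$3$3"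
  unfolding trace_form_eq_sum sum_3 block_family_def mat33_nth mat_1_nth_3 fst_conv snd_conv
    symmetric_nth[OF assms, of 2 1]
  by (simp add: power2_eq_square algebra_simps)

text \<open>A violation at a large n > 0 makes \<open>Y$1$1\<close> and the value of
  \<open>Y\<close> at (n c, 1, 0) exponentially small, hence also \<open>Y$2$2\<close>, in spite of
  a factor n^2; then the N-th power, which contracts the third coordinate, violates its inequality.
  For n < 0 the entry \<open>Y$3$3\<close> is small, and the power - N, which contracts the block,
  takes over.\<close>

lemma finitely_determined_block_cyclic:
  assumes "W \<in> P3" and t: "t > 0"
  shows "finitely_determined W (range (\<lambda>n::int. block_family (of_int n *\<^sub>R (t, c))))"
proof -
  have W: "W \<in> pos_def" using assms by (simp add: P3_iff)
  obtain \<epsilon> C where \<epsilon>: "\<epsilon> > 0" and C: "C > 0"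
    and bd: "\<forall>Y\<in>pos_def. \<forall>h. \<epsilon> * trace_form (mat 1) Y h \<le> trace_form W Y h
      \<and> trace_form W Y h \<le> C * trace_form (mat 1) Y h"
    using trace_form_bounds[OF W] by blast
  let ?E = "\<lambda>x::real. block_family (x * t, x * c)"
  have lim0: "((\<lambda>N::real. (exp (- 2 * (N * t)))\<^sup>2) \<longlongrightarrow> 0) at_top"
    and lim1: "((\<lambda>N::real. (exp (- (N * t)))\<^sup>2) \<longlongrightarrow> 0) at_top"
    and lim2: "((\<lambda>N::real. N\<^sup>2 * (exp (- (N * t)))\<^sup>2) \<longlongrightarrow> 0) at_top"
    using t by real_asymp+
  have lim: "((\<lambda>x::real. (a + b * (x * c)\<^sup>2) * (exp (- (x * t)))\<^sup>2) \<longlongrightarrow> 0) at_top" for a b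
  proof -
    have "((\<lambda>x::real. a * (exp (- (x * t)))\<^sup>2 + b * c\<^sup>2 * (x\<^sup>2 * (exp (- (x * t)))\<^sup>2)) \<longlongrightarrow> a * 0 + b * c\<^sup>2 * 0) at_top"
      by (intro tendsto_intros lim1 lim2)
    then show ?thesis by (simp add: algebra_simps power_mult_distrib)
  qed
  have "((\<lambda>N::real. C * (exp (- 2 * (N * t)))\<^sup>2) \<longlongrightarrow> 0) at_top"
    using tendsto_mult[OF tendsto_const lim0] by simp
  moreover have "((\<lambda>N::real. C * ((exp (- (N * t)))\<^sup>2 * (3 + 2 * (N * c)\<^sup>2))) \<longlongrightarrow> 0) at_top"
    using tendsto_mult[OF tendsto_const[of C] lim[of 3 2]] by (simp add: mult.commute)
  ultimately have "\<forall>\<^sub>F N in at_top. C * (exp (- 2 * (N * t)))\<^sup>2 < \<epsilon> / 4 \<and>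
      C * ((exp (- (N * t)))\<^sup>2 * (3 + 2 * (N * c)\<^sup>2)) < \<epsilon> / 4"
    using \<epsilon> by (intro eventually_conj order_tendstoD(2)) auto
  then have "\<forall>\<^sub>F N::nat in sequentially. C * (exp (- 2 * (N * t)))\<^sup>2 < \<epsilon> / 4 \<and>
      C * ((exp (- (N * t)))\<^sup>2 * (3 + 2 * (N * c)\<^sup>2)) < \<epsilon> / 4"
    using eventually_compose_filterlim filterlim_real_sequentially by blast
  then obtain N :: nat where N: "C * (exp (- 2 * (N * t)))\<^sup>2 < \<epsilon> / 4"
      "C * ((exp (- (N * t)))\<^sup>2 * (3 + 2 * (N * c)\<^sup>2)) < \<epsilon> / 4"
    using eventually_happens' sequentially_bot by blast
  \<comment> \<open>The expansion of the power N on the block and of - N on the third coordinate,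
    both fixed before \<open>n0\<close> is chosen to beat them.\<close>
  let ?a = "C * (exp (N * t))\<^sup>2" and ?b = "C * (exp (2 * (N * t)))\<^sup>2"
  have "((\<lambda>n::real. ?a * (C / \<epsilon>) * ((1 + 2 * (N * c)\<^sup>2 + 4 + 4 * (n * c)\<^sup>2) * (exp (- (n * t)))\<^sup>2)) \<longlongrightarrow> ?a * (C / \<epsilon>) * 0) at_top"
    by (intro tendsto_mult tendsto_const lim)
  then have "((\<lambda>n::real. ?a * ((1 + 2 * (N * c)\<^sup>2 + 4 * (1 + (n * c)\<^sup>2)) * (C / \<epsilon> * (exp (- (n * t)))\<^sup>2))) \<longlongrightarrow> 0) at_top"
    by (simp add: algebra_simps)
  moreover have "((\<lambda>n::real. ?b * (C / \<epsilon> * (exp (- 2 * (n * t)))\<^sup>2)) \<longlongrightarrow> 0) at_top"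
    using tendsto_mult[OF tendsto_const[of ?b] tendsto_mult[OF tendsto_const[of "C / \<epsilon>"] lim0]] by simp
  ultimately have "\<forall>\<^sub>F n in at_top. ?a * ((1 + 2 * (N * c)\<^sup>2 + 4 * (1 + (n * c)\<^sup>2)) * (C / \<epsilon> * (exp (- (n * t)))\<^sup>2)) < \<epsilon> / 4 \<and>
      ?b * (C / \<epsilon> * (exp (- 2 * (n * t)))\<^sup>2) < \<epsilon> / 4"
    using \<epsilon> by (intro eventually_conj order_tendstoD(2)) auto
  then obtain n0 where n0: "\<And>n. n \<ge> n0 \<Longrightarrow>
      ?a * ((1 + 2 * (N * c)\<^sup>2 + 4 * (1 + (n * c)\<^sup>2)) * (C / \<epsilon> * (exp (- (n * t)))\<^sup>2)) < \<epsilon> / 4"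
      "\<And>n. n \<ge> n0 \<Longrightarrow> ?b * (C / \<epsilon> * (exp (- 2 * (n * t)))\<^sup>2) < \<epsilon> / 4"
    unfolding eventually_at_top_linorder by blast
  define B where "B = max (int N) \<lceil>n0\<rceil>"
  have B: "int N \<le> B" "n0 \<le> of_int B" unfolding B_def by linarith+
  let ?F = "\<lambda>n::int. block_family (of_int n *\<^sub>R (t, c))"
  have F: "?F n = ?E (of_int n)" for n by simp
  show ?thesis
    unfolding finitely_determined_def
  proof (intro exI[of _ "?F ` {-B..B}"] conjI ballI impI)
    fix Y h
    assume Y: "Y \<in> pos_def" and le: "\<forall>h\<in>?F ` {-B..B}. trace_form W Y (mat 1) \<le> trace_form W Y h"
      and "h \<in> range ?F"
    then obtain n where n: "h = ?F n" by blast
    \<comment> \<open>The value of the form \<open>Y\<close> at (x, 1, 0); its nonnegativity at - x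
      and at 2 x yields the two comparisons below.\<close>
    define q where "q x = x\<^sup>2 * Y$1$1 + 2 * x * Y$1$2 + Y$2$2" for x
    have q0: "q x \<ge> 0" for x
      using pos_def_nonneg[OF Y, of "vector [x, 1, 0]"]
      unfolding quadratic_form_3[OF pos_def_symmetric[OF Y]] by (simp add: q_def mult_ac)
    have q_le: "q x \<le> 2 * x\<^sup>2 * Y$1$1 + 2 * Y$2$2" for x
    proof -
      have "2 * x\<^sup>2 * Y$1$1 + 2 * Y$2$2 - q x = q (- x)" by (simp add: q_def)
      then show ?thesis using q0[of "- x"] by linarith
    qed
    have Y22_le: "Y$2$2 \<le> 2 * q x + 2 * x\<^sup>2 * Y$1$1" for x
    proof -
      have "2 * q x + 2 * x\<^sup>2 * Y$1$1 - Y$2$2 = q (2 * x)" by (simp add: q_def power_mult_distrib)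
      then show ?thesis using q0[of "2 * x"] by linarith
    qed
    define T where "T = (\<Sum>i\<in>UNIV. Y$i$i)"
    have pos: "Y$1$1 > 0" "Y$2$2 > 0" "Y$3$3 > 0" using pos_def_minors[OF Y] by auto
    have T: "T = Y$1$1 + Y$2$2 + Y$3$3" by (simp add: T_def sum_3)
    have T1: "\<epsilon> * T \<le> trace_form W Y (mat 1)" "trace_form W Y (mat 1) \<le> C * T"
      using bd Y unfolding T_def trace_form_mat_1_mat_1[symmetric] by auto
    have tf: "trace_form (mat 1) Y (?E x) = (exp (x * t))\<^sup>2 * (Y$1$1 + q (x * c)) + (exp (- 2 * (x * t)))\<^sup>2 * Y$3$3" for x
      unfolding trace_form_block_family[OF pos_def_symmetric[OF Y]] q_def ..
    have upper: "trace_form W Y (?E x) \<le> C * ((exp (x * t))\<^sup>2 * (Y$1$1 + q (x * c)))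
        + C * ((exp (- 2 * (x * t)))\<^sup>2 * Y$3$3)" for x
      using bd Y unfolding distrib_left[symmetric] tf[symmetric] by blast
    show "trace_form W Y (mat 1) \<le> trace_form W Y h"
    proof (rule ccontr)
      assume neg: "\<not> ?thesis"
      then have "n \<notin> {-B..B}" using le n by blast
      then have nB: "real_of_int B \<le> \<bar>of_int n\<bar>" by auto
      have "\<epsilon> * trace_form (mat 1) Y (?E (of_int n)) \<le> C * T"
        using bd[rule_format, OF Y, of h] neg T1(2) unfolding n F by linarith
      then have small: "(exp (of_int n * t))\<^sup>2 * (Y$1$1 + q (of_int n * c)) + (exp (- 2 * (of_int n * t)))\<^sup>2 * Y$3$3 \<le> C / \<epsilon> * T"
        using \<epsilon> unfolding tf by (simp add: pos_le_divide_eq mult.commute)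
      have inv: "(exp (- s))\<^sup>2 * ((exp s)\<^sup>2 * y) = y" for s y :: real
        by (simp add: exp_minus field_simps)
      show False
      proof (cases "n \<ge> 0")
        case True
        define k where "k = real_of_int n"
        have k: "k \<ge> n0" using nB B(2) True by (simp add: k_def)
        define \<delta> where "\<delta> = C / \<epsilon> * (exp (- (k * t)))\<^sup>2"
        have "0 \<le> (exp (- 2 * (k * t)))\<^sup>2 * Y$3$3" using pos by simp
        then have "(exp (k * t))\<^sup>2 * (Y$1$1 + q (k * c)) \<le> C / \<epsilon> * T"
          using small unfolding k_def by linarith
        then have "(exp (- (k * t)))\<^sup>2 * ((exp (k * t))\<^sup>2 * (Y$1$1 + q (k * c))) \<le> (exp (- (k * t)))\<^sup>2 * (C / \<epsilon> * T)"
          by (rule mult_left_mono) simp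
        then have "Y$1$1 + q (k * c) \<le> \<delta> * T" unfolding inv \<delta>_def by (simp add: mult_ac)
        then have Yk: "Y$1$1 \<le> \<delta> * T" "q (k * c) \<le> \<delta> * T" using q0[of "k * c"] pos by linarith+
        have "2 * (k * c)\<^sup>2 * Y$1$1 \<le> 2 * (k * c)\<^sup>2 * (\<delta> * T)" by (rule mult_left_mono[OF Yk(1)]) simp
        then have Y22: "Y$2$2 \<le> 2 * (\<delta> * T) + 2 * (k * c)\<^sup>2 * (\<delta> * T)" using Y22_le[of "k * c"] Yk(2) by linarith
        have "2 * (N * c)\<^sup>2 * Y$1$1 \<le> 2 * (N * c)\<^sup>2 * (\<delta> * T)" by (rule mult_left_mono[OF Yk(1)]) simp
        then have "Y$1$1 + q (N * c) \<le> \<delta> * T + 2 * (N * c)\<^sup>2 * (\<delta> * T) + 2 * (2 * (\<delta> * T) + 2 * (k * c)\<^sup>2 * (\<delta> * T))"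
          using add_mono[OF Yk(1) order_trans[OF q_le[of "N * c"] add_mono[OF _ mult_left_mono[OF Y22, of 2]]]]
          by (simp add: add.assoc)
        also have "\<dots> = (1 + 2 * (N * c)\<^sup>2 + 4 * (1 + (k * c)\<^sup>2)) * \<delta> * T" by algebra
        finally have "C * ((exp (N * t))\<^sup>2 * (Y$1$1 + q (N * c)))
            \<le> C * ((exp (N * t))\<^sup>2 * ((1 + 2 * (N * c)\<^sup>2 + 4 * (1 + (k * c)\<^sup>2)) * \<delta> * T))"
          using C by (intro mult_left_mono) auto
        also have "\<dots> = ?a * ((1 + 2 * (N * c)\<^sup>2 + 4 * (1 + (k * c)\<^sup>2)) * \<delta>) * T" by simp
        also have "\<dots> \<le> \<epsilon> / 4 * T"
          using n0(1)[OF k] pos T unfolding \<delta>_def by (intro mult_right_mono) auto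
        finally have 1: "C * ((exp (N * t))\<^sup>2 * (Y$1$1 + q (N * c))) \<le> \<epsilon> / 4 * T" .
        have "C * ((exp (- 2 * (N * t)))\<^sup>2 * Y$3$3) = C * (exp (- 2 * (N * t)))\<^sup>2 * Y$3$3" by simp
        also have "\<dots> \<le> \<epsilon> / 4 * T" using N(1) pos T \<epsilon> by (intro mult_mono) auto
        finally have "trace_form W Y (?E N) \<le> \<epsilon> / 4 * T + \<epsilon> / 4 * T" using upper[of N] 1 by linarith
        also have "\<dots> < \<epsilon> * T" using \<epsilon> pos T by simp
        also have "\<dots> \<le> trace_form W Y (?F (int N))"
          using T1(1) le B(1) by (intro order_trans[OF T1(1)] bspec[OF le] imageI) auto
        finally show False by (simp add: F)
      next
        case False
        define k where "k = - real_of_int n"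
        have k: "k \<ge> n0" using nB B(2) False by (simp add: k_def)
        have "0 \<le> (exp (of_int n * t))\<^sup>2 * (Y$1$1 + q (of_int n * c))" using pos q0[of "of_int n * c"] by simp
        then have "(exp (2 * (k * t)))\<^sup>2 * Y$3$3 \<le> C / \<epsilon> * T" using small by (simp add: k_def)
        then have "(exp (- (2 * (k * t))))\<^sup>2 * ((exp (2 * (k * t)))\<^sup>2 * Y$3$3) \<le> (exp (- (2 * (k * t))))\<^sup>2 * (C / \<epsilon> * T)"
          by (rule mult_left_mono) simp
        then have Y33: "Y$3$3 \<le> C / \<epsilon> * (exp (- 2 * (k * t)))\<^sup>2 * T" unfolding inv by (simp add: mult_ac)
        have "2 * (N * c)\<^sup>2 * Y$1$1 \<le> 2 * (N * c)\<^sup>2 * T" using T pos by (intro mult_left_mono) auto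
        moreover have "q (- N * c) \<le> 2 * (N * c)\<^sup>2 * Y$1$1 + 2 * Y$2$2" using q_le[of "- N * c"] by simp
        moreover have "Y$1$1 + 2 * Y$2$2 \<le> T + 2 * T" using T pos by simp
        ultimately have "Y$1$1 + q (- N * c) \<le> T + 2 * (N * c)\<^sup>2 * T + 2 * T" by simp
        also have "\<dots> = (3 + 2 * (N * c)\<^sup>2) * T" by algebra
        finally have "C * ((exp (- N * t))\<^sup>2 * (Y$1$1 + q (- N * c))) \<le> C * ((exp (- N * t))\<^sup>2 * ((3 + 2 * (N * c)\<^sup>2) * T))"
          using C by (intro mult_left_mono) auto
        also have "\<dots> = C * ((exp (- (N * t)))\<^sup>2 * (3 + 2 * (N * c)\<^sup>2)) * T" by simp
        also have "\<dots> \<le> \<epsilon> / 4 * T" using N(2) pos T by (intro mult_right_mono) auto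
        finally have 1: "C * ((exp (- N * t))\<^sup>2 * (Y$1$1 + q (- N * c))) \<le> \<epsilon> / 4 * T" .
        have "C * ((exp (- 2 * (- N * t)))\<^sup>2 * Y$3$3) = ?b * Y$3$3" by simp
        also have "\<dots> \<le> ?b * (C / \<epsilon> * (exp (- 2 * (k * t)))\<^sup>2 * T)" using C Y33 by (intro mult_left_mono) auto
        also have "\<dots> = ?b * (C / \<epsilon> * (exp (- 2 * (k * t)))\<^sup>2) * T" by simp
        also have "\<dots> \<le> \<epsilon> / 4 * T" using n0(2)[OF k] pos T by (intro mult_right_mono) auto
        finally have "trace_form W Y (?E (- N)) \<le> \<epsilon> / 4 * T + \<epsilon> / 4 * T" using upper[of "- N"] 1 by linarith
        also have "\<dots> < \<epsilon> * T" using \<epsilon> pos T by simp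
        also have "\<dots> \<le> trace_form W Y (?F (- int N))"
          using B(1) by (intro order_trans[OF T1(1)] bspec[OF le] imageI) auto
        finally show False by (simp add: F)
      qed
    qed
  qed auto
qed

section \<open>The infinitely-sided types\<close>

definition col_unipotent :: "real \<times> real \<Rightarrow> real^3^3" where
  "col_unipotent z = mat33 1 0 (fst z)  0 1 (snd z)  0 0 1"

text \<open>The logarithm of \<open>jordan_unipotent (x, z)\<close> is \<open>x N + z N\<^sup>2\<close>, where \<open>N\<close> is the nilpotent
  Jordan block.\<close>

definition jordan_unipotent :: "real \<times> real \<Rightarrow> real^3^3" where
  "jordan_unipotent z = mat33 1 (fst z) (snd z + (fst z)\<^sup>2 / 2)  0 1 (fst z)  0 0 1"

interpretation col_unipotent: SL3_family col_unipotent
  by standard (auto intro!: mat33_eqI simp: col_unipotent_def matrix_mult_nth_3 det_3)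

interpretation jordan_unipotent: SL3_family jordan_unipotent
  by standard (auto intro!: mat33_eqI simp: jordan_unipotent_def matrix_mult_nth_3 det_3 power2_eq_square
      field_simps)

context SL3_family
begin

lemma not_finitely_determinedI:
  assumes "\<And>P. finite P \<Longrightarrow> P \<subseteq> \<Lambda> \<Longrightarrow> \<exists>Y\<in>pos_def. (\<forall>z\<in>P. trace_form W Y (mat 1) \<le> trace_form W Y (E z)) \<and>
    (\<exists>z\<in>\<Lambda>. trace_form W Y (E z) < trace_form W Y (mat 1))"
  shows "\<not> finitely_determined W (E ` \<Lambda>)"
proof
  assume "finitely_determined W (E ` \<Lambda>)"
  then obtain S where S: "S \<subseteq> E ` \<Lambda>" "finite S"
    and det: "\<And>Y. Y \<in> pos_def \<Longrightarrow> \<forall>h\<in>S. trace_form W Y (mat 1) \<le> trace_form W Y h \<Longrightarrow>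
      \<forall>h\<in>E ` \<Lambda>. trace_form W Y (mat 1) \<le> trace_form W Y h"
    unfolding finitely_determined_def by blast
  obtain P where P: "P \<subseteq> \<Lambda>" "finite P" "S = E ` P"
    using finite_subset_image[OF S(2,1)] by blast
  obtain Y z where Y: "Y \<in> pos_def" "\<forall>z\<in>P. trace_form W Y (mat 1) \<le> trace_form W Y (E z)"
    and z: "z \<in> \<Lambda>" "trace_form W Y (E z) < trace_form W Y (mat 1)"
    using assms[OF P(2,1)] by blast
  have "trace_form W Y (mat 1) \<le> trace_form W Y (E z)"
    using det[OF Y(1)] Y(2) P(3) z(1) by blast
  then show False using z(2) by simp
qed

text \<open>Strict inequalities survive adding a small multiple of the identity, so a degenerate
  \<open>Y\<close> of low rank, for which the form is explicit, is as good as a positive definite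
  one. The parameter 0, where equality always holds, is exempted.\<close>

lemma not_finitely_determined_semidefiniteI:
  assumes sep: "\<And>P. finite P \<Longrightarrow> P \<subseteq> \<Lambda> \<Longrightarrow> \<exists>Y. transpose Y = Y \<and> (\<forall>v. 0 \<le> quadratic_form Y v) \<and>
    (\<forall>z\<in>P. z \<noteq> 0 \<longrightarrow> trace_form W Y (mat 1) < trace_form W Y (E z)) \<and>
    (\<exists>z\<in>\<Lambda>. trace_form W Y (E z) < trace_form W Y (mat 1))"
  shows "\<not> finitely_determined W (E ` \<Lambda>)"
proof (rule not_finitely_determinedI)
  fix P assume P: "finite P" "P \<subseteq> \<Lambda>"
  obtain Y z where Y: "transpose Y = Y" "\<forall>v. 0 \<le> quadratic_form Y v"
      "\<forall>z\<in>P. z \<noteq> 0 \<longrightarrow> trace_form W Y (mat 1) < trace_form W Y (E z)"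
    and z: "z \<in> \<Lambda>" "trace_form W Y (E z) < trace_form W Y (mat 1)"
    using sep[OF P] by blast
  let ?Y = "\<lambda>t::real. Y + t *\<^sub>R mat 1"
  have lim: "((\<lambda>t. trace_form W (?Y t) h) \<longlongrightarrow> trace_form W Y h) (at_right 0)" for h
  proof -
    have "((\<lambda>t. trace_form W Y h + t * trace_form W (mat 1) h) \<longlongrightarrow> trace_form W Y h + 0 * trace_form W (mat 1) h) (at_right 0)"
      by (intro tendsto_intros)
    then show ?thesis by (simp add: trace_form_add trace_form_scaleR)
  qed
  have less: "\<forall>\<^sub>F t in at_right 0. trace_form W (?Y t) g < trace_form W (?Y t) h"
    if "trace_form W Y g < trace_form W Y h" for g h
    using order_tendstoD(1)[OF tendsto_diff[OF lim[of h] lim[of g]], of 0] that by simp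
  have "\<forall>\<^sub>F t in at_right 0. \<forall>z\<in>P. trace_form W (?Y t) (mat 1) \<le> trace_form W (?Y t) (E z)"
  proof (rule eventually_ball_finite[OF P(1)], rule ballI)
    fix z assume z: "z \<in> P"
    show "\<forall>\<^sub>F t in at_right 0. trace_form W (?Y t) (mat 1) \<le> trace_form W (?Y t) (E z)"
    proof (cases "z = 0")
      case True
      then show ?thesis by (simp add: E_0)
    next
      case False
      have "\<forall>\<^sub>F t in at_right 0. trace_form W (?Y t) (mat 1) < trace_form W (?Y t) (E z)"
        using Y(3) z False by (intro less) blast
      then show ?thesis by eventually_elim simp
    qed
  qed
  moreover have "\<forall>\<^sub>F t in at_right 0. trace_form W (?Y t) (E z) < trace_form W (?Y t) (mat 1)"
    by (rule less[OF z(2)])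
  moreover have "\<forall>\<^sub>F t in at_right (0::real). t > 0" by (rule eventually_at_right_less)
  ultimately have "\<forall>\<^sub>F t in at_right 0. ?Y t \<in> pos_def \<and>
      (\<forall>z\<in>P. trace_form W (?Y t) (mat 1) \<le> trace_form W (?Y t) (E z)) \<and>
      trace_form W (?Y t) (E z) < trace_form W (?Y t) (mat 1)"
  proof eventually_elim
    case (elim t)
    have "0 < quadratic_form (?Y t) v" if "v \<noteq> 0" for v
    proof -
      have "quadratic_form (?Y t) v = quadratic_form Y v + t * (v \<bullet> v)"
        by (simp add: matrix_vector_mult_add_rdistrib inner_add_right flip: scaleR_matrix_vector_assoc)
      moreover have "0 < t * (v \<bullet> v)" using elim(3) that by simp
      ultimately show ?thesis using Y(2) by (simp add: add_nonneg_pos)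
    qed
    then have "?Y t \<in> pos_def" using Y(1) by (simp add: pos_def_def transpose_add transpose_scalar)
    then show ?case using elim by blast
  qed
  then obtain t where "?Y t \<in> pos_def \<and>
      (\<forall>z\<in>P. trace_form W (?Y t) (mat 1) \<le> trace_form W (?Y t) (E z)) \<and>
      trace_form W (?Y t) (E z) < trace_form W (?Y t) (mat 1)"
    using eventually_happens[of _ "at_right (0::real)"] by auto
  then show "\<exists>Y\<in>pos_def. (\<forall>z\<in>P. trace_form W Y (mat 1) \<le> trace_form W Y (E z)) \<and>
      (\<exists>z\<in>\<Lambda>. trace_form W Y (E z) < trace_form W Y (mat 1))"
    using z(1) by blast
qed

end

lemma mat33_symmetric: "transpose (mat33 a b c b d e c e f) = mat33 a b c b d e c e f"
  by (intro mat33_eqI) simp_all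

text \<open>For types 1' and 3' the entry \<open>Y$3$3\<close> adds the same amount to f(h) for
  every h. It may thus be as large as needed, here making the determinant 1, and \<open>c\<close>
  and \<open>e\<close> can be prescribed at will.\<close>

lemma pos_def_large_corner:
  assumes "a > 0" "a * d - b\<^sup>2 > 0"
  shows "\<exists>r. mat33 a b c b d e c e r \<in> pos_def"
proof -
  define r where "r = (1 + a * e\<^sup>2 + d * c\<^sup>2 - 2 * b * e * c) / (a * d - b\<^sup>2)"
  have "det (mat33 a b c b d e c e r) = r * (a * d - b\<^sup>2) + 2 * b * e * c - a * e\<^sup>2 - d * c\<^sup>2"
    unfolding det_symmetric_3[OF mat33_symmetric] by (simp add: algebra_simps)
  also have "\<dots> = 1" using assms(2) by (simp add: r_def)
  finally show ?thesis using assms by (intro exI[of _ r] pos_defI mat33_symmetric) simp_all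
qed

section \<open>Type 1': unipotent matrices supported in the last column\<close>

lemma trace_form_col_unipotent:
  assumes W: "transpose W = W" and Y: "transpose Y = Y"
  shows "trace_form W Y (col_unipotent z) = trace_form W Y (mat 1)
    + 2 * (fst z * (W$1$3 * Y$1$1 + W$2$3 * Y$1$2 + W$3$3 * Y$1$3)
         + snd z * (W$1$3 * Y$1$2 + W$2$3 * Y$2$2 + W$3$3 * Y$2$3))
    + W$3$3 * ((fst z)\<^sup>2 * Y$1$1 + 2 * fst z * snd z * Y$1$2 + (snd z)\<^sup>2 * Y$2$2)"
  unfolding trace_form_eq_sum sum_3 col_unipotent_def mat33_nth mat_1_nth_3
    symmetric_nth[OF W, of 2 1] symmetric_nth[OF W, of 3 1] symmetric_nth[OF W, of 3 2]
    symmetric_nth[OF Y, of 2 1] symmetric_nth[OF Y, of 3 1] symmetric_nth[OF Y, of 3 2]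
  by (simp add: power2_eq_square algebra_simps)

text \<open>The inequality of \<open>z\<close> involves a binary quadratic form, for which we take
  \<open>(K x - y)\<^sup>2 + \<epsilon> (x\<^sup>2 + y\<^sup>2)\<close>, and a linear form, which the third column of \<open>Y\<close> makes arbitrary:
  we take \<open>- 2 \<epsilon> (x + K y)\<close>. Among the small vectors only \<open>0\<close> is a multiple of \<open>(1, K)\<close>.\<close>

lemma not_finitely_determined_col_unipotent:
  assumes "W \<in> P3"
  shows "\<not> finitely_determined W (col_unipotent ` int_span (0, 1) (1, 0))"
proof (rule col_unipotent.not_finitely_determinedI)
  let ?\<Lambda> = "int_span (0, 1) (1, 0) :: (real \<times> real) set"
  have W: "W \<in> pos_def" using assms by (simp add: P3_iff)
  have W33: "W$3$3 > 0" using pos_def_minors[OF W] by simp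
  fix P assume P: "finite P" "P \<subseteq> ?\<Lambda>"
  have "finite ((\<lambda>z. \<bar>fst z\<bar> + \<bar>snd z\<bar>) ` P)" using P by simp
  then have "bdd_above ((\<lambda>z. \<bar>fst z\<bar> + \<bar>snd z\<bar>) ` P)" by (rule bdd_above_finite)
  then obtain b where b: "\<And>z. z \<in> P \<Longrightarrow> \<bar>fst z\<bar> + \<bar>snd z\<bar> \<le> b" by (auto simp: bdd_above_def)
  define n where "n = nat \<lceil>b\<rceil>"
  \<comment> \<open>An integer exceeding the size of all elements of \<open>P\<close>, so that (1,
    K) is a lattice point outside \<open>P\<close>.\<close>
  define K where "K = real n + 1"
  have K: "K > 0" "K \<ge> 1" "K = of_int (int n + 1)" by (simp_all add: K_def)
  have bK: "\<bar>fst z\<bar> + \<bar>snd z\<bar> < K" if "z \<in> P" for z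
    using b[OF that] unfolding K_def n_def by linarith
  \<comment> \<open>Makes the linear part at most 1 on \<open>P\<close>, which the square of a
    nonzero integer K i - j absorbs.\<close>
  define \<epsilon> where "\<epsilon> = 1 / (2 * K * K)"
  have \<epsilon>: "\<epsilon> > 0" using K by (simp add: \<epsilon>_def)
  define p where "p = K\<^sup>2 + \<epsilon>"
  \<comment> \<open>\<open>c\<close> and \<open>e\<close> are solved from the demand that the linear
    coefficients be - \<epsilon> and - \<epsilon> K, up to the factor 2
    \<open>W$3$3\<close>.\<close>
  define c where "c = - (\<epsilon> + (W$1$3 * p - W$2$3 * K) / W$3$3)"
  define e where "e = - (\<epsilon> * K + (- W$1$3 * K + W$2$3 * (1 + \<epsilon>)) / W$3$3)"
  have "p * (1 + \<epsilon>) - (- K)\<^sup>2 > 0" using \<epsilon> by (simp add: p_def algebra_simps add_pos_nonneg)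
  then obtain r where Y: "mat33 p (- K) c (- K) (1 + \<epsilon>) e c e r \<in> pos_def" (is "?Y \<in> _")
    using pos_def_large_corner[of p "1 + \<epsilon>" "- K" c e] \<epsilon> by (auto simp: p_def add_nonneg_pos)
  have tf: "trace_form W ?Y (col_unipotent (x, y)) = trace_form W ?Y (mat 1)
      + W$3$3 * ((K * x - y)\<^sup>2 + \<epsilon> * (x\<^sup>2 + y\<^sup>2) - 2 * \<epsilon> * (x + K * y))" for x y
  proof -
    have "W$1$3 * p + W$2$3 * - K + W$3$3 * c = - W$3$3 * \<epsilon>"
      "W$1$3 * - K + W$2$3 * (1 + \<epsilon>) + W$3$3 * e = - W$3$3 * (\<epsilon> * K)"
      using W33 by (simp_all add: c_def e_def field_simps)
    then show ?thesis
      unfolding trace_form_col_unipotent[OF pos_def_symmetric[OF W] pos_def_symmetric[OF Y]] mat33_nth fst_conv snd_conv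
      by (simp only:) (simp add: p_def power2_eq_square algebra_simps)
  qed
  show "\<exists>Y\<in>pos_def. (\<forall>z\<in>P. trace_form W Y (mat 1) \<le> trace_form W Y (col_unipotent z)) \<and>
      (\<exists>z\<in>?\<Lambda>. trace_form W Y (col_unipotent z) < trace_form W Y (mat 1))"
  proof (intro bexI[of _ ?Y] conjI ballI Y)
    fix z assume z: "z \<in> P"
    then have "z \<in> ?\<Lambda>" using P(2) by blast
    then obtain j i :: int where "z = of_int j *\<^sub>R (0, 1) + of_int i *\<^sub>R (1, 0)" by (rule int_spanE)
    then have zij: "z = (of_int i, of_int j)" by simp
    have small: "\<bar>real_of_int i\<bar> + \<bar>real_of_int j\<bar> < K" using bK[OF z] by (simp add: zij)
    have "0 \<le> (K * of_int i - of_int j)\<^sup>2 + \<epsilon> * ((of_int i)\<^sup>2 + (of_int j)\<^sup>2) - 2 * \<epsilon> * (of_int i + K * of_int j)"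
    proof (cases "K * of_int i = (of_int j :: real)")
      case True
      have "i = 0"
      proof (rule ccontr)
        assume "i \<noteq> 0"
        then have "1 \<le> \<bar>real_of_int i\<bar>" by linarith
        then have "K * 1 \<le> K * \<bar>real_of_int i\<bar>" using K(1) by (intro mult_left_mono) auto
        also have "\<dots> = \<bar>real_of_int j\<bar>" using True K(1) by (simp flip: True add: abs_mult)
        finally show False using small by linarith
      qed
      then show ?thesis using True by simp
    next
      case False
      then have "(int n + 1) * i - j \<noteq> 0" using K(3) by (metis eq_iff_diff_eq_0 of_int_mult)
      then have "1 \<le> \<bar>(int n + 1) * i - j\<bar>" by linarith
      then have "1 \<le> \<bar>of_int ((int n + 1) * i - j) :: real\<bar>" by linarith
      then have "1 \<le> \<bar>K * of_int i - of_int j\<bar>" by (simp add: K(3))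
      then have 1: "1 \<le> (K * of_int i - of_int j)\<^sup>2" by (metis abs_le_square_iff abs_one one_power2)
      have "of_int i + K * of_int j \<le> K * \<bar>of_int i\<bar> + K * \<bar>of_int j\<bar>"
        using K(1,2) mult_right_mono[of 1 K "\<bar>of_int i\<bar>"] by (intro add_mono mult_left_mono) auto
      also have "\<dots> = K * (\<bar>of_int i\<bar> + \<bar>of_int j\<bar>)" by (simp add: distrib_left)
      also have "\<dots> \<le> K * K" using small K(1) by (intro mult_left_mono) auto
      finally have "2 * \<epsilon> * (of_int i + K * of_int j) \<le> 2 * \<epsilon> * (K * K)" using \<epsilon> by simp
      also have "\<dots> = 1" using K(1) by (simp add: \<epsilon>_def)
      moreover have "0 \<le> \<epsilon> * ((of_int i)\<^sup>2 + (of_int j)\<^sup>2)" using \<epsilon> by simp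
      ultimately show ?thesis using 1 by linarith
    qed
    then show "trace_form W ?Y (mat 1) \<le> trace_form W ?Y (col_unipotent z)"
      unfolding zij tf using W33 by simp
  next
    have "(1, K) \<in> ?\<Lambda>" using int_spanI[of "int n + 1" "(0, 1) :: real \<times> real" 1 "(1, 0)"] by (simp add: K(3))
    moreover have "trace_form W ?Y (col_unipotent (1, K)) < trace_form W ?Y (mat 1)"
    proof -
      have "(K * 1 - K)\<^sup>2 + \<epsilon> * (1\<^sup>2 + K\<^sup>2) - 2 * \<epsilon> * (1 + K * K) = - (\<epsilon> * (1 + K * K))"
        by (simp add: power2_eq_square algebra_simps)
      also have "\<dots> < 0" using \<epsilon> K(1) by (simp add: add_pos_pos)
      finally show ?thesis unfolding tf using W33 by (simp add: mult_pos_neg)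
    qed
    ultimately show "\<exists>z\<in>?\<Lambda>. trace_form W ?Y (col_unipotent z) < trace_form W ?Y (mat 1)" by blast
  qed
qed

section \<open>Cyclic type 3'\<close>

lemma trace_form_diag_family_general:
  assumes W: "transpose W = W" and Y: "transpose Y = Y"
  shows "trace_form W Y (diag_family (s, - s)) = W$1$1 * Y$1$1 * (exp s)\<^sup>2 + W$2$2 * Y$2$2 / (exp s)\<^sup>2
    + W$3$3 * Y$3$3 + 2 * W$1$2 * Y$1$2 + 2 * W$1$3 * Y$1$3 * exp s + 2 * W$2$3 * Y$2$3 / exp s"
  unfolding trace_form_eq_sum sum_3 diag_family_def diag3_def mat33_nth fst_conv snd_conv
    symmetric_nth[OF W, of 2 1] symmetric_nth[OF W, of 3 1] symmetric_nth[OF W, of 3 2]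
    symmetric_nth[OF Y, of 2 1] symmetric_nth[OF Y, of 3 1] symmetric_nth[OF Y, of 3 2]
  by (simp add: power2_eq_square exp_minus field_simps)

text \<open>In terms of \<open>x = exp (n s)\<close>, the inequality of the \<open>n\<close>th power is a quartic, which for suitable
  \<open>Y\<close> equals \<open>(x - 1)\<^sup>2 (x - X1) (x - X2) \<ge> 0\<close>. All powers satisfy it except those with \<open>x\<close> between \<open>X1\<close> and
  \<open>X2\<close>.\<close>

lemma not_finitely_determined_diag:
  assumes "W \<in> P3" "W$1$3 \<noteq> 0" "W$2$3 \<noteq> 0" and s: "s \<noteq> 0"
  shows "\<not> finitely_determined W (diag_family ` range (\<lambda>n::int. of_int n *\<^sub>R (s, - s)))"
proof (rule diag_family.not_finitely_determinedI)
  let ?\<Lambda> = "range (\<lambda>n::int. of_int n *\<^sub>R (s, - s))"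
  have W: "W \<in> pos_def" using assms by (simp add: P3_iff)
  note m = pos_def_minors[OF W]
  fix P assume P: "finite P" "P \<subseteq> ?\<Lambda>"
  have "bdd_above ((\<lambda>z. \<bar>fst z\<bar>) ` P)" using P(1) by (intro bdd_above_finite) auto
  then obtain b where b: "\<And>z. z \<in> P \<Longrightarrow> \<bar>fst z\<bar> \<le> b" by (auto simp: bdd_above_def)
  have "\<bar>s\<bar> > 0" using s by simp
  then obtain N :: nat where N: "max b 0 < real N * \<bar>s\<bar>" using reals_Archimedean3 by blast
  \<comment> \<open>Half a step on either side of \<plusminus> N, so that exactly one power falls
    between \<open>X1\<close> and \<open>X2\<close>; the 0 in the choice of \<open>N\<close> makes
    that power nontrivial.\<close>
  define X1 where "X1 = exp ((N - 1/2) * \<bar>s\<bar>)"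
  define X2 where "X2 = exp ((N + 1/2) * \<bar>s\<bar>)"
  have X: "X1 > 0" "X2 > 0" by (simp_all add: X1_def X2_def)
  \<comment> \<open>Comparison of coefficients with the quartic. The coefficient of x^2 takes care
    of itself, because f(h) - f(1) vanishes at x = 1.\<close>
  let ?a = "1 / W$1$1" and ?d = "X1 * X2 / W$2$2"
  let ?c = "- (2 + X1 + X2) / (2 * W$1$3)" and ?e = "- (X1 + X2 + 2 * X1 * X2) / (2 * W$2$3)"
  have "?a > 0" "?a * ?d - 0\<^sup>2 > 0" using m X by simp_all
  then obtain r where Y: "mat33 ?a 0 ?c 0 ?d ?e ?c ?e r \<in> pos_def" (is "?Y \<in> _")
    using pos_def_large_corner by blast
  have 1: "W$1$1 * ?a = 1" "W$2$2 * ?d = X1 * X2" "2 * W$1$3 * ?c = - (2 + X1 + X2)"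
    "2 * W$2$3 * ?e = - (X1 + X2 + 2 * X1 * X2)"
    using m assms(2,3) by simp_all
  have eq: "trace_form W ?Y (diag_family (t, - t)) = (exp t)\<^sup>2 + X1 * X2 / (exp t)\<^sup>2 + W$3$3 * r
      - (2 + X1 + X2) * exp t - (X1 + X2 + 2 * X1 * X2) / exp t" for t
    unfolding trace_form_diag_family_general[OF pos_def_symmetric[OF W] pos_def_symmetric[OF Y]] mat33_nth 1
    by (simp add: algebra_simps diff_divide_distrib add_divide_distrib)
  have tf1: "trace_form W ?Y (mat 1) = 1 + X1 * X2 + W$3$3 * r - (2 + X1 + X2) - (X1 + X2 + 2 * X1 * X2)"
    using eq[of 0] diag_family.E_0 by (simp add: zero_prod_def)
  have tf: "trace_form W ?Y (diag_family (t, - t)) = trace_form W ?Y (mat 1)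
      + (exp t - 1)\<^sup>2 * ((exp t - X1) * (exp t - X2)) / (exp t)\<^sup>2" for t
  proof -
    define x where "x = exp t"
    have "x > 0" by (simp add: x_def)
    then show ?thesis unfolding eq tf1 x_def[symmetric]
      by (simp add: field_simps power2_eq_square)
  qed
  show "\<exists>Y\<in>pos_def. (\<forall>z\<in>P. trace_form W Y (mat 1) \<le> trace_form W Y (diag_family z)) \<and>
      (\<exists>z\<in>?\<Lambda>. trace_form W Y (diag_family z) < trace_form W Y (mat 1))"
  proof (intro bexI[of _ ?Y] conjI ballI Y)
    fix z assume z: "z \<in> P"
    then obtain n :: int where n: "z = (of_int n * s, - (of_int n * s))" using P(2) by auto
    have "\<bar>of_int n * s\<bar> < real N * \<bar>s\<bar>" using b[OF z] N by (simp add: n)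
    then have "\<bar>of_int n\<bar> < real N" using s by (simp add: abs_mult)
    then have "\<bar>n\<bar> < int N" by linarith
    then have "\<bar>of_int n\<bar> \<le> real N - 1" by linarith
    then have "\<bar>of_int n\<bar> * \<bar>s\<bar> \<le> (real N - 1) * \<bar>s\<bar>" by (rule mult_right_mono) simp
    also have "\<dots> \<le> (real N - 1/2) * \<bar>s\<bar>" by (rule mult_right_mono) simp_all
    finally have "of_int n * s \<le> (real N - 1/2) * \<bar>s\<bar>" by (simp add: abs_le_iff flip: abs_mult)
    then have le1: "exp (of_int n * s) \<le> X1" by (simp add: X1_def)
    have "X1 \<le> X2" unfolding X1_def X2_def exp_le_cancel_iff by (intro mult_right_mono) auto
    then have "0 \<le> (exp (of_int n * s) - X1) * (exp (of_int n * s) - X2)"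
      using le1 by (intro mult_nonpos_nonpos) auto
    then show "trace_form W ?Y (mat 1) \<le> trace_form W ?Y (diag_family z)" unfolding n tf by simp
  next
    define t where "t = real N * \<bar>s\<bar>"
    have "t = of_int (if s > 0 then int N else - int N) * s" by (simp add: t_def)
    then have "(t, - t) = of_int (if s > 0 then int N else - int N) *\<^sub>R (s, - s)" by simp
    then have "(t, - t) \<in> ?\<Lambda>" by blast
    moreover have "trace_form W ?Y (diag_family (t, - t)) < trace_form W ?Y (mat 1)"
    proof -
      have "X1 < exp t" "exp t < X2" using s by (simp_all add: X1_def X2_def t_def)
      moreover have "t > 0" using N by (simp add: t_def)
      ultimately have "(exp t - 1)\<^sup>2 * ((exp t - X1) * (exp t - X2)) / (exp t)\<^sup>2 < 0"
        by (intro divide_neg_pos mult_pos_neg) auto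
      then show ?thesis unfolding tf by simp
    qed
    ultimately show "\<exists>z\<in>?\<Lambda>. trace_form W ?Y (diag_family z) < trace_form W ?Y (mat 1)" by blast
  qed
qed

section \<open>Groups containing a full Jordan block\<close>

definition rank_one :: "real \<Rightarrow> real \<Rightarrow> real \<Rightarrow> real^3^3" where
  "rank_one a b c = mat33 (a * a) (a * b) (a * c)  (b * a) (b * b) (b * c)  (c * a) (c * b) (c * c)"

lemma rank_one_semidefinite:
  "transpose (rank_one a b c) = rank_one a b c" "0 \<le> quadratic_form (rank_one a b c) v"
proof -
  show sym: "transpose (rank_one a b c) = rank_one a b c" by (intro mat33_eqI) (simp_all add: rank_one_def)
  have "quadratic_form (rank_one a b c) v = (a * v$1 + b * v$2 + c * v$3)\<^sup>2"
    unfolding quadratic_form_3[OF sym] unfolding rank_one_def mat33_nth by algebra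
  then show "0 \<le> quadratic_form (rank_one a b c) v" by simp
qed

definition ternary_form :: "real^3^3 \<Rightarrow> real \<Rightarrow> real \<Rightarrow> real \<Rightarrow> real" where
  "ternary_form W a b c = W$1$1 * a\<^sup>2 + W$2$2 * b\<^sup>2 + W$3$3 * c\<^sup>2
    + 2 * W$1$2 * a * b + 2 * W$1$3 * a * c + 2 * W$2$3 * b * c"

text \<open>For Y = v v^T the trace form is the value of the form \<open>W\<close> at h^T v, here
  with v = (a, b, c).\<close>

lemma trace_form_jordan_rank_one:
  assumes W: "transpose W = W"
  shows "trace_form W (rank_one a b c) (jordan_unipotent (x, z))
    = ternary_form W a (b + x * a) (c + x * b + (z + x\<^sup>2 / 2) * a)"
proof -
  define y where "y = z + x\<^sup>2 / 2"
  show ?thesis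
    unfolding trace_form_eq_sum sum_3 jordan_unipotent_def rank_one_def mat33_nth fst_conv snd_conv ternary_form_def
      symmetric_nth[OF W, of 2 1] symmetric_nth[OF W, of 3 1] symmetric_nth[OF W, of 3 2] y_def[symmetric]
    by (simp add: power2_eq_square algebra_simps)
qed

text \<open>The third component enters the first square only, so it can be used to control that
  square without disturbing the rest.\<close>

lemma ternary_form_complete_square:
  assumes "W$3$3 \<noteq> 0"
  shows "ternary_form W a b c = W$3$3 * (c + (W$2$3 * b + W$1$3 * a) / W$3$3)\<^sup>2
    + ((W$1$1 - (W$1$3)\<^sup>2 / W$3$3) * a\<^sup>2 + 2 * (W$1$2 - W$1$3 * W$2$3 / W$3$3) * a * b
      + (W$2$2 - (W$2$3)\<^sup>2 / W$3$3) * b\<^sup>2)"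
  using assms by (simp add: ternary_form_def field_simps power2_eq_square)

text \<open>With \<open>\<beta> = 1 / K\<close>, the \<open>n\<close>th power takes \<open>v\<close> to the vector with last component
  \<open>\<alpha> + n (n - K) / K\<close>, whose other components are its second difference and, up to an error
  vanishing with \<open>\<beta>\<close>, its first difference. As \<open>K\<close> tends to infinity, the values of the form near \<open>n = 0\<close> and near
  \<open>n = K\<close> converge to two independent quadratic polynomials in \<open>n\<close>; the fractional part of \<open>K\<close> shifts
  the second one relative to the integers. We arrange that the first one has its minimum over the
  integers strictly at \<open>0\<close>, and that the second one takes its (equal) real minimum at an integer.\<close>

lemma not_finitely_determined_jordan_cyclic:
  assumes "W \<in> P3"
  shows "\<not> finitely_determined W (jordan_unipotent ` range (\<lambda>n::int. of_int n *\<^sub>R (1, - 1 / 2)))"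
proof (rule jordan_unipotent.not_finitely_determined_semidefiniteI)
  let ?\<Lambda> = "range (\<lambda>n::int. of_int n *\<^sub>R (1, - 1 / 2)) :: (real \<times> real) set"
  have PD: "W \<in> pos_def" using assms by (simp add: P3_iff)
  note W = pos_def_symmetric[OF PD]
  have W33: "W$3$3 > 0" using pos_def_minors[OF PD] by simp
  define \<omega> where "\<omega> = W$2$3 / W$3$3"
  \<comment> \<open>Near n = 0 the limiting square is (1/4 - n)^2, over the integers strictly
    smallest at n = 0. Near n = K the second component tends to 1 instead of -1, the square becomes
    (\<alpha> - \<kappa> + \<omega>)^2 at the chosen integer, and \<open>\<kappa>\<close> makes it
    0.\<close>
  define \<alpha> where "\<alpha> = \<omega> + 1 / 4"
  define \<kappa> where "\<kappa> = 2 * \<omega> + 1 / 4"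
  define D where "D = W$2$2 - (W$2$3)\<^sup>2 / W$3$3"
  have form0: "ternary_form W 0 b c = W$3$3 * (c + \<omega> * b)\<^sup>2 + D * b\<^sup>2" for b c
    using W33 by (simp add: ternary_form_complete_square \<omega>_def D_def)
  define Y where "Y \<beta> = rank_one (2 * \<beta>) (\<beta> - 1) \<alpha>" for \<beta>
  have tf: "trace_form W (Y \<beta>) (jordan_unipotent (of_int n *\<^sub>R (1, - 1 / 2)))
      = ternary_form W (2 * \<beta>) (\<beta> - 1 + 2 * of_int n * \<beta>) (\<alpha> + (of_int n)\<^sup>2 * \<beta> - of_int n)" for \<beta> and n :: int
    using trace_form_jordan_rank_one[OF W, of "2 * \<beta>" "\<beta> - 1" \<alpha> "of_int n" "- of_int n / 2"]
    by (simp add: Y_def power2_eq_square algebra_simps)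
  have tf1: "trace_form W (Y \<beta>) (mat 1) = ternary_form W (2 * \<beta>) (\<beta> - 1) \<alpha>" for \<beta>
    using tf[of \<beta> 0] jordan_unipotent.E_0 by (simp add: zero_prod_def)
  have lim: "((\<lambda>\<beta>. ternary_form W (f \<beta>) (g \<beta>) (h \<beta>)) \<longlongrightarrow> ternary_form W a b c) (at_right 0)"
    if "(f \<longlongrightarrow> a) (at_right 0)" "(g \<longlongrightarrow> b) (at_right 0)" "(h \<longlongrightarrow> c) (at_right 0)"
    for f g h :: "real \<Rightarrow> real" and a b c
    unfolding ternary_form_def by (intro tendsto_intros that)
  have lim1: "((\<lambda>\<beta>. trace_form W (Y \<beta>) (mat 1)) \<longlongrightarrow> W$3$3 / 16 + D) (at_right 0)"
  proof -
    have "((\<lambda>\<beta>. ternary_form W (2 * \<beta>) (\<beta> - 1) \<alpha>) \<longlongrightarrow> ternary_form W (2 * 0) (0 - 1) \<alpha>) (at_right 0)"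
      by (intro lim tendsto_intros)
    moreover have "ternary_form W (2 * 0) (0 - 1) \<alpha> = W$3$3 / 16 + D"
      by (simp add: form0 \<alpha>_def power2_eq_square)
    ultimately show ?thesis by (simp add: tf1)
  qed
  fix P assume P: "finite P" "P \<subseteq> ?\<Lambda>"
  have "\<forall>\<^sub>F \<beta> in at_right 0. \<forall>z\<in>P. z \<noteq> 0 \<longrightarrow> trace_form W (Y \<beta>) (mat 1) < trace_form W (Y \<beta>) (jordan_unipotent z)"
  proof (rule eventually_ball_finite[OF P(1)], rule ballI)
    fix z assume z: "z \<in> P"
    show "\<forall>\<^sub>F \<beta> in at_right 0. z \<noteq> 0 \<longrightarrow> trace_form W (Y \<beta>) (mat 1) < trace_form W (Y \<beta>) (jordan_unipotent z)"
    proof (cases "z = 0")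
      case False
      obtain n :: int where n: "z = of_int n *\<^sub>R (1, - 1 / 2)" using z P(2) by blast
      have "n \<noteq> 0" using False n by (auto simp: zero_prod_def)
      have "((\<lambda>\<beta>. trace_form W (Y \<beta>) (jordan_unipotent z)) \<longlongrightarrow>
          ternary_form W (2 * 0) (0 - 1 + 2 * of_int n * 0) (\<alpha> + (of_int n)\<^sup>2 * 0 - of_int n)) (at_right 0)"
        unfolding n tf by (intro lim tendsto_intros)
      moreover have "ternary_form W (2 * 0) (0 - 1 + 2 * of_int n * 0) (\<alpha> + (of_int n)\<^sup>2 * 0 - of_int n)
          = W$3$3 * (1 / 4 - of_int n)\<^sup>2 + D"
        by (simp add: form0 \<alpha>_def algebra_simps)
      moreover have "W$3$3 / 16 < W$3$3 * (1 / 4 - of_int n)\<^sup>2"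
      proof -
        have "n \<le> -1 \<or> n \<ge> 1" using \<open>n \<noteq> 0\<close> by linarith
        then have "real_of_int n \<le> -1 \<or> real_of_int n \<ge> 1" by linarith
        then have "\<bar>1 / 4\<bar> < \<bar>1 / 4 - real_of_int n\<bar>" by linarith
        then have "(1 / 4)\<^sup>2 < (1 / 4 - real_of_int n)\<^sup>2"
          using abs_le_square_iff[of "1 / 4 - real_of_int n" "1 / 4"] by linarith
        then have "W$3$3 * (1 / 4)\<^sup>2 < W$3$3 * (1 / 4 - real_of_int n)\<^sup>2" using W33 by (rule mult_strict_left_mono)
        then show ?thesis by (simp add: power2_eq_square)
      qed
      ultimately have "\<forall>\<^sub>F \<beta> in at_right 0. 0 < trace_form W (Y \<beta>) (jordan_unipotent z) - trace_form W (Y \<beta>) (mat 1)"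
        by (intro order_tendstoD(1)[OF tendsto_diff[OF _ lim1]]) auto
      then show ?thesis by eventually_elim simp
    qed simp
  qed
  moreover have "\<forall>\<^sub>F \<beta> in at_right 0. ternary_form W (2 * \<beta>) (1 + \<beta> - 2 * \<kappa> * \<beta>) (\<alpha> - \<kappa> + \<kappa>\<^sup>2 * \<beta>)
      - trace_form W (Y \<beta>) (mat 1) < 0"
  proof (rule order_tendstoD(2))
    show "((\<lambda>\<beta>. ternary_form W (2 * \<beta>) (1 + \<beta> - 2 * \<kappa> * \<beta>) (\<alpha> - \<kappa> + \<kappa>\<^sup>2 * \<beta>) - trace_form W (Y \<beta>) (mat 1))
        \<longlongrightarrow> ternary_form W (2 * 0) (1 + 0 - 2 * \<kappa> * 0) (\<alpha> - \<kappa> + \<kappa>\<^sup>2 * 0) - (W$3$3 / 16 + D)) (at_right 0)"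
      by (intro tendsto_diff lim1 lim tendsto_intros)
    show "ternary_form W (2 * 0) (1 + 0 - 2 * \<kappa> * 0) (\<alpha> - \<kappa> + \<kappa>\<^sup>2 * 0) - (W$3$3 / 16 + D) < 0"
      using W33 by (simp add: form0 \<alpha>_def \<kappa>_def)
  qed
  ultimately have "\<forall>\<^sub>F \<beta> in at_right 0.
      (\<forall>z\<in>P. z \<noteq> 0 \<longrightarrow> trace_form W (Y \<beta>) (mat 1) < trace_form W (Y \<beta>) (jordan_unipotent z)) \<and>
      ternary_form W (2 * \<beta>) (1 + \<beta> - 2 * \<kappa> * \<beta>) (\<alpha> - \<kappa> + \<kappa>\<^sup>2 * \<beta>) < trace_form W (Y \<beta>) (mat 1)"
    by eventually_elim simp
  then obtain b where b: "b > 0" "\<And>\<beta>. 0 < \<beta> \<Longrightarrow> \<beta> < b \<Longrightarrow>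
      (\<forall>z\<in>P. z \<noteq> 0 \<longrightarrow> trace_form W (Y \<beta>) (mat 1) < trace_form W (Y \<beta>) (jordan_unipotent z)) \<and>
      ternary_form W (2 * \<beta>) (1 + \<beta> - 2 * \<kappa> * \<beta>) (\<alpha> - \<kappa> + \<kappa>\<^sup>2 * \<beta>) < trace_form W (Y \<beta>) (mat 1)"
    unfolding eventually_at_right_field by blast
  \<comment> \<open>Only the size of the integer \<open>M\<close> matters; K = M + \<kappa> then has
    the prescribed fractional part, and \<open>\<beta>\<close> is its inverse.\<close>
  define M where "M = \<lfloor>1 / b - \<kappa>\<rfloor> + 1"
  have "1 / b < of_int M + \<kappa>" unfolding M_def by linarith
  moreover have "0 < 1 / b" using b(1) by simp
  ultimately have K: "0 < of_int M + \<kappa>" "1 / b < of_int M + \<kappa>" by linarith+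
  define \<beta> where "\<beta> = 1 / (of_int M + \<kappa>)"
  have \<beta>: "0 < \<beta>" using K by (simp add: \<beta>_def)
  have "\<beta> < b" using K b(1) by (simp add: \<beta>_def field_simps)
  note b' = b(2)[OF \<beta> this]
  have M: "of_int M * \<beta> = 1 - \<kappa> * \<beta>" using K(1) by (simp add: \<beta>_def field_simps)
  have "\<beta> - 1 + 2 * of_int M * \<beta> = 1 + \<beta> - 2 * \<kappa> * \<beta>" using M by (simp add: mult.assoc)
  moreover have "\<alpha> + (of_int M)\<^sup>2 * \<beta> - of_int M = \<alpha> - \<kappa> + \<kappa>\<^sup>2 * \<beta>"
  proof -
    have "(of_int M)\<^sup>2 * \<beta> - of_int M = of_int M * (of_int M * \<beta>) - of_int M" by (simp add: power2_eq_square)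
    also have "\<dots> = of_int M * (1 - \<kappa> * \<beta>) - of_int M" unfolding M ..
    also have "\<dots> = - \<kappa> * (of_int M * \<beta>)" by (simp add: algebra_simps)
    also have "\<dots> = - \<kappa> + \<kappa>\<^sup>2 * \<beta>" unfolding M by (simp add: power2_eq_square algebra_simps)
    finally show ?thesis by simp
  qed
  ultimately have "trace_form W (Y \<beta>) (jordan_unipotent (of_int M *\<^sub>R (1, - 1 / 2))) < trace_form W (Y \<beta>) (mat 1)"
    unfolding tf using b' by (simp only:)
  then show "\<exists>Y. transpose Y = Y \<and> (\<forall>v. 0 \<le> quadratic_form Y v) \<and>
      (\<forall>z\<in>P. z \<noteq> 0 \<longrightarrow> trace_form W Y (mat 1) < trace_form W Y (jordan_unipotent z)) \<and>
      (\<exists>z\<in>?\<Lambda>. trace_form W Y (jordan_unipotent z) < trace_form W Y (mat 1))"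
    using b' rank_one_semidefinite by (intro exI[of _ "Y \<beta>"]) (auto simp: Y_def)
qed

text \<open>Here \<open>v = (\<beta>, 1, v\<^sub>3)\<close>, and \<open>v\<^sub>3\<close> is chosen such that the square in the decomposition of the
  form vanishes at \<open>v\<close>. For fixed lattice points \<open>(x, z)\<close> with \<open>x \<noteq> 0\<close> the square grows as
  \<open>\<beta> \<rightarrow> 0\<close>, and for \<open>x = 0\<close> only the square changes. Close to the point
  \<open>x = - 1 / \<beta>\<close>, \<open>z = 1 / (2 \<beta>\<^sup>2) + \<omega> / \<beta>\<close> the whole form is small.\<close>

lemma not_finitely_determined_jordan_lattice:
  assumes "W \<in> P3" and uv: "fst u * snd v \<noteq> snd u * fst v"
  shows "\<not> finitely_determined W (jordan_unipotent ` int_span u v)"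
proof (rule jordan_unipotent.not_finitely_determined_semidefiniteI)
  let ?\<Lambda> = "int_span u v"
  have PD: "W \<in> pos_def" using assms by (simp add: P3_iff)
  note W = pos_def_symmetric[OF PD]
  have W33: "W$3$3 > 0" using pos_def_minors[OF PD] by simp
  define \<omega> where "\<omega> = W$2$3 / W$3$3"
  define A where "A = W$1$1 - (W$1$3)\<^sup>2 / W$3$3"
  define B where "B = W$1$2 - W$1$3 * W$2$3 / W$3$3"
  define D where "D = W$2$2 - (W$2$3)\<^sup>2 / W$3$3"
  have D: "D > 0" using pos_def_minors[OF PD] by (simp add: D_def field_simps)
  obtain R where R: "R \<ge> 0" "\<And>x y. \<exists>z\<in>?\<Lambda>. \<bar>fst z - x\<bar> \<le> R \<and> \<bar>snd z - y\<bar> \<le> R"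
    using lattice_cobounded[OF uv] by blast
  define Y where "Y \<beta> = rank_one \<beta> 1 (- (W$2$3 + W$1$3 * \<beta>) / W$3$3)" for \<beta>
  have tf: "trace_form W (Y \<beta>) (jordan_unipotent (x, z))
      = W$3$3 * (x + (z + x\<^sup>2 / 2) * \<beta> + \<omega> * x * \<beta>)\<^sup>2 + (A * \<beta>\<^sup>2 + 2 * B * \<beta> * (1 + x * \<beta>) + D * (1 + x * \<beta>)\<^sup>2)" for \<beta> x z
  proof -
    have third: "- (W$2$3 + W$1$3 * \<beta>) / W$3$3 + x * 1 + (z + x\<^sup>2 / 2) * \<beta> + (W$2$3 * (1 + x * \<beta>) + W$1$3 * \<beta>) / W$3$3
        = x + (z + x\<^sup>2 / 2) * \<beta> + \<omega> * x * \<beta>"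
      using W33 by (simp add: \<omega>_def field_simps)
    show ?thesis
      unfolding Y_def trace_form_jordan_rank_one[OF W] ternary_form_complete_square[OF less_imp_neq[OF W33, symmetric]]
        third A_def B_def D_def by simp
  qed
  have tf1: "trace_form W (Y \<beta>) (mat 1) = A * \<beta>\<^sup>2 + 2 * B * \<beta> + D" for \<beta>
    using tf[of \<beta> 0 0] jordan_unipotent.E_0 by (simp add: zero_prod_def)
  fix P assume P: "finite P" "P \<subseteq> ?\<Lambda>"
  have "\<forall>\<^sub>F \<beta> in at_right 0. \<forall>z\<in>P. z \<noteq> 0 \<longrightarrow> trace_form W (Y \<beta>) (mat 1) < trace_form W (Y \<beta>) (jordan_unipotent z)"
  proof (rule eventually_ball_finite[OF P(1)], rule ballI)
    fix p assume "p \<in> P"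
    obtain x z where p: "p = (x, z)" by (cases p)
    show "\<forall>\<^sub>F \<beta> in at_right 0. p \<noteq> 0 \<longrightarrow> trace_form W (Y \<beta>) (mat 1) < trace_form W (Y \<beta>) (jordan_unipotent p)"
    proof (cases "x = 0")
      \<comment> \<open>For x = 0 the difference is \<open>W$3$3 * (z * \<beta>)\<^sup>2\<close>,
        positive because z is nonzero.\<close>
      case True
      have "\<forall>\<^sub>F \<beta> in at_right (0::real). \<beta> > 0" by (rule eventually_at_right_less)
      then show ?thesis
        by eventually_elim (use True W33 in \<open>auto simp: p tf tf1 zero_prod_def\<close>)
    next
      case False
      have "((\<lambda>\<beta>. trace_form W (Y \<beta>) (jordan_unipotent p) - trace_form W (Y \<beta>) (mat 1)) \<longlongrightarrow>
          W$3$3 * (x + (z + x\<^sup>2 / 2) * 0 + \<omega> * x * 0)\<^sup>2 + (A * 0\<^sup>2 + 2 * B * 0 * (1 + x * 0) + D * (1 + x * 0)\<^sup>2)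
          - (A * 0\<^sup>2 + 2 * B * 0 + D)) (at_right 0)"
        unfolding p tf tf1 by (intro tendsto_intros)
      then have "\<forall>\<^sub>F \<beta> in at_right 0. 0 < trace_form W (Y \<beta>) (jordan_unipotent p) - trace_form W (Y \<beta>) (mat 1)"
        by (rule order_tendstoD(1)) (use W33 False in simp)
      then show ?thesis by eventually_elim simp
    qed
  qed
  \<comment> \<open>Bounds the form at the nearest lattice point divided by
    \<open>\<beta>\<^sup>2\<close>; it depends only on \<open>W\<close> and on the rounding error
    \<open>R\<close>.\<close>
  moreover define C where "C = W$3$3 * (R\<^sup>2 / 2 + R + \<bar>\<omega>\<bar> * R)\<^sup>2 + \<bar>A\<bar> + 2 * \<bar>B\<bar> * R + D * R\<^sup>2"
  have "((\<lambda>\<beta>. C * \<beta>\<^sup>2 - (A * \<beta>\<^sup>2 + 2 * B * \<beta> + D)) \<longlongrightarrow> C * 0\<^sup>2 - (A * 0\<^sup>2 + 2 * B * 0 + D)) (at_right 0)"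
    by (intro tendsto_intros)
  then have "\<forall>\<^sub>F \<beta> in at_right 0. C * \<beta>\<^sup>2 - (A * \<beta>\<^sup>2 + 2 * B * \<beta> + D) < 0"
    by (rule order_tendstoD(2)) (use D in simp)
  moreover have "\<forall>\<^sub>F \<beta> in at_right (0::real). \<beta> > 0" by (rule eventually_at_right_less)
  ultimately have "\<forall>\<^sub>F \<beta> in at_right 0. \<beta> > 0 \<and> C * \<beta>\<^sup>2 < A * \<beta>\<^sup>2 + 2 * B * \<beta> + D \<and>
      (\<forall>z\<in>P. z \<noteq> 0 \<longrightarrow> trace_form W (Y \<beta>) (mat 1) < trace_form W (Y \<beta>) (jordan_unipotent z))"
    by eventually_elim simp
  then obtain \<beta> where \<beta>: "\<beta> > 0" "C * \<beta>\<^sup>2 < A * \<beta>\<^sup>2 + 2 * B * \<beta> + D"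
      "\<forall>z\<in>P. z \<noteq> 0 \<longrightarrow> trace_form W (Y \<beta>) (mat 1) < trace_form W (Y \<beta>) (jordan_unipotent z)"
    using eventually_happens[of _ "at_right (0::real)"] by auto
  obtain g where g: "g \<in> ?\<Lambda>" "\<bar>fst g - (- 1 / \<beta>)\<bar> \<le> R" "\<bar>snd g - (1 / (2 * \<beta>\<^sup>2) + \<omega> / \<beta>)\<bar> \<le> R"
    using R(2) by blast
  define \<rho> where "\<rho> = fst g + 1 / \<beta>"
  define \<sigma> where "\<sigma> = snd g - (1 / (2 * \<beta>\<^sup>2) + \<omega> / \<beta>)"
  have \<rho>: "\<bar>\<rho>\<bar> \<le> R" using g(2) by (simp add: \<rho>_def)
  have \<sigma>: "\<bar>\<sigma>\<bar> \<le> R" using g(3) by (simp add: \<sigma>_def)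
  have x: "1 + fst g * \<beta> = \<rho> * \<beta>" using \<beta>(1) by (simp add: \<rho>_def field_simps)
  have z: "fst g + (snd g + (fst g)\<^sup>2 / 2) * \<beta> + \<omega> * fst g * \<beta> = \<beta> * (\<rho>\<^sup>2 / 2 + \<sigma> + \<omega> * \<rho>)"
  proof -
    define i where "i = 1 / \<beta>"
    have i: "i * \<beta> = 1" "fst g = \<rho> - i" "snd g = \<sigma> + i\<^sup>2 / 2 + \<omega> * i"
      using \<beta>(1) by (simp_all add: \<rho>_def \<sigma>_def i_def power_divide)
    have "2 * (\<rho> - i) + (2 * \<sigma> + i\<^sup>2 + 2 * \<omega> * i + (\<rho> - i)\<^sup>2) * \<beta> + 2 * \<omega> * (\<rho> - i) * \<beta>
        = \<beta> * (\<rho>\<^sup>2 + 2 * \<sigma> + 2 * \<omega> * \<rho>)"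
      using i(1) by algebra
    then show ?thesis unfolding i(2,3) by (simp add: algebra_simps)
  qed
  have "trace_form W (Y \<beta>) (jordan_unipotent g)
      = \<beta>\<^sup>2 * (W$3$3 * (\<rho>\<^sup>2 / 2 + \<sigma> + \<omega> * \<rho>)\<^sup>2 + A + 2 * B * \<rho> + D * \<rho>\<^sup>2)"
    using tf[of \<beta> "fst g" "snd g"] unfolding z x by (simp add: power2_eq_square algebra_simps)
  also have "\<dots> \<le> \<beta>\<^sup>2 * C"
  proof (rule mult_left_mono)
    have \<rho>2: "\<rho>\<^sup>2 \<le> R\<^sup>2" using power_mono[OF \<rho> abs_ge_zero, of 2] by simp
    have "\<bar>\<rho>\<^sup>2 / 2 + \<sigma> + \<omega> * \<rho>\<bar> \<le> \<rho>\<^sup>2 / 2 + \<bar>\<sigma>\<bar> + \<bar>\<omega>\<bar> * \<bar>\<rho>\<bar>"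
      using abs_triangle_ineq[of "\<rho>\<^sup>2 / 2 + \<sigma>" "\<omega> * \<rho>"] abs_triangle_ineq[of "\<rho>\<^sup>2 / 2" \<sigma>] by (simp add: abs_mult)
    also have "\<dots> \<le> R\<^sup>2 / 2 + R + \<bar>\<omega>\<bar> * R" using \<rho> \<sigma> \<rho>2 by (intro add_mono mult_left_mono) auto
    finally have "\<bar>\<rho>\<^sup>2 / 2 + \<sigma> + \<omega> * \<rho>\<bar> \<le> R\<^sup>2 / 2 + R + \<bar>\<omega>\<bar> * R" .
    from power_mono[OF this abs_ge_zero, of 2]
    have "(\<rho>\<^sup>2 / 2 + \<sigma> + \<omega> * \<rho>)\<^sup>2 \<le> (R\<^sup>2 / 2 + R + \<bar>\<omega>\<bar> * R)\<^sup>2" by simp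
    then have 1: "W$3$3 * (\<rho>\<^sup>2 / 2 + \<sigma> + \<omega> * \<rho>)\<^sup>2 \<le> W$3$3 * (R\<^sup>2 / 2 + R + \<bar>\<omega>\<bar> * R)\<^sup>2"
      using W33 by simp
    have "B * \<rho> \<le> \<bar>B * \<rho>\<bar>" by simp
    also have "\<dots> \<le> \<bar>B\<bar> * R" using \<rho> by (simp add: abs_mult mult_left_mono)
    finally have 2: "2 * B * \<rho> \<le> 2 * \<bar>B\<bar> * R" by simp
    have 3: "D * \<rho>\<^sup>2 \<le> D * R\<^sup>2" using D \<rho>2 by simp
    show "W$3$3 * (\<rho>\<^sup>2 / 2 + \<sigma> + \<omega> * \<rho>)\<^sup>2 + A + 2 * B * \<rho> + D * \<rho>\<^sup>2 \<le> C"
      unfolding C_def by (intro add_mono 1 2 3 abs_ge_self)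
  qed simp
  also have "\<dots> < trace_form W (Y \<beta>) (mat 1)" using \<beta>(2) by (simp add: tf1 mult.commute)
  finally show "\<exists>Y. transpose Y = Y \<and> (\<forall>v. 0 \<le> quadratic_form Y v) \<and>
      (\<forall>z\<in>P. z \<noteq> 0 \<longrightarrow> trace_form W Y (mat 1) < trace_form W Y (jordan_unipotent z)) \<and>
      (\<exists>z\<in>?\<Lambda>. trace_form W Y (jordan_unipotent z) < trace_form W Y (mat 1))"
    using \<beta>(3) g(1) rank_one_semidefinite by (intro exI[of _ "Y \<beta>"]) (auto simp: Y_def)
qed

section \<open>Two-generated type 4\<close>

lemma trace_form_block_family_general:
  assumes W: "transpose W = W" and Y: "transpose Y = Y"
  shows "trace_form W Y (block_family (\<tau>, c))
    = (exp \<tau>)\<^sup>2 * (Y$1$1 * (W$1$1 + 2 * c * W$1$2 + c\<^sup>2 * W$2$2) + 2 * Y$1$2 * (W$1$2 + c * W$2$2) + Y$2$2 * W$2$2)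
    + 2 / exp \<tau> * (W$1$3 * Y$1$3 + W$2$3 * (Y$2$3 + c * Y$1$3)) + W$3$3 * Y$3$3 / (exp \<tau>) ^ 4"
proof -
  define e where "e = exp \<tau>"
  have e: "e > 0" "exp (- 2 * \<tau>) = 1 / e\<^sup>2"
    using exp_double[of \<tau>] by (simp_all add: e_def exp_minus inverse_eq_divide)
  show ?thesis
    unfolding trace_form_eq_sum sum_3 block_family_def mat33_nth fst_conv snd_conv e_def[symmetric] e(2)
      symmetric_nth[OF W, of 2 1] symmetric_nth[OF W, of 3 1] symmetric_nth[OF W, of 3 2]
      symmetric_nth[OF Y, of 2 1] symmetric_nth[OF Y, of 3 1] symmetric_nth[OF Y, of 3 2]
    using e(1) by (simp add: field_simps power2_eq_square power4_eq_xxxx)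
qed

text \<open>Without elements \<open>(0, c)\<close> the eigenvalue parameter alone separates the elements of \<open>P\<close>
  from the identity, and \<open>Y\<close> is chosen such that the form is small near \<open>c = 1 / \<eta>\<close>.\<close>

lemma not_finitely_determined_block_generic:
  assumes "W \<in> P3" and uv: "fst u * snd v \<noteq> snd u * fst v"
    and no: "\<And>c. (0, c) \<in> int_span u v \<Longrightarrow> c = 0"
  shows "\<not> finitely_determined W (block_family ` int_span u v)"
proof (rule block_family.not_finitely_determined_semidefiniteI)
  let ?\<Lambda> = "int_span u v"
  have PD: "W \<in> pos_def" using assms by (simp add: P3_iff)
  note W = pos_def_symmetric[OF PD] and m = pos_def_minors[OF PD]
  define \<omega> where "\<omega> = W$1$2 / W$2$2"
  define \<kappa> where "\<kappa> = W$1$1 - (W$1$2)\<^sup>2 / W$2$2"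
  have \<kappa>: "\<kappa> > 0" using m by (simp add: \<kappa>_def field_simps)
  \<comment> \<open>The upper block has rank one, with the shift \<open>\<omega> * \<eta>\<close>
    completing the square in the form of \<open>W\<close>. The corner is such that for \<eta> = 0
    the trace form is \<open>W$2$2\<close> times y + 1 / (2 y^2) with y = exp(2 \<tau>), which has
    its minimum over y > 0 at y = 1.\<close>
  define Y where "Y \<eta> = mat33 (\<eta>\<^sup>2) (- \<eta> * (1 + \<omega> * \<eta>)) 0 (- \<eta> * (1 + \<omega> * \<eta>)) ((1 + \<omega> * \<eta>)\<^sup>2) 0 0 0 (W$2$2 / (2 * W$3$3))"
    for \<eta>
  have sym: "transpose (Y \<eta>) = Y \<eta>" for \<eta> unfolding Y_def by (rule mat33_symmetric)
  have psd: "0 \<le> quadratic_form (Y \<eta>) v" for \<eta> v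
  proof -
    have "quadratic_form (Y \<eta>) v = (\<eta> * v$1 - (1 + \<omega> * \<eta>) * v$2)\<^sup>2 + W$2$2 / (2 * W$3$3) * (v$3)\<^sup>2"
      unfolding quadratic_form_3[OF sym] unfolding Y_def mat33_nth by (simp add: power2_eq_square algebra_simps)
    also have "\<dots> \<ge> 0" using m by (intro add_nonneg_nonneg mult_nonneg_nonneg) auto
    finally show ?thesis .
  qed
  have tf: "trace_form W (Y \<eta>) (block_family (\<tau>, c))
      = (exp \<tau>)\<^sup>2 * (W$2$2 * (1 - c * \<eta>)\<^sup>2 + \<kappa> * \<eta>\<^sup>2) + W$2$2 / 2 / (exp \<tau>) ^ 4" for \<eta> \<tau> c
  proof -
    have "\<eta>\<^sup>2 * (W$1$1 + 2 * c * W$1$2 + c\<^sup>2 * W$2$2) + 2 * (- \<eta> * (1 + \<omega> * \<eta>)) * (W$1$2 + c * W$2$2) + (1 + \<omega> * \<eta>)\<^sup>2 * W$2$2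
        = W$2$2 * (1 - c * \<eta>)\<^sup>2 + \<kappa> * \<eta>\<^sup>2"
      using m by (simp add: \<omega>_def \<kappa>_def field_simps power2_eq_square)
    then show ?thesis
      unfolding trace_form_block_family_general[OF W sym] unfolding Y_def mat33_nth using m by simp
  qed
  have tf1: "trace_form W (Y \<eta>) (mat 1) = W$2$2 + \<kappa> * \<eta>\<^sup>2 + W$2$2 / 2" for \<eta>
    using tf[of \<eta> 0 0] block_family.E_0 by (simp add: zero_prod_def)
  obtain R where R: "R \<ge> 0" "\<And>x y. \<exists>z\<in>?\<Lambda>. \<bar>fst z - x\<bar> \<le> R \<and> \<bar>snd z - y\<bar> \<le> R"
    using lattice_cobounded[OF uv] by blast
  fix P assume P: "finite P" "P \<subseteq> ?\<Lambda>"
  have "\<forall>\<^sub>F \<eta> in at_right 0. \<forall>z\<in>P. z \<noteq> 0 \<longrightarrow> trace_form W (Y \<eta>) (mat 1) < trace_form W (Y \<eta>) (block_family z)"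
  proof (rule eventually_ball_finite[OF P(1)], rule ballI)
    fix z assume z: "z \<in> P"
    obtain \<tau> c where zc: "z = (\<tau>, c)" by (cases z)
    show "\<forall>\<^sub>F \<eta> in at_right 0. z \<noteq> 0 \<longrightarrow> trace_form W (Y \<eta>) (mat 1) < trace_form W (Y \<eta>) (block_family z)"
    proof (cases "z = 0")
      case False
      then have "\<tau> \<noteq> 0" using no[of c] z P(2) by (auto simp: zc zero_prod_def)
      have "((\<lambda>\<eta>. trace_form W (Y \<eta>) (block_family z) - trace_form W (Y \<eta>) (mat 1)) \<longlongrightarrow>
          (exp \<tau>)\<^sup>2 * (W$2$2 * (1 - c * 0)\<^sup>2 + \<kappa> * 0\<^sup>2) + W$2$2 / 2 / (exp \<tau>) ^ 4 - (W$2$2 + \<kappa> * 0\<^sup>2 + W$2$2 / 2)) (at_right 0)"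
        unfolding zc tf tf1 by (intro tendsto_intros) auto
      moreover have "0 < (exp \<tau>)\<^sup>2 * (W$2$2 * (1 - c * 0)\<^sup>2 + \<kappa> * 0\<^sup>2) + W$2$2 / 2 / (exp \<tau>) ^ 4 - (W$2$2 + \<kappa> * 0\<^sup>2 + W$2$2 / 2)"
      proof -
        define y where "y = (exp \<tau>)\<^sup>2"
        have y: "y > 0" "(exp \<tau>) ^ 4 = y\<^sup>2" by (simp_all add: y_def power_mult[symmetric] flip: power_mult)
        have "exp \<tau> \<noteq> - 1" using exp_gt_zero[of \<tau>] by linarith
        then have "y \<noteq> 1" using \<open>\<tau> \<noteq> 0\<close> by (auto simp: y_def power2_eq_1_iff)
        then have "0 < W$2$2 * ((y - 1)\<^sup>2 * (2 * y + 1)) / (2 * y\<^sup>2)"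
          using y m by (intro divide_pos_pos mult_pos_pos) auto
        also have "\<dots> = y * W$2$2 + W$2$2 / 2 / y\<^sup>2 - (W$2$2 + W$2$2 / 2)"
          using y(1) by (simp add: field_simps power2_eq_square)
        finally show ?thesis unfolding y(2) y_def[symmetric] by simp
      qed
      ultimately have "\<forall>\<^sub>F \<eta> in at_right 0. 0 < trace_form W (Y \<eta>) (block_family z) - trace_form W (Y \<eta>) (mat 1)"
        by (rule order_tendstoD(1))
      then show ?thesis by eventually_elim simp
    qed simp
  qed
  moreover have "\<forall>\<^sub>F \<eta> in at_right 0. (exp (2 * R))\<^sup>2 * ((W$2$2 * R\<^sup>2 + \<kappa>) * \<eta>\<^sup>2) + W$2$2 / 2 - (W$2$2 + \<kappa> * \<eta>\<^sup>2 + W$2$2 / 2) < 0"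
  proof (rule order_tendstoD(2))
    show "((\<lambda>\<eta>. (exp (2 * R))\<^sup>2 * ((W$2$2 * R\<^sup>2 + \<kappa>) * \<eta>\<^sup>2) + W$2$2 / 2 - (W$2$2 + \<kappa> * \<eta>\<^sup>2 + W$2$2 / 2)) \<longlongrightarrow>
        (exp (2 * R))\<^sup>2 * ((W$2$2 * R\<^sup>2 + \<kappa>) * 0\<^sup>2) + W$2$2 / 2 - (W$2$2 + \<kappa> * 0\<^sup>2 + W$2$2 / 2)) (at_right (0::real))"
      by (intro tendsto_intros) auto
  qed (use m in simp)
  moreover have "\<forall>\<^sub>F \<eta> in at_right (0::real). \<eta> > 0" by (rule eventually_at_right_less)
  ultimately have "\<forall>\<^sub>F \<eta> in at_right 0. \<eta> > 0 \<and>
      (\<forall>z\<in>P. z \<noteq> 0 \<longrightarrow> trace_form W (Y \<eta>) (mat 1) < trace_form W (Y \<eta>) (block_family z)) \<and>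
      (exp (2 * R))\<^sup>2 * ((W$2$2 * R\<^sup>2 + \<kappa>) * \<eta>\<^sup>2) + W$2$2 / 2 < W$2$2 + \<kappa> * \<eta>\<^sup>2 + W$2$2 / 2"
    by eventually_elim simp
  then obtain \<eta> where \<eta>: "\<eta> > 0"
      "\<forall>z\<in>P. z \<noteq> 0 \<longrightarrow> trace_form W (Y \<eta>) (mat 1) < trace_form W (Y \<eta>) (block_family z)"
      "(exp (2 * R))\<^sup>2 * ((W$2$2 * R\<^sup>2 + \<kappa>) * \<eta>\<^sup>2) + W$2$2 / 2 < W$2$2 + \<kappa> * \<eta>\<^sup>2 + W$2$2 / 2"
    using eventually_happens[of _ "at_right (0::real)"] by auto
  \<comment> \<open>Aiming at \<open>R\<close> instead of 0 keeps the eigenvalue parameter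
    nonnegative after rounding, so the last term does not grow.\<close>
  obtain g where g: "g \<in> ?\<Lambda>" "\<bar>fst g - R\<bar> \<le> R" "\<bar>snd g - 1 / \<eta>\<bar> \<le> R" using R(2) by blast
  define \<sigma> where "\<sigma> = snd g - 1 / \<eta>"
  have \<tau>: "0 \<le> fst g" "fst g \<le> 2 * R" using g(2) by linarith+
  have \<sigma>: "1 - snd g * \<eta> = - \<sigma> * \<eta>" using \<eta>(1) by (simp add: \<sigma>_def field_simps)
  have "trace_form W (Y \<eta>) (block_family g)
      = (exp (fst g))\<^sup>2 * ((W$2$2 * \<sigma>\<^sup>2 + \<kappa>) * \<eta>\<^sup>2) + W$2$2 / 2 / (exp (fst g)) ^ 4"
    using tf[of \<eta> "fst g" "snd g"] unfolding \<sigma> by (simp add: power_mult_distrib algebra_simps)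
  also have "\<dots> \<le> (exp (2 * R))\<^sup>2 * ((W$2$2 * R\<^sup>2 + \<kappa>) * \<eta>\<^sup>2) + W$2$2 / 2"
  proof (rule add_mono)
    have "\<sigma>\<^sup>2 \<le> R\<^sup>2" using power_mono[OF g(3) abs_ge_zero, of 2] by (simp add: \<sigma>_def)
    then have "W$2$2 * \<sigma>\<^sup>2 + \<kappa> \<le> W$2$2 * R\<^sup>2 + \<kappa>" using m by simp
    then show "(exp (fst g))\<^sup>2 * ((W$2$2 * \<sigma>\<^sup>2 + \<kappa>) * \<eta>\<^sup>2) \<le> (exp (2 * R))\<^sup>2 * ((W$2$2 * R\<^sup>2 + \<kappa>) * \<eta>\<^sup>2)"
      using \<tau>(2) m \<kappa> by (intro mult_mono power_mono mult_right_mono) (auto intro!: mult_nonneg_nonneg add_nonneg_nonneg)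
    have "1 \<le> (exp (fst g)) ^ 4" using \<tau>(1) by (intro one_le_power) simp
    then show "W$2$2 / 2 / (exp (fst g)) ^ 4 \<le> W$2$2 / 2" using m by (simp add: divide_le_eq)
  qed
  also have "\<dots> < trace_form W (Y \<eta>) (mat 1)" using \<eta>(3) by (simp add: tf1)
  finally show "\<exists>Y. transpose Y = Y \<and> (\<forall>v. 0 \<le> quadratic_form Y v) \<and>
      (\<forall>z\<in>P. z \<noteq> 0 \<longrightarrow> trace_form W Y (mat 1) < trace_form W Y (block_family z)) \<and>
      (\<exists>z\<in>?\<Lambda>. trace_form W Y (block_family z) < trace_form W Y (mat 1))"
    using \<eta>(2) g(1) sym psd by blast
qed

lemma int_span_scale:
  assumes "x \<in> int_span u v"
  shows "of_int n *\<^sub>R x \<in> int_span u v"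
proof -
  obtain k l :: int where "x = of_int k *\<^sub>R u + of_int l *\<^sub>R v" using assms by (rule int_spanE)
  then show ?thesis using int_spanI[of "n * k" u "n * l" v] by (simp add: scaleR_add_right)
qed

text \<open>The expression factors as (y - 1) (a - 1/y - 1/y^2). For y < 1 the second factor is
  negative because a < 2; from y1 on it is positive because 1/y + 1/y^2 decreases. With y = exp(2
  \<tau>) this is the limit of f(h) - f(1) in the argument below.\<close>

lemma exp_profile_pos:
  fixes y y1 a :: real
  assumes "1 < y1" "(y1 + 1) / y1\<^sup>2 < a" "a < 2" "0 < y" "y < 1 \<or> y1 \<le> y"
  shows "0 < (y - 1) * a + 1 / y\<^sup>2 - 1"
proof -
  have eq: "(y - 1) * a + 1 / y\<^sup>2 - 1 = (y - 1) * (a - (1 / y + (1 / y)\<^sup>2))"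
    using assms(4) by (simp add: field_simps power2_eq_square)
  have "0 < (y - 1) * (a - (1 / y + (1 / y)\<^sup>2))"
    using assms(5)
  proof
    assume "y < 1"
    then have "1 < 1 / y" using assms(4) by simp
    then have "1 < (1 / y)\<^sup>2" by (simp add: one_less_power)
    then show ?thesis using \<open>y < 1\<close> \<open>1 < 1 / y\<close> assms(3) by (intro mult_neg_neg) linarith+
  next
    assume y: "y1 \<le> y"
    then have "1 / y \<le> 1 / y1" using assms(1) by (intro divide_left_mono) auto
    moreover from this have "(1 / y)\<^sup>2 \<le> (1 / y1)\<^sup>2" using assms(4) by (intro power_mono) auto
    moreover have "1 / y1 + (1 / y1)\<^sup>2 = (y1 + 1) / y1\<^sup>2"
      using assms(1) by (simp add: field_simps power2_eq_square)
    ultimately show ?thesis using y assms(1,2) by (intro mult_pos_pos) linarith+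
  qed
  then show ?thesis unfolding eq .
qed

text \<open>The parameter \<open>p\<close> cancels the linear term in \<open>c\<close> of the form on the elements \<open>(0, c)\<close>.
  On the elements \<open>(\<tau>, c)\<close> with \<open>\<tau> \<noteq> 0\<close> and \<open>W$2$3 \<noteq> 0\<close> a linear term survives; its minimum over
  \<open>c\<close> drifts to infinity as \<open>\<epsilon> \<rightarrow> 0\<close>, while its depth stays bounded below. The diagonal of \<open>Y\<close> is such
  that on bounded \<open>c\<close> the form exceeds its value at the identity for all
  \<open>\<tau> < 0\<close> and \<open>\<tau> \<ge> \<tau>\<^sub>1\<close>, but at \<open>\<tau>\<^sub>1\<close> by less than that depth.\<close>

lemma not_finitely_determined_block_special:
  assumes "W \<in> P3" and W23: "W$2$3 \<noteq> 0" and uv: "fst u * snd v \<noteq> snd u * fst v"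
    and c0: "(0, c0) \<in> int_span u v" "c0 \<noteq> 0"
  shows "\<not> finitely_determined W (block_family ` int_span u v)"
proof (rule block_family.not_finitely_determinedI)
  let ?\<Lambda> = "int_span u v"
  have PD: "W \<in> pos_def" using assms by (simp add: P3_iff)
  note W = pos_def_symmetric[OF PD] and m = pos_def_minors[OF PD]
  fix P assume P: "finite P" "P \<subseteq> ?\<Lambda>"
  have "fst u \<noteq> 0 \<or> fst v \<noteq> 0" using uv by auto
  then have "\<exists>z\<in>?\<Lambda>. fst z \<noteq> 0" using int_span_closed(4)[of u v] int_span_closed(5)[of v u] by blast
  then obtain z' where z': "z' \<in> ?\<Lambda>" "fst z' \<noteq> 0" by blast
  have "\<exists>z\<in>?\<Lambda>. fst z > 0"
  proof (cases "fst z' > 0")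
    case False
    then have "fst (- z') > 0" using z'(2) by simp
    then show ?thesis using int_span_closed(2)[OF z'(1)] by blast
  qed (use z' in blast)
  then obtain z0 where z0: "z0 \<in> ?\<Lambda>" "fst z0 > 0" by blast
  \<comment> \<open>Adding \<open>z0\<close> keeps the set nonempty if no element of
    \<open>P\<close> has a positive parameter.\<close>
  define T where "T = {z \<in> insert z0 P. fst z > 0}"
  have "z0 \<in> T" using z0 by (simp add: T_def)
  then have "T \<noteq> {}" by blast
  moreover have "finite T" using P(1) by (simp add: T_def)
  ultimately have T: "finite T" "T \<noteq> {}" by blast+
  define \<tau>1 where "\<tau>1 = Min (fst ` T)"
  have "\<tau>1 \<in> fst ` T" unfolding \<tau>1_def using T by (intro Min_in) auto
  then obtain z1 where z1: "z1 \<in> T" "fst z1 = \<tau>1" by auto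
  then have \<tau>1: "\<tau>1 > 0" "z1 \<in> ?\<Lambda>" using z0(1) P(2) by (auto simp: T_def)
  have gap: "fst z \<le> 0 \<or> \<tau>1 \<le> fst z" if "z \<in> P" for z
  proof (cases "fst z > 0")
    case True
    then have "fst z \<in> fst ` T" using that by (auto simp: T_def)
    then show ?thesis unfolding \<tau>1_def using T by simp
  qed simp
  define e1 where "e1 = exp \<tau>1"
  define y1 where "y1 = e1\<^sup>2"
  have e1: "e1 > 1" using \<tau>1 by (simp add: e1_def)
  then have y1: "y1 > 1" by (simp add: y1_def one_less_power)
  \<comment> \<open>The slope for which the limiting profile vanishes exactly at \<open>y1\<close>;
    \<open>a\<close> is taken slightly larger below.\<close>
  define a0 where "a0 = (y1 + 1) / y1\<^sup>2"
  have a0: "a0 > 0" "a0 < 2"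
  proof -
    show "a0 > 0" using y1 by (simp add: a0_def)
    have "y1 * 1 < y1 * y1" using y1 by (intro mult_strict_left_mono) auto
    then have "y1 + 1 < 2 * y1\<^sup>2" using y1 unfolding power2_eq_square by linarith
    then show "a0 < 2" using y1 by (simp add: a0_def divide_less_eq)
  qed
  \<comment> \<open>The determinant of the final \<open>Y\<close> divided by
    \<open>\<epsilon>\<^sup>2\<close>. Its positivity is secured by small q, then by a close to
    \<open>a0\<close>, then by small \<epsilon>; the parameters are fixed in this order.\<close>
  define det' where "det' a q p = a / W$2$2 / W$3$3 - p\<^sup>2 / W$3$3 - q\<^sup>2 * a / W$2$2" for a q p
  have "((\<lambda>q. det' a0 q (- (W$2$3 * q) / W$2$2)) \<longlongrightarrow> a0 / W$2$2 / W$3$3 - (- (W$2$3 * 0) / W$2$2)\<^sup>2 / W$3$3 - 0\<^sup>2 * a0 / W$2$2) (at_right 0)"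
    unfolding det'_def using m by (intro tendsto_intros) auto
  then have "\<forall>\<^sub>F q in at_right 0. 0 < det' a0 q (- (W$2$3 * q) / W$2$2)"
    by (rule order_tendstoD(1)) (use m a0 in simp)
  moreover have "\<forall>\<^sub>F q in at_right (0::real). q > 0" by (rule eventually_at_right_less)
  ultimately have "\<forall>\<^sub>F q in at_right (0::real). q > 0 \<and> 0 < det' a0 q (- (W$2$3 * q) / W$2$2)"
    by eventually_elim simp
  then obtain q where q: "q > 0" "0 < det' a0 q (- (W$2$3 * q) / W$2$2)"
    using eventually_happens[of _ "at_right (0::real)"] by auto
  define s where "s = W$2$3 * q"
  have s: "s \<noteq> 0" using W23 q by (simp add: s_def)
  \<comment> \<open>The minimizer in x = \<epsilon> c of the part of the form at \<tau>1 that
    depends on c; the depth of the minimum is \<open>y1 * W$2$2 * X\<^sup>2\<close>.\<close>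
  define X where "X = s / W$2$2 * (1 - 1 / e1 ^ 3)"
  have "e1 ^ 3 > 1" using e1 by (simp add: one_less_power)
  then have X: "X \<noteq> 0" using s m by (simp add: X_def)
  have "((\<lambda>a. det' a q (- s / W$2$2)) \<longlongrightarrow> a0 / W$2$2 / W$3$3 - (- s / W$2$2)\<^sup>2 / W$3$3 - q\<^sup>2 * a0 / W$2$2) (at_right a0)"
    unfolding det'_def using m by (intro tendsto_intros) auto
  then have "\<forall>\<^sub>F a in at_right a0. 0 < det' a q (- s / W$2$2)"
    by (rule order_tendstoD(1)) (use q(2) in \<open>simp add: det'_def s_def\<close>)
  moreover have "((\<lambda>a. (y1 - 1) * a + 1 / y1\<^sup>2 - 1 - y1 * W$2$2 * X\<^sup>2) \<longlongrightarrow> (y1 - 1) * a0 + 1 / y1\<^sup>2 - 1 - y1 * W$2$2 * X\<^sup>2) (at_right a0)"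
    by (intro tendsto_intros)
  then have "\<forall>\<^sub>F a in at_right a0. (y1 - 1) * a + 1 / y1\<^sup>2 - 1 - y1 * W$2$2 * X\<^sup>2 < 0"
  proof (rule order_tendstoD(2))
    have "(y1 - 1) * a0 + 1 / y1\<^sup>2 - 1 = 0" using y1 by (simp add: a0_def field_simps power2_eq_square)
    moreover have "0 < y1 * W$2$2 * X\<^sup>2" using y1 m X by simp
    ultimately show "(y1 - 1) * a0 + 1 / y1\<^sup>2 - 1 - y1 * W$2$2 * X\<^sup>2 < 0" by linarith
  qed
  moreover have "\<forall>\<^sub>F a in at_right a0. a0 < a" by (rule eventually_at_right_less)
  moreover have "\<forall>\<^sub>F a in at_right a0. a < 2" by (rule order_tendstoD(2)[OF tendsto_ident_at a0(2)])
  ultimately have "\<forall>\<^sub>F a in at_right a0. 0 < det' a q (- s / W$2$2) \<and>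
      (y1 - 1) * a + 1 / y1\<^sup>2 - 1 - y1 * W$2$2 * X\<^sup>2 < 0 \<and> a0 < a \<and> a < 2"
    by eventually_elim simp
  then obtain a where a: "0 < det' a q (- s / W$2$2)" "(y1 - 1) * a + 1 / y1\<^sup>2 - 1 - y1 * W$2$2 * X\<^sup>2 < 0" "a0 < a" "a < 2"
    using eventually_happens[of _ "at_right a0"] by auto
  define p where "p \<epsilon> = - (s + W$1$2 * \<epsilon>) / W$2$2" for \<epsilon>
  define Y where "Y \<epsilon> = mat33 (\<epsilon>\<^sup>2) (\<epsilon> * p \<epsilon>) (\<epsilon> * q) (\<epsilon> * p \<epsilon>) (a / W$2$2) 0 (\<epsilon> * q) 0 (1 / W$3$3)" for \<epsilon>
  have sym: "transpose (Y \<epsilon>) = Y \<epsilon>" for \<epsilon> unfolding Y_def by (rule mat33_symmetric)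
  define G where "G \<epsilon> = \<epsilon>\<^sup>2 * W$1$1 + 2 * \<epsilon> * p \<epsilon> * W$1$2" for \<epsilon>
  define H where "H \<epsilon> = W$1$3 * \<epsilon> * q" for \<epsilon>
  have tf: "trace_form W (Y \<epsilon>) (block_family (\<tau>, c)) = (exp \<tau>)\<^sup>2 * (G \<epsilon> + a + W$2$2 * (\<epsilon> * c)\<^sup>2 - 2 * s * (\<epsilon> * c))
      + 2 / exp \<tau> * (H \<epsilon> + s * (\<epsilon> * c)) + 1 / (exp \<tau>) ^ 4" for \<epsilon> \<tau> c
  proof -
    have "p \<epsilon> * W$2$2 = - s - W$1$2 * \<epsilon>" using m by (simp add: p_def)
    then have 1: "\<epsilon>\<^sup>2 * (W$1$1 + 2 * c * W$1$2 + c\<^sup>2 * W$2$2) + 2 * (\<epsilon> * p \<epsilon>) * (W$1$2 + c * W$2$2)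
        = G \<epsilon> + W$2$2 * (\<epsilon> * c)\<^sup>2 - 2 * s * (\<epsilon> * c)"
      unfolding G_def by algebra
    have 2: "W$1$3 * (\<epsilon> * q) + W$2$3 * (0 + c * (\<epsilon> * q)) = H \<epsilon> + s * (\<epsilon> * c)"
      by (simp add: H_def s_def algebra_simps)
    have 3: "a / W$2$2 * W$2$2 = a" "W$3$3 * (1 / W$3$3) = 1" using m by auto
    show ?thesis
      unfolding trace_form_block_family_general[OF W sym] unfolding Y_def mat33_nth 1 2 3 by simp
  qed
  have tf1: "trace_form W (Y \<epsilon>) (mat 1) = G \<epsilon> + a + 2 * H \<epsilon> + 1" for \<epsilon>
    using tf[of \<epsilon> 0 0] block_family.E_0 by (simp add: zero_prod_def)
  have lim_p: "(p \<longlongrightarrow> p 0) (at_right 0)" unfolding p_def using m by (intro tendsto_intros) auto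
  have lim_G: "(G \<longlongrightarrow> 0) (at_right 0)"
  proof -
    have "(G \<longlongrightarrow> 0\<^sup>2 * W$1$1 + 2 * 0 * p 0 * W$1$2) (at_right 0)"
      unfolding G_def by (intro tendsto_intros lim_p)
    then show ?thesis by simp
  qed
  have lim_H: "(H \<longlongrightarrow> 0) (at_right 0)"
  proof -
    have "(H \<longlongrightarrow> W$1$3 * 0 * q) (at_right 0)" unfolding H_def by (intro tendsto_intros)
    then show ?thesis by simp
  qed
  have "\<forall>\<^sub>F \<epsilon> in at_right 0. \<forall>z\<in>P. trace_form W (Y \<epsilon>) (mat 1) \<le> trace_form W (Y \<epsilon>) (block_family z)"
  proof (rule eventually_ball_finite[OF P(1)], rule ballI)
    fix z assume z: "z \<in> P"
    obtain \<tau> c where zc: "z = (\<tau>, c)" by (cases z)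
    show "\<forall>\<^sub>F \<epsilon> in at_right 0. trace_form W (Y \<epsilon>) (mat 1) \<le> trace_form W (Y \<epsilon>) (block_family z)"
    proof (cases "\<tau> = 0")
      case True
      have "trace_form W (Y \<epsilon>) (block_family z) = trace_form W (Y \<epsilon>) (mat 1) + W$2$2 * (\<epsilon> * c)\<^sup>2" for \<epsilon>
        by (simp add: zc tf tf1 True algebra_simps)
      then show ?thesis using m by simp
    next
      case False
      define y where "y = (exp \<tau>)\<^sup>2"
      have y: "y > 0" "(exp \<tau>) ^ 4 = y\<^sup>2" by (simp_all add: y_def flip: power_mult)
      have "((\<lambda>\<epsilon>. trace_form W (Y \<epsilon>) (block_family z) - trace_form W (Y \<epsilon>) (mat 1)) \<longlongrightarrow>
          (exp \<tau>)\<^sup>2 * (0 + a + W$2$2 * (0 * c)\<^sup>2 - 2 * s * (0 * c)) + 2 / exp \<tau> * (0 + s * (0 * c)) + 1 / (exp \<tau>) ^ 4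
          - (0 + a + 2 * 0 + 1)) (at_right 0)"
        unfolding zc tf tf1 by (intro tendsto_intros lim_G lim_H) auto
      moreover have "y < 1 \<or> y1 \<le> y"
      proof (cases "\<tau> < 0")
        case True
        then have "exp \<tau> < 1" by simp
        then have "(exp \<tau>)\<^sup>2 < 1\<^sup>2" by (intro power_strict_mono) auto
        then show ?thesis by (simp add: y_def)
      next
        assume "\<not> \<tau> < 0"
        then have "\<tau>1 \<le> \<tau>" using gap[OF z] False by (auto simp: zc)
        then show ?thesis unfolding y_def y1_def e1_def by (intro disjI2 power_mono) auto
      qed
      then have "0 < (y - 1) * a + 1 / y\<^sup>2 - 1"
        using y1 a(3,4) y(1) unfolding a0_def by (intro exp_profile_pos)
      then have "0 < (exp \<tau>)\<^sup>2 * (0 + a + W$2$2 * (0 * c)\<^sup>2 - 2 * s * (0 * c)) + 2 / exp \<tau> * (0 + s * (0 * c)) + 1 / (exp \<tau>) ^ 4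
          - (0 + a + 2 * 0 + 1)"
        unfolding y(2) y_def[symmetric] by (simp add: algebra_simps)
      ultimately have "\<forall>\<^sub>F \<epsilon> in at_right 0. 0 < trace_form W (Y \<epsilon>) (block_family z) - trace_form W (Y \<epsilon>) (mat 1)"
        by (rule order_tendstoD(1))
      then show ?thesis by eventually_elim simp
    qed
  qed
  moreover have "\<forall>\<^sub>F \<epsilon> in at_right 0. y1 * (G \<epsilon> + a + W$2$2 * ((\<epsilon> * c0)\<^sup>2 - X\<^sup>2)) + 2 / e1 * H \<epsilon> + 1 / y1\<^sup>2 - (G \<epsilon> + a + 2 * H \<epsilon> + 1) < 0"
  proof (rule order_tendstoD(2))
    show "((\<lambda>\<epsilon>. y1 * (G \<epsilon> + a + W$2$2 * ((\<epsilon> * c0)\<^sup>2 - X\<^sup>2)) + 2 / e1 * H \<epsilon> + 1 / y1\<^sup>2 - (G \<epsilon> + a + 2 * H \<epsilon> + 1)) \<longlongrightarrow>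
        y1 * (0 + a + W$2$2 * ((0 * c0)\<^sup>2 - X\<^sup>2)) + 2 / e1 * 0 + 1 / y1\<^sup>2 - (0 + a + 2 * 0 + 1)) (at_right 0)"
      by (intro tendsto_intros lim_G lim_H)
    show "y1 * (0 + a + W$2$2 * ((0 * c0)\<^sup>2 - X\<^sup>2)) + 2 / e1 * 0 + 1 / y1\<^sup>2 - (0 + a + 2 * 0 + 1) < 0"
      using a(2) by (simp add: algebra_simps)
  qed
  moreover have "\<forall>\<^sub>F \<epsilon> in at_right 0. 0 < det' a q (p \<epsilon>)"
  proof (rule order_tendstoD(1))
    show "((\<lambda>\<epsilon>. det' a q (p \<epsilon>)) \<longlongrightarrow> det' a q (p 0)) (at_right 0)"
      unfolding det'_def using m by (intro tendsto_intros lim_p) auto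
    show "0 < det' a q (p 0)" using a(1) by (simp add: p_def)
  qed
  moreover have "\<forall>\<^sub>F \<epsilon> in at_right (0::real). \<epsilon> > 0" by (rule eventually_at_right_less)
  ultimately have "\<forall>\<^sub>F \<epsilon> in at_right 0. \<epsilon> > 0 \<and> 0 < det' a q (p \<epsilon>) \<and>
      y1 * (G \<epsilon> + a + W$2$2 * ((\<epsilon> * c0)\<^sup>2 - X\<^sup>2)) + 2 / e1 * H \<epsilon> + 1 / y1\<^sup>2 < G \<epsilon> + a + 2 * H \<epsilon> + 1 \<and>
      (\<forall>z\<in>P. trace_form W (Y \<epsilon>) (mat 1) \<le> trace_form W (Y \<epsilon>) (block_family z))"
    by eventually_elim simp
  then obtain \<epsilon> where \<epsilon>: "\<epsilon> > 0" "0 < det' a q (p \<epsilon>)"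
      "y1 * (G \<epsilon> + a + W$2$2 * ((\<epsilon> * c0)\<^sup>2 - X\<^sup>2)) + 2 / e1 * H \<epsilon> + 1 / y1\<^sup>2 < G \<epsilon> + a + 2 * H \<epsilon> + 1"
      "\<forall>z\<in>P. trace_form W (Y \<epsilon>) (mat 1) \<le> trace_form W (Y \<epsilon>) (block_family z)"
    using eventually_happens[of _ "at_right (0::real)"] by auto
  have YP: "Y \<epsilon> \<in> pos_def"
  proof (rule pos_defI[OF sym])
    show "Y \<epsilon> $ 1 $ 1 > 0" using \<epsilon>(1) by (simp add: Y_def)
    have "det (Y \<epsilon>) = \<epsilon>\<^sup>2 * det' a q (p \<epsilon>)"
      unfolding det_symmetric_3[OF sym] unfolding Y_def mat33_nth det'_def
      by (simp add: power_mult_distrib right_diff_distrib)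
    then show "det (Y \<epsilon>) > 0" using \<epsilon>(1,2) by simp
    have "0 \<le> q\<^sup>2 * a / W$2$2" using a(3) a0(1) m by simp
    then have "0 < (a / W$2$2 - (p \<epsilon>)\<^sup>2) / W$3$3" using \<epsilon>(2) unfolding det'_def diff_divide_distrib by linarith
    then have "0 < a / W$2$2 - (p \<epsilon>)\<^sup>2" using m by (simp add: zero_less_divide_iff)
    then have "0 < \<epsilon>\<^sup>2 * (a / W$2$2 - (p \<epsilon>)\<^sup>2)" using \<epsilon>(1) by simp
    then show "Y \<epsilon> $ 1 $ 1 * Y \<epsilon> $ 2 $ 2 - (Y \<epsilon> $ 1 $ 2)\<^sup>2 > 0"
      by (simp add: Y_def power_mult_distrib right_diff_distrib)
  qed
  \<comment> \<open>Rounding inside the coset of \<open>z1\<close> by multiples of (0, c0) leaves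
    the parameter \<tau>1 unchanged and brings \<epsilon> c within
    \<open>\<epsilon> * \<bar>c0\<bar>\<close> of \<open>X\<close>.\<close>
  define j where "j = \<lfloor>(X / \<epsilon> - snd z1) / c0\<rfloor>"
  define g where "g = z1 + of_int j *\<^sub>R (0, c0)"
  have g: "g \<in> ?\<Lambda>" unfolding g_def by (intro int_span_closed(3) \<tau>1 int_span_scale c0)
  have fg: "fst g = \<tau>1" by (simp add: g_def z1)
  have "\<bar>X / \<epsilon> - snd g\<bar> \<le> \<bar>c0\<bar>"
  proof -
    define r where "r = (X / \<epsilon> - snd z1) / c0"
    have "r * c0 = X / \<epsilon> - snd z1" using c0(2) by (simp add: r_def)
    then have "X / \<epsilon> - snd g = (r - of_int \<lfloor>r\<rfloor>) * c0"
      unfolding g_def j_def r_def[symmetric] by (simp add: left_diff_distrib)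
    moreover have "\<bar>r - of_int \<lfloor>r\<rfloor>\<bar> \<le> 1" by linarith
    ultimately show ?thesis by (simp add: abs_mult mult_left_le_one_le)
  qed
  then have "\<epsilon> * \<bar>X / \<epsilon> - snd g\<bar> \<le> \<epsilon> * \<bar>c0\<bar>" using \<epsilon>(1) by simp
  then have "\<bar>\<epsilon> * snd g - X\<bar> \<le> \<epsilon> * \<bar>c0\<bar>"
    using \<epsilon>(1) by (simp add: abs_mult_pos' right_diff_distrib abs_minus_commute)
  then have near: "(\<epsilon> * snd g - X)\<^sup>2 \<le> (\<epsilon> * c0)\<^sup>2"
    using power_mono[OF _ abs_ge_zero, of "\<epsilon> * snd g - X" "\<epsilon> * \<bar>c0\<bar>" 2] by (simp add: power_mult_distrib)
  have "trace_form W (Y \<epsilon>) (block_family g) = y1 * (G \<epsilon> + a + W$2$2 * ((\<epsilon> * snd g - X)\<^sup>2 - X\<^sup>2)) + 2 / e1 * H \<epsilon> + 1 / y1\<^sup>2"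
  proof -
    have X': "W$2$2 * X = s * (1 - 1 / e1 ^ 3)" using m by (simp add: X_def)
    have eX: "e1\<^sup>2 * (W$2$2 * X) = s * (e1\<^sup>2 - 1 / e1)"
      unfolding X' using e1 by (simp add: field_simps power2_eq_square power3_eq_cube)
    define d where "d = 1 / e1"
    define x where "x = \<epsilon> * snd g"
    have "e1\<^sup>2 * (G \<epsilon> + a + W$2$2 * x\<^sup>2 - 2 * s * x) + 2 * d * (H \<epsilon> + s * x)
        = e1\<^sup>2 * (G \<epsilon> + a + W$2$2 * ((x - X)\<^sup>2 - X\<^sup>2)) + 2 * d * H \<epsilon>"
      using eX unfolding d_def[symmetric] by algebra
    moreover have "e1 ^ 4 = y1\<^sup>2" by (simp add: y1_def flip: power_mult)
    moreover have "g = (\<tau>1, snd g)" by (simp add: prod_eq_iff fg)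
    ultimately show ?thesis
      using tf[of \<epsilon> \<tau>1 "snd g"] unfolding e1_def[symmetric] by (simp add: d_def x_def y1_def)
  qed
  also have "\<dots> \<le> y1 * (G \<epsilon> + a + W$2$2 * ((\<epsilon> * c0)\<^sup>2 - X\<^sup>2)) + 2 / e1 * H \<epsilon> + 1 / y1\<^sup>2"
    using y1 m near by (intro add_right_mono mult_left_mono add_left_mono diff_right_mono) auto
  also have "\<dots> < trace_form W (Y \<epsilon>) (mat 1)" using \<epsilon>(3) by (simp add: tf1)
  finally have "trace_form W (Y \<epsilon>) (block_family g) < trace_form W (Y \<epsilon>) (mat 1)" .
  then show "\<exists>Y\<in>pos_def. (\<forall>z\<in>P. trace_form W Y (mat 1) \<le> trace_form W Y (block_family z)) \<and>
      (\<exists>z\<in>?\<Lambda>. trace_form W Y (block_family z) < trace_form W Y (mat 1))"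
    using YP \<epsilon>(4) g by blast
qed

text \<open>The two preceding constructions cover the lattices without and with a nonzero element
  (0, c), that is, the groups without and with nontrivial unipotent elements.\<close>

lemma not_finitely_determined_block_lattice:
  assumes "W \<in> P3" "W$2$3 \<noteq> 0" "fst u * snd v \<noteq> snd u * fst v"
  shows "\<not> finitely_determined W (block_family ` int_span u v)"
  using not_finitely_determined_block_generic[OF assms(1,3)] not_finitely_determined_block_special[OF assms]
  by blast

section \<open>The classification\<close>

lemma isCont_mat33:
  assumes "isCont a x" "isCont b x" "isCont c x" "isCont d x" "isCont e x" "isCont f x"
    "isCont g x" "isCont h x" "isCont i x"
  shows "isCont (\<lambda>z. mat33 (a z) (b z) (c z) (d z) (e z) (f z) (g z) (h z) (i z)) x"
proof -
  let ?M = "\<lambda>z. mat33 (a z) (b z) (c z) (d z) (e z) (f z) (g z) (h z) (i z)"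
  have "((\<lambda>z. ?M z $ k $ l) \<longlongrightarrow> ?M x $ k $ l) (at x)" for k l
    using exhaust_3[of k] exhaust_3[of l] assms by (elim disjE) (simp_all add: isCont_def)
  then show ?thesis unfolding isCont_def by (intro vec_tendstoI)
qed

lemma isCont_diag_family: "isCont diag_family z"
  unfolding diag_family_def[abs_def] diag3_def by (intro isCont_mat33 continuous_intros)

lemma isCont_block_family: "isCont block_family z"
  unfolding block_family_def[abs_def] by (intro isCont_mat33 continuous_intros)

lemma diag_family_eq_mat_1D:
  assumes "diag_family z = mat 1"
  shows "z = 0"
  using arg_cong[OF assms, of "\<lambda>M. M$1$1"] arg_cong[OF assms, of "\<lambda>M. M$2$2"]
  by (simp add: diag_family_def diag3_def prod_eq_iff)

lemma block_family_eq_mat_1D: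
  assumes "block_family z = mat 1"
  shows "z = 0"
  using arg_cong[OF assms, of "\<lambda>M. M$1$1"] arg_cong[OF assms, of "\<lambda>M. M$1$2"]
  by (simp add: block_family_def prod_eq_iff)

lemma diag3_exp:
  assumes "r + s + t = 0"
  shows "diag3 (exp r) (exp s) (exp t) = diag_family (r, s)"
proof -
  have "t = - r - s" using assms by linarith
  then show ?thesis by (simp add: diag_family_def)
qed

lemma block_mat_eq: "block_mat t a = block_family (t, a * exp (- t))"
  by (simp add: block_mat_def block_family_def exp_minus field_simps)

text \<open>A generator may be replaced by its inverse; cyclic type 4 thereby reduces to t >
  0.\<close>

lemma range_int_scaleR_uminus:
  "range (\<lambda>n::int. f (of_int n *\<^sub>R - u)) = range (\<lambda>n::int. f (of_int n *\<^sub>R u))" for u :: "'a::real_vector"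
proof (intro subset_antisym image_subsetI)
  fix n :: int
  show "f (of_int n *\<^sub>R - u) \<in> range (\<lambda>n::int. f (of_int n *\<^sub>R u))"
    by (rule range_eqI[of _ _ "- n"]) simp
  show "f (of_int n *\<^sub>R u) \<in> range (\<lambda>n::int. f (of_int n *\<^sub>R - u))"
    by (rule range_eqI[of _ _ "- n"]) simp
qed

lemma two_generated_type_conjugate: "two_generated_type \<Gamma> A B \<Longrightarrow> conjugate_SL3 \<Gamma> (generate SL3 {A, B})"
  by (simp add: two_generated_type_def)

context
  fixes \<Gamma> :: "(real^3^3) set"
  assumes \<Gamma>: "subgroup \<Gamma> SL3" "discrete \<Gamma>"
begin

lemma cyclic_type_1_finitely_sided:
  assumes "cyclic_type_1 \<Gamma>"
  shows "\<forall>X\<in>P3. finitely_sided (DS X \<Gamma>)"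
proof -
  have "mat33 1 1 0 0 1 0 0 0 1 = row_unipotent (1, 0)" by (simp add: row_unipotent_def)
  then have "conjugate_SL3 \<Gamma> (range (\<lambda>n::int. row_unipotent (of_int n *\<^sub>R (1, 0))))"
    using assms unfolding cyclic_type_1_def by (simp only: row_unipotent.generate_singleton_eq)
  then show ?thesis
    using DS_finitely_sided_conjugate[OF \<Gamma>] finitely_determined_row_unipotent_cyclic by blast
qed

lemma cyclic_type_3_finitely_sided:
  assumes "cyclic_type_3 \<Gamma>"
  shows "\<forall>X\<in>P3. finitely_sided (DS X \<Gamma>)"
proof -
  obtain r s t where rst: "r + s + t = 0" "r \<noteq> 0" "s \<noteq> 0" "t \<noteq> 0"
    and conj: "conjugate_SL3 \<Gamma> (generate SL3 {diag3 (exp r) (exp s) (exp t)})"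
    using assms unfolding cyclic_type_3_def by blast
  have "weight i (r, s) \<noteq> 0" for i using rst by (auto simp: weight_def)
  then have "finitely_determined W (range (\<lambda>n::int. diag_family (of_int n *\<^sub>R (r, s))))" if "W \<in> P3" for W
    using finitely_determined_diag_cyclic[OF that, of "(r, s)"] by (simp add: image_image)
  then show ?thesis
    using DS_finitely_sided_conjugate[OF \<Gamma>] conj
    unfolding diag3_exp[OF rst(1)] diag_family.generate_singleton_eq by blast
qed

lemma cyclic_type_4_finitely_sided:
  assumes "cyclic_type_4 \<Gamma>"
  shows "\<forall>X\<in>P3. finitely_sided (DS X \<Gamma>)"
proof -
  obtain t where t: "t \<noteq> 0" and conj: "conjugate_SL3 \<Gamma> (generate SL3 {block_mat t 1})"
    using assms unfolding cyclic_type_4_def by blast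
  have "finitely_determined W (range (\<lambda>n::int. block_family (of_int n *\<^sub>R (t, 1 * exp (- t)))))" if "W \<in> P3" for W
  proof (cases "t > 0")
    case True
    then show ?thesis by (rule finitely_determined_block_cyclic[OF that])
  next
    case False
    then have "- t > 0" using t by simp
    from finitely_determined_block_cyclic[OF that this, of "- exp (- t)"]
    show ?thesis
      using range_int_scaleR_uminus[of block_family "(t, exp (- t))"] by simp
  qed
  then show ?thesis
    using DS_finitely_sided_conjugate[OF \<Gamma>] conj
    unfolding block_mat_eq block_family.generate_singleton_eq by blast
qed

lemma two_type_1_finitely_sided:
  assumes "two_type_1 \<Gamma>"
  shows "\<forall>X\<in>P3. finitely_sided (DS X \<Gamma>)"
proof -
  have eq: "mat33 1 1 0 0 1 0 0 0 1 = row_unipotent (1, 0)" "mat33 1 0 1 0 1 0 0 0 1 = row_unipotent (0, 1)"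
    by (simp_all add: row_unipotent_def)
  have "conjugate_SL3 \<Gamma> (row_unipotent ` int_span (1, 0) (0, 1))"
    using two_generated_type_conjugate[OF assms[unfolded two_type_1_def]]
    unfolding eq row_unipotent.generate_eq .
  then show ?thesis
    using DS_finitely_sided_conjugate[OF \<Gamma>] finitely_determined_row_unipotent by blast
qed

lemma two_type_3_finitely_sided:
  assumes "two_type_3 \<Gamma>"
  shows "\<forall>X\<in>P3. finitely_sided (DS X \<Gamma>)"
proof -
  obtain r s t r' s' t' where rst: "r + s + t = 0" "r' + s' + t' = 0"
    and "two_generated_type \<Gamma> (diag3 (exp r) (exp s) (exp t)) (diag3 (exp r') (exp s') (exp t'))"
    using assms unfolding two_type_3_def by blast
  then have type: "two_generated_type \<Gamma> (diag_family (r, s)) (diag_family (r', s'))"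
    by (simp only: diag3_exp)
  \<comment> \<open>The parameters span a lattice of rank two because the group is discrete and not
    cyclic.\<close>
  have "fst (r, s) * snd (r', s') \<noteq> snd (r, s) * fst (r', s')"
    by (rule diag_family.two_generated_type_independent[OF \<Gamma> type isCont_diag_family diag_family_eq_mat_1D])
  then show ?thesis
    using DS_finitely_sided_conjugate[OF \<Gamma> two_generated_type_conjugate[OF type]] finitely_determined_diag_lattice
    unfolding diag_family.generate_eq by blast
qed

lemma cyclic_type_2_infinitely_sided:
  assumes "cyclic_type_2 \<Gamma>"
  shows "\<exists>U. dense_P3 U \<and> zariski_open_P3 U \<and> (\<forall>X\<in>U. infinitely_sided (DS X \<Gamma>))"
proof -
  have eq: "mat33 1 1 0 0 1 1 0 0 1 = jordan_unipotent (1, - 1 / 2)" by (simp add: jordan_unipotent_def)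
  have "\<not> finitely_determined W (range (\<lambda>n::int. jordan_unipotent (of_int n *\<^sub>R (1, - 1 / 2))))" if "W \<in> P3" for W
    using not_finitely_determined_jordan_cyclic[OF that] unfolding image_image .
  then show ?thesis
    using DS_infinitely_sided_conjugate[OF \<Gamma>] assms
    unfolding cyclic_type_2_def eq jordan_unipotent.generate_singleton_eq by blast
qed

lemma cyclic_type_3'_infinitely_sided:
  assumes "cyclic_type_3' \<Gamma>"
  shows "\<exists>U. dense_P3 U \<and> zariski_open_P3 U \<and> (\<forall>X\<in>U. infinitely_sided (DS X \<Gamma>))"
proof -
  obtain s where s: "s \<noteq> 0" and conj: "conjugate_SL3 \<Gamma> (generate SL3 {diag3 (exp s) (exp (- s)) 1})"
    using assms unfolding cyclic_type_3'_def by blast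
  have eq: "diag3 (exp s) (exp (- s)) 1 = diag_family (s, - s)" by (simp add: diag_family_def)
  have "\<not> finitely_determined W (range (\<lambda>n::int. diag_family (of_int n *\<^sub>R (s, - s))))"
    if "W \<in> P3" "W$1$3 \<noteq> 0" "W$2$3 \<noteq> 0" for W
    using not_finitely_determined_diag[OF that s] unfolding image_image .
  then show ?thesis
    using DS_infinitely_sided_conjugate[OF \<Gamma>] conj
    unfolding eq diag_family.generate_singleton_eq by blast
qed

lemma two_type_1'_infinitely_sided:
  assumes "two_type_1' \<Gamma>"
  shows "\<exists>U. dense_P3 U \<and> zariski_open_P3 U \<and> (\<forall>X\<in>U. infinitely_sided (DS X \<Gamma>))"
proof -
  have eq: "mat33 1 0 0 0 1 1 0 0 1 = col_unipotent (0, 1)" "mat33 1 0 1 0 1 0 0 0 1 = col_unipotent (1, 0)"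
    by (simp_all add: col_unipotent_def)
  have "conjugate_SL3 \<Gamma> (col_unipotent ` int_span (0, 1) (1, 0))"
    using two_generated_type_conjugate[OF assms[unfolded two_type_1'_def]]
    unfolding eq col_unipotent.generate_eq .
  then show ?thesis
    using DS_infinitely_sided_conjugate[OF \<Gamma>] not_finitely_determined_col_unipotent by blast
qed

lemma two_type_2_infinitely_sided:
  assumes "two_type_2 \<Gamma>"
  shows "\<exists>U. dense_P3 U \<and> zariski_open_P3 U \<and> (\<forall>X\<in>U. infinitely_sided (DS X \<Gamma>))"
proof -
  obtain a b where ab: "b \<noteq> a * (a - 1) / 2"
    and "two_generated_type \<Gamma> (mat33 1 1 0 0 1 1 0 0 1) (mat33 1 a b 0 1 a 0 0 1)"
    using assms unfolding two_type_2_def by blast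
  moreover have eq: "mat33 1 1 0 0 1 1 0 0 1 = jordan_unipotent (1, - 1 / 2)"
    "mat33 1 a b 0 1 a 0 0 1 = jordan_unipotent (a, b - a\<^sup>2 / 2)"
    by (simp_all add: jordan_unipotent_def)
  ultimately have type: "two_generated_type \<Gamma> (jordan_unipotent (1, - 1 / 2)) (jordan_unipotent (a, b - a\<^sup>2 / 2))"
    by simp
  \<comment> \<open>Linear independence of the two logarithms is exactly the condition on b.\<close>
  have "fst (1, - 1 / 2) * snd (a, b - a\<^sup>2 / 2) \<noteq> snd (1, - 1 / 2) * fst (a, b - a\<^sup>2 / 2)"
    using ab by (simp add: power2_eq_square field_simps)
  then show ?thesis
    using DS_infinitely_sided_conjugate[OF \<Gamma> two_generated_type_conjugate[OF type]]
      not_finitely_determined_jordan_lattice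
    unfolding jordan_unipotent.generate_eq by blast
qed

lemma two_type_4_infinitely_sided:
  assumes "two_type_4 \<Gamma>"
  shows "\<exists>U. dense_P3 U \<and> zariski_open_P3 U \<and> (\<forall>X\<in>U. infinitely_sided (DS X \<Gamma>))"
proof -
  obtain s t a where "two_generated_type \<Gamma> (block_mat t 1) (block_mat s a)"
    using assms unfolding two_type_4_def by blast
  then have type: "two_generated_type \<Gamma> (block_family (t, 1 * exp (- t))) (block_family (s, a * exp (- s)))"
    by (simp only: block_mat_eq)
  have "fst (t, 1 * exp (- t)) * snd (s, a * exp (- s)) \<noteq> snd (t, 1 * exp (- t)) * fst (s, a * exp (- s))"
    by (rule block_family.two_generated_type_independent[OF \<Gamma> type isCont_block_family block_family_eq_mat_1D])
  then show ?thesis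
    using DS_infinitely_sided_conjugate[OF \<Gamma> two_generated_type_conjugate[OF type]]
      not_finitely_determined_block_lattice
    unfolding block_family.generate_eq by blast
qed

end

theorem theorem6p1:
  fixes \<Gamma> :: "(real^3^3) set"
  assumes "subgroup \<Gamma> SL3"
    and "discrete \<Gamma>"
    and "free_abelian (SL3\<lparr>carrier := \<Gamma>\<rparr>)"
    and "\<exists>S\<subseteq>carrier SL3. \<Gamma> = generate SL3 S \<and> (\<forall>A\<in>S. positive_eigenvalues A)"
  shows "(cyclic_type_1 \<Gamma> \<or> cyclic_type_3 \<Gamma> \<or> cyclic_type_4 \<Gamma> \<or>
            two_type_1 \<Gamma> \<or> two_type_3 \<Gamma> \<longrightarrow>
            (\<forall>X\<in>P3. finitely_sided (DS X \<Gamma>))) \<and>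
         (cyclic_type_2 \<Gamma> \<or> cyclic_type_3' \<Gamma> \<or>
            two_type_1' \<Gamma> \<or> two_type_2 \<Gamma> \<or> two_type_4 \<Gamma> \<longrightarrow>
            (\<exists>U. dense_P3 U \<and> zariski_open_P3 U \<and>
                 (\<forall>X\<in>U. infinitely_sided (DS X \<Gamma>))))"
proof (intro conjI impI)
  assume "cyclic_type_1 \<Gamma> \<or> cyclic_type_3 \<Gamma> \<or> cyclic_type_4 \<Gamma> \<or> two_type_1 \<Gamma> \<or> two_type_3 \<Gamma>"
  then show "\<forall>X\<in>P3. finitely_sided (DS X \<Gamma>)"
    by (elim disjE)
      (rule cyclic_type_1_finitely_sided[OF assms(1,2)] cyclic_type_3_finitely_sided[OF assms(1,2)]
        cyclic_type_4_finitely_sided[OF assms(1,2)] two_type_1_finitely_sided[OF assms(1,2)]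
        two_type_3_finitely_sided[OF assms(1,2)]; assumption)+
next
  assume "cyclic_type_2 \<Gamma> \<or> cyclic_type_3' \<Gamma> \<or> two_type_1' \<Gamma> \<or> two_type_2 \<Gamma> \<or> two_type_4 \<Gamma>"
  then show "\<exists>U. dense_P3 U \<and> zariski_open_P3 U \<and> (\<forall>X\<in>U. infinitely_sided (DS X \<Gamma>))"
    by (elim disjE)
      (rule cyclic_type_2_infinitely_sided[OF assms(1,2)] cyclic_type_3'_infinitely_sided[OF assms(1,2)]
        two_type_1'_infinitely_sided[OF assms(1,2)] two_type_2_infinitely_sided[OF assms(1,2)]
        two_type_4_infinitely_sided[OF assms(1,2)]; assumption)+
qed

end
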